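(* Let $\mathbb{F}\in\{\mathbb{R},\mathbb{C},\mathbb{H}\}$ and $m=\dim_{\mathbb{R}}(\mathbb{F})=1,2,4$ respectively. Then $\widetilde{\mathcal{B}}_{4,\mathbb{F}}$ is a $(6m+1)$-dimensional orientable, connected, noncompact, austere, proper Dupin hypersurface of the unit sphere $S(4,\mathbb{F})$ with $5$ distinct principal curvatures of multiplicities $m$, $m$, $m$, $m$ and $2m+1$.
   Context: $A^*$ denotes the conjugate transpose. $E(4,\mathbb{F})=\{A\in M(4,\mathbb{F}): A^*=A,\ \operatorname{tr}A=0\}$ is a real vector space of dimension $6m+3$ with inner product $\langle A,B\rangle=\mathfrak{R}(\operatorname{tr}AB^* )$ ($\mathfrak{R}$ is the real part), and $S(4,\mathbb{F})$ is its unit sphere. $U(4,\mathbb{F})$ denotes $\operatorname{SO}(4)$, $\operatorname{U}(4)$, $\operatorname{Sp}(4)$ for $\mathbb{F}=\mathbb{R},\mathbb{C},\mathbb{H}$ respectively, acting by $P\cdot A=P^*AP$. $\mathcal{B}_{4,\mathbb{F}}$ is the set of $A\in S(4,\mathbb{F})$ with $\operatorname{tr}A^3=0$ that are regular points of the function $A\mapsto\operatorname{tr}A^3$ on $S(4,\mathbb{F})$; it is an embedded hypersurface of $S(4,\mathbb{F})$. Let $\widetilde{\mathcal{D}}_4=\{\operatorname{diag}(\lambda_1,-\lambda_1,\lambda_2,-\lambda_2)\in S(4,\mathbb{R}):\lambda_1>\lambda_2>0\}$ and $\widetilde{\mathcal{B}}_{4,\mathbb{F}}=U(4,\mathbb{F})\cdot\widetilde{\mathcal{D}}_4=\mathcal{B}_{4,\mathbb{F}}\cap\operatorname{GL}(4,\mathbb{F})$,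 an open subset of $\mathcal{B}_{4,\mathbb{F}}$ with the induced metric. A submanifold of a Riemannian manifold is austere if, for every normal vector $\xi$, all symmetric polynomials of odd degree in the eigenvalues of the shape operator $S_\xi$ vanish. A curvature surface of an oriented hypersurface $M$ is a (connected) submanifold $S\subset M$ whose tangent space at each point is a full principal space (eigenspace of the shape operator). $M$ is a Dupin hypersurface if along each curvature surface the corresponding principal curvature is constant; it is proper Dupin if in addition the number of distinct principal curvatures is constant on $M$. *)

theory Defs
  imports "HOL-Analysis.Analysis" "HOL-Library.Multiset"
begin

datatype quat = Quat (qre: real) (qi: real) (qj: real) (qk: real)

lemma quat_eq_iff: "x = y \<longleftrightarrow> qre x = qre y \<and> qi x = qi y \<and> qj x = qj y \<and> qk x = qk y"
  by (cases x; cases y) auto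

instantiation quat :: ring_1
begin

definition "0 = Quat 0 0 0 0"
definition "1 = Quat 1 0 0 0"
definition "x + y = Quat (qre x + qre y) (qi x + qi y) (qj x + qj y) (qk x + qk y)"
definition "- x = Quat (- qre x) (- qi x) (- qj x) (- qk x)"
definition "x - y = Quat (qre x - qre y) (qi x - qi y) (qj x - qj y) (qk x - qk y)" for x y :: quat
definition "x * y = Quat
  (qre x * qre y - qi x * qi y - qj x * qj y - qk x * qk y)
  (qre x * qi y + qi x * qre y + qj x * qk y - qk x * qj y)
  (qre x * qj y - qi x * qk y + qj x * qre y + qk x * qi y)
  (qre x * qk y + qi x * qj y - qj x * qi y + qk x * qre y)"

lemmas quat_defs = zero_quat_def one_quat_def plus_quat_def
    uminus_quat_def minus_quat_def times_quat_def

instance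
proof
  fix a b c :: quat
  show "a * b * c = a * (b * c)"
    by (simp add: quat_eq_iff quat_defs ring_distribs)
  show "a + b + c = a + (b + c)" "a + b = b + a" "0 + a = a" "- a + a = 0" "a - b = a + - b"
    "1 * a = a" "a * 1 = a" "0 \<noteq> (1::quat)"
    by (simp_all add: quat_eq_iff quat_defs)
  show "(a + b) * c = a * c + b * c" "a * (b + c) = a * b + a * c"
    by (simp_all add: quat_eq_iff quat_defs algebra_simps)
qed

end

lemma quat_sel [simp]:
  "qre 0 = 0" "qi 0 = 0" "qj 0 = 0" "qk 0 = 0"
  "qre 1 = 1" "qi 1 = 0" "qj 1 = 0" "qk 1 = 0"
  "qre (x + y) = qre x + qre y" "qi (x + y) = qi x + qi y"
  "qj (x + y) = qj x + qj y" "qk (x + y) = qk x + qk y"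
  "qre (- x) = - qre x" "qi (- x) = - qi x" "qj (- x) = - qj x" "qk (- x) = - qk x"
  "qre (x - y) = qre x - qre y" "qi (x - y) = qi x - qi y"
  "qj (x - y) = qj x - qj y" "qk (x - y) = qk x - qk y"
  "qre (x * y) = qre x * qre y - qi x * qi y - qj x * qj y - qk x * qk y"
  "qi (x * y) = qre x * qi y + qi x * qre y + qj x * qk y - qk x * qj y"
  "qj (x * y) = qre x * qj y - qi x * qk y + qj x * qre y + qk x * qi y"
  "qk (x * y) = qre x * qk y + qi x * qj y - qj x * qi y + qk x * qre y"
  by (simp_all add: zero_quat_def one_quat_def plus_quat_def uminus_quat_def
    minus_quat_def times_quat_def)

instantiation quat :: real_algebra_1
begin

definition "scaleR r x = Quat (r * qre x) (r * qi x) (r * qj x) (r * qk x)"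

instance
  by standard (simp_all add: quat_eq_iff scaleR_quat_def algebra_simps)

end

lemma quat_sel_scaleR [simp]:
  "qre (r *\<^sub>R x) = r * qre x" "qi (r *\<^sub>R x) = r * qi x"
  "qj (r *\<^sub>R x) = r * qj x" "qk (r *\<^sub>R x) = r * qk x"
  by (simp_all add: scaleR_quat_def)

instantiation quat :: real_inner
begin

definition "inner x y = qre x * qre y + qi x * qi y + qj x * qj y + qk x * qk y"
definition "norm (x :: quat) = sqrt (inner x x)"
definition "sgn (x :: quat) = x /\<^sub>R norm x"
definition "dist (x :: quat) y = norm (x - y)"
definition uniformity_quat_def [code del]:
  "(uniformity :: (quat \<times> quat) filter) = (INF e\<in>{0 <..}. principal {(x, y). dist x y < e})"
definition open_quat_def [code del]:
  "open (U :: quat set) \<longleftrightarrow> (\<forall>x\<in>U. eventually (\<lambda>(x', y). x' = x \<longrightarrow> y \<in> U) uniformity)"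

instance
proof
  fix x y z :: quat and r s :: real and U :: "quat set"
  show "sgn x = x /\<^sub>R norm x" by (rule sgn_quat_def)
  show "dist x y = norm (x - y)" by (rule dist_quat_def)
  show "(uniformity :: (quat \<times> quat) filter) = (INF e\<in>{0 <..}. principal {(x, y). dist x y < e})"
    by (rule uniformity_quat_def)
  show "open U \<longleftrightarrow> (\<forall>x\<in>U. eventually (\<lambda>(x', y). x' = x \<longrightarrow> y \<in> U) uniformity)"
    by (rule open_quat_def)
  show "inner x y = inner y x" "inner (x + y) z = inner x z + inner y z"
    "inner (r *\<^sub>R x) y = r * inner x y" "0 \<le> inner x x"
    by (simp_all add: inner_quat_def scaleR_quat_def algebra_simps)
  show "inner x x = 0 \<longleftrightarrow> x = 0"
    by (simp add: inner_quat_def quat_eq_iff add_nonneg_eq_0_iff conj_assoc)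
  show "norm x = sqrt (inner x x)" by (rule norm_quat_def)
qed

end

instantiation quat :: euclidean_space
begin

definition "Basis = {Quat 1 0 0 0, Quat 0 1 0 0, Quat 0 0 1 0, Quat 0 0 0 1}"

instance
proof
  show "(Basis :: quat set) \<noteq> {}" "finite (Basis :: quat set)"
    by (simp_all add: Basis_quat_def)
  show "inner u v = (if u = v then 1 else 0)" if "u \<in> Basis" "v \<in> Basis" for u v :: quat
    using that unfolding Basis_quat_def by (elim insertE emptyE) (simp_all add: inner_quat_def)
  show "(\<forall>u\<in>Basis. inner x u = 0) \<longleftrightarrow> x = 0" for x :: quat
    unfolding Basis_quat_def by (simp add: inner_quat_def quat_eq_iff [of x 0])
qed

end

lemma DIM_quat [simp]: "DIM(quat) = 4"
  by (simp add: Basis_quat_def)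

instantiation quat :: real_normed_div_algebra
begin

definition "inverse x = Quat (qre x) (- qi x) (- qj x) (- qk x) /\<^sub>R (norm x)\<^sup>2" for x :: quat
definition "x div y = x * inverse y" for x y :: quat

instance
proof
  fix x y :: quat and r :: real
  show "x div y = x * inverse y" by (rule divide_quat_def)
  show "inverse (0 :: quat) = 0"
    by (simp add: inverse_quat_def quat_eq_iff)
  let ?c = "Quat (qre x) (- qi x) (- qj x) (- qk x)"
  have nsq: "(norm x)\<^sup>2 = qre x * qre x + qi x * qi x + qj x * qj x + qk x * qk x"
    by (simp add: power2_norm_eq_inner inner_quat_def)
  have "?c * x = (norm x)\<^sup>2 *\<^sub>R 1" "x * ?c = (norm x)\<^sup>2 *\<^sub>R 1"
    by (simp_all add: quat_eq_iff nsq)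
  then show "inverse x * x = 1" "x * inverse x = 1" if "x \<noteq> 0"
    using that by (simp_all add: inverse_quat_def)
  have "inner (x * y) (x * y) = inner x x * inner y y"
    unfolding inner_quat_def quat_sel by algebra
  then show "norm (x * y) = norm x * norm y"
    by (simp only: norm_quat_def real_sqrt_mult)
qed

end

section \<open>Scalars with conjugation\<close>

text \<open>
  Common interface to real numbers, complex numbers and quaternions; \<open>m = dim\<^sub>R F\<close> is \<open>DIM('f)\<close>.
\<close>

class conjugation_algebra = real_normed_div_algebra + euclidean_space +
  fixes conjugate :: "'a \<Rightarrow> 'a"
  assumes conjugate_conjugate [simp]: "conjugate (conjugate x) = x"
    and conjugate_add: "conjugate (x + y) = conjugate x + conjugate y"
    and conjugate_mult: "conjugate (x * y) = conjugate y * conjugate x"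
    and conjugate_scaleR: "conjugate (r *\<^sub>R x) = r *\<^sub>R conjugate x"
    and mult_conjugate: "x * conjugate x = (norm x)\<^sup>2 *\<^sub>R 1"
    and inner_conjugate: "inner x y = inner (x * conjugate y) 1"

instantiation real :: conjugation_algebra
begin
definition conjugate_real :: "real \<Rightarrow> real" where "conjugate_real x = x"
instance by standard (simp_all add: conjugate_real_def power2_eq_square)
end

instantiation complex :: conjugation_algebra
begin
definition conjugate_complex :: "complex \<Rightarrow> complex" where "conjugate_complex = cnj"
instance
proof
  fix x y :: complex and r :: real
  show "conjugate (conjugate x) = x" "conjugate (x + y) = conjugate x + conjugate y"
    "conjugate (x * y) = conjugate y * conjugate x"
    "conjugate (r *\<^sub>R x) = r *\<^sub>R conjugate x"
    by (simp_all add: conjugate_complex_def)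
  show "x * conjugate x = (norm x)\<^sup>2 *\<^sub>R 1"
    unfolding cmod_power2 by (simp add: conjugate_complex_def complex_eq_iff power2_eq_square)
  show "inner x y = inner (x * conjugate y) 1"
    by (simp add: conjugate_complex_def inner_complex_def)
qed
end

instantiation quat :: conjugation_algebra
begin
definition conjugate_quat :: "quat \<Rightarrow> quat"
  where "conjugate_quat x = Quat (qre x) (- qi x) (- qj x) (- qk x)"
instance
proof
  fix x y :: quat and r :: real
  show "conjugate (conjugate x) = x" "conjugate (x + y) = conjugate x + conjugate y"
    "conjugate (r *\<^sub>R x) = r *\<^sub>R conjugate x"
    by (simp_all add: conjugate_quat_def quat_eq_iff)
  show "conjugate (x * y) = conjugate y * conjugate x"
    by (simp add: conjugate_quat_def quat_eq_iff)
  show "x * conjugate x = (norm x)\<^sup>2 *\<^sub>R 1"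
    unfolding power2_norm_eq_inner by (simp add: conjugate_quat_def quat_eq_iff inner_quat_def)
  show "inner x y = inner (x * conjugate y) 1"
    by (simp add: conjugate_quat_def inner_quat_def)
qed
end

text \<open>For all three scalar types the real part of \<open>z\<close> is its component along 1.\<close>

definition real_part :: "'f::conjugation_algebra \<Rightarrow> real" where
  "real_part z = inner z 1"

lemma real_part_simps: "real_part (x::real) = x" "real_part (z::complex) = Re z"
  "real_part (q::quat) = qre q"
  by (simp_all add: real_part_def inner_complex_def inner_quat_def)

definition adjoint_matrix :: "'f::conjugation_algebra^'n^'m \<Rightarrow> 'f^'m^'n" where
  "adjoint_matrix A = map_matrix conjugate (transpose A)"

lemma inner_matrix_eq: "inner A B = real_part (trace (A ** adjoint_matrix B))"
  for A B :: "'f::conjugation_algebra^'n^'n"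
  unfolding inner_vec_def real_part_def trace_def
  by (simp add: inner_sum_left adjoint_matrix_def matrix_matrix_mult_def transpose_def
    inner_conjugate[symmetric])

section \<open>Smooth maps and submanifolds of Euclidean spaces\<close>

text \<open>The predicate below is meant for open \<open>U\<close> (classes \<open>C\<^sup>n\<close>, via directional derivatives).\<close>

primrec times_differentiable_on ::
  "nat \<Rightarrow> 'a::euclidean_space set \<Rightarrow> ('a \<Rightarrow> 'b::euclidean_space) \<Rightarrow> bool" where
  "times_differentiable_on 0 U f \<longleftrightarrow> continuous_on U f"
| "times_differentiable_on (Suc n) U f \<longleftrightarrow>
     (\<forall>x\<in>U. f differentiable (at x)) \<and>
     (\<forall>v. times_differentiable_on n U (\<lambda>x. frechet_derivative f (at x) v))"

definition smooth_on :: "'a::euclidean_space set \<Rightarrow> ('a \<Rightarrow> 'b::euclidean_space) \<Rightarrow> bool" where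
  "smooth_on U f \<longleftrightarrow> (\<forall>n. times_differentiable_on n U f)"

text \<open>Embedded \<open>k\<close>-dimensional submanifolds, by slice charts \<open>\<phi> : U \<rightarrow> \<phi>(U)\<close> with inverse \<open>\<psi>\<close>.\<close>

definition embedded_submanifold :: "nat \<Rightarrow> 'a::euclidean_space set \<Rightarrow> bool" where
  "embedded_submanifold k M \<longleftrightarrow> (\<forall>p\<in>M. \<exists>U \<phi> \<psi> L.
     open U \<and> p \<in> U \<and> open (\<phi> ` U) \<and> smooth_on U \<phi> \<and> smooth_on (\<phi> ` U) \<psi> \<and>
     (\<forall>x\<in>U. \<psi> (\<phi> x) = x) \<and>
     subspace (L :: 'a set) \<and> dim L = k \<and> \<phi> ` (U \<inter> M) = \<phi> ` U \<inter> L)"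

definition hypersurface :: "nat \<Rightarrow> 'a::euclidean_space set \<Rightarrow> 'a set \<Rightarrow> bool" where
  "hypersurface k N M \<longleftrightarrow>
     embedded_submanifold (k + 1) N \<and> embedded_submanifold k M \<and> M \<subseteq> N"

text \<open>
  An immersed submanifold is a set with its own, possibly finer, topology \<open>T\<close>, in which every
  point has a neighbourhood that is an embedded submanifold of the Euclidean space.
\<close>

definition immersed_submanifold :: "nat \<Rightarrow> 'a::euclidean_space topology \<Rightarrow> bool" where
  "immersed_submanifold k T \<longleftrightarrow> second_countable T \<and>
     (\<forall>p\<in>topspace T. \<exists>W. openin T W \<and> p \<in> W \<and> embedded_submanifold k W \<and>
        subtopology T W = top_of_set W)"

text \<open>Tangent vectors are velocities of smooth curves that are continuous into \<open>T\<close>.\<close>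

definition immersed_tangent_space :: "'a::euclidean_space topology \<Rightarrow> 'a \<Rightarrow> 'a set" where
  "immersed_tangent_space T p = {v. \<exists>\<gamma> \<epsilon>. 0 < \<epsilon> \<and> smooth_on {-\<epsilon><..<\<epsilon>} \<gamma> \<and>
     continuous_map (top_of_set {-\<epsilon><..<\<epsilon>}) T \<gamma> \<and>
     \<gamma> 0 = p \<and> (\<gamma> has_vector_derivative v) (at (0::real))}"

definition tangent_space :: "'a::euclidean_space set \<Rightarrow> 'a \<Rightarrow> 'a set" where
  "tangent_space M p = immersed_tangent_space (top_of_set M) p"

lemma tangent_space_altdef:
  "tangent_space M p = {v. \<exists>\<gamma> \<epsilon>. 0 < \<epsilon> \<and> smooth_on {-\<epsilon><..<\<epsilon>} \<gamma> \<and> \<gamma> ` {-\<epsilon><..<\<epsilon>} \<subseteq> M \<and>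
     \<gamma> 0 = p \<and> (\<gamma> has_vector_derivative v) (at (0::real))}"
proof -
  have "continuous_map (top_of_set {-\<epsilon><..<\<epsilon>}) (top_of_set M) \<gamma> \<longleftrightarrow> \<gamma> ` {-\<epsilon><..<\<epsilon>} \<subseteq> M"
    if "smooth_on {-\<epsilon><..<\<epsilon>} \<gamma>" for \<gamma> :: "real \<Rightarrow> 'a" and \<epsilon>
  proof -
    have "times_differentiable_on 0 {-\<epsilon><..<\<epsilon>} \<gamma>"
      using that unfolding smooth_on_def by blast
    then show ?thesis by (auto simp: continuous_map_in_subtopology)
  qed
  then show ?thesis
    unfolding tangent_space_def immersed_tangent_space_def by (auto; blast)
qed

section \<open>Orientability\<close>

definition ordered_basis :: "nat \<Rightarrow> 'a::euclidean_space set \<Rightarrow> (nat \<Rightarrow> 'a) \<Rightarrow> bool" where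
  "ordered_basis k V b \<longleftrightarrow>
     inj_on b {..<k} \<and> independent (b ` {..<k}) \<and> span (b ` {..<k}) = V"

definition leibniz_det :: "nat \<Rightarrow> (nat \<Rightarrow> nat \<Rightarrow> real) \<Rightarrow> real" where
  "leibniz_det k C = (\<Sum>p | p permutes {..<k}. of_int (sign p) * (\<Prod>i<k. C i (p i)))"

definition same_orientation ::
  "nat \<Rightarrow> (nat \<Rightarrow> 'a::euclidean_space) \<Rightarrow> (nat \<Rightarrow> 'a) \<Rightarrow> bool" where
  "same_orientation k b c \<longleftrightarrow>
     (\<exists>C. (\<forall>j<k. c j = (\<Sum>i<k. C i j *\<^sub>R b i)) \<and> 0 < leibniz_det k C)"

text \<open>
  An orientation chooses at each \<open>p\<close> an orientation of the tangent space, represented by an ordered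
  basis \<open>b p\<close>; these have to agree locally with continuous frames. (\<open>b\<close> itself need not be
  continuous, so that no global frame is asked for.)
\<close>

definition orientable :: "nat \<Rightarrow> 'a::euclidean_space set \<Rightarrow> bool" where
  "orientable k M \<longleftrightarrow> (\<exists>b. \<forall>p\<in>M. ordered_basis k (tangent_space M p) (b p) \<and>
     (\<exists>U X. open U \<and> p \<in> U \<and> (\<forall>i<k. continuous_on (U \<inter> M) (X i)) \<and>
        (\<forall>q\<in>U \<inter> M. same_orientation k (b q) (\<lambda>i. X i q))))"

section \<open>Shape operators\<close>

text \<open>
  \<open>M \<subseteq> N\<close> are submanifolds of a Euclidean space with the induced metrics. The Levi-Civita
  connection of \<open>N\<close> is the tangential part of the Euclidean derivative.
\<close>

definition orth_proj :: "'a::euclidean_space set \<Rightarrow> 'a \<Rightarrow> 'a" where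
  "orth_proj V x = (THE y. y \<in> V \<and> (\<forall>z\<in>V. inner (x - y) z = 0))"

definition covariant_derivative ::
  "'a::euclidean_space set \<Rightarrow> ('a \<Rightarrow> 'a) \<Rightarrow> 'a \<Rightarrow> 'a \<Rightarrow> 'a" where
  "covariant_derivative N X p v = orth_proj (tangent_space N p) (frechet_derivative X (at p) v)"

definition normal_space :: "'a::euclidean_space set \<Rightarrow> 'a set \<Rightarrow> 'a \<Rightarrow> 'a set" where
  "normal_space N M p = {\<xi> \<in> tangent_space N p. \<forall>v\<in>tangent_space M p. inner \<xi> v = 0}"

text \<open>
  Weingarten formula: \<open>S\<^sub>\<xi> v\<close> is minus the component tangent to \<open>M\<close> of the derivative in direction
  \<open>v \<in> T\<^sub>pM\<close> of any local normal field \<open>X\<close> extending \<open>\<xi>\<close> (the result does not depend on \<open>X\<close>).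
\<close>

definition shape_operator ::
  "'a::euclidean_space set \<Rightarrow> 'a set \<Rightarrow> 'a \<Rightarrow> 'a \<Rightarrow> 'a \<Rightarrow> 'a" where
  "shape_operator N M p \<xi> v = (THE w. \<exists>U X. open U \<and> p \<in> U \<and> smooth_on U X \<and>
     (\<forall>q\<in>U \<inter> M. X q \<in> normal_space N M q) \<and> X p = \<xi> \<and>
     w = - orth_proj (tangent_space M p) (covariant_derivative N X p v))"

definition eigenspace :: "'a::real_vector set \<Rightarrow> ('a \<Rightarrow> 'a) \<Rightarrow> real \<Rightarrow> 'a set" where
  "eigenspace V S \<kappa> = {v \<in> V. S v = \<kappa> *\<^sub>R v}"

definition eigenvalues :: "'a::real_vector set \<Rightarrow> ('a \<Rightarrow> 'a) \<Rightarrow> real set" where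
  "eigenvalues V S = {\<kappa>. \<exists>v\<in>eigenspace V S \<kappa>. v \<noteq> 0}"

text \<open>The shape operator being self-adjoint, multiplicities are dimensions of eigenspaces.\<close>

definition eigenvalue_mset :: "'a::euclidean_space set \<Rightarrow> ('a \<Rightarrow> 'a) \<Rightarrow> real multiset" where
  "eigenvalue_mset V S = (\<Sum>\<kappa>\<in>eigenvalues V S. replicate_mset (dim (eigenspace V S \<kappa>)) \<kappa>)"

section \<open>Austere submanifolds\<close>

text \<open>Polynomials in \<open>n\<close> real variables are given as functions of \<open>x 0, \<dots>, x (n - 1)\<close>.\<close>

definition homogeneous_symmetric_poly :: "nat \<Rightarrow> nat \<Rightarrow> ((nat \<Rightarrow> real) \<Rightarrow> real) \<Rightarrow> bool" where
  "homogeneous_symmetric_poly n d f \<longleftrightarrow>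
     (\<exists>E c. finite E \<and> (\<forall>\<alpha>\<in>E. (\<Sum>i<n. \<alpha> i) = d) \<and>
        (\<forall>x. f x = (\<Sum>\<alpha>\<in>E. c \<alpha> * (\<Prod>i<n. x i ^ \<alpha> i)))) \<and>
     (\<forall>\<pi> x. \<pi> permutes {..<n} \<longrightarrow> f (x \<circ> \<pi>) = f x)"

definition austere :: "'a::euclidean_space set \<Rightarrow> 'a set \<Rightarrow> bool" where
  "austere N M \<longleftrightarrow> (\<forall>p\<in>M. \<forall>\<xi>\<in>normal_space N M p. \<forall>\<mu>.
     mset \<mu> = eigenvalue_mset (tangent_space M p) (shape_operator N M p \<xi>) \<longrightarrow>
     (\<forall>d f. odd d \<and> homogeneous_symmetric_poly (length \<mu>) d f \<longrightarrow> f (\<lambda>i. \<mu> ! i) = 0))"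

section \<open>Oriented hypersurfaces and the Dupin condition\<close>

definition unit_normal_field ::
  "'a::euclidean_space set \<Rightarrow> 'a set \<Rightarrow> ('a \<Rightarrow> 'a) \<Rightarrow> bool" where
  "unit_normal_field N M \<nu> \<longleftrightarrow>
     (\<forall>p\<in>M. \<nu> p \<in> normal_space N M p \<and> norm (\<nu> p) = 1 \<and>
        (\<exists>U X. open U \<and> p \<in> U \<and> smooth_on U X \<and> (\<forall>q\<in>U \<inter> M. X q = \<nu> q)))"

definition principal_space ::
  "'a::euclidean_space set \<Rightarrow> 'a set \<Rightarrow> ('a \<Rightarrow> 'a) \<Rightarrow> 'a \<Rightarrow> real \<Rightarrow> 'a set" where
  "principal_space N M \<nu> p \<kappa> = eigenspace (tangent_space M p) (shape_operator N M p (\<nu> p)) \<kappa>"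

definition principal_curvatures ::
  "'a::euclidean_space set \<Rightarrow> 'a set \<Rightarrow> ('a \<Rightarrow> 'a) \<Rightarrow> 'a \<Rightarrow> real set" where
  "principal_curvatures N M \<nu> p = eigenvalues (tangent_space M p) (shape_operator N M p (\<nu> p))"

definition curvature_surface ::
  "'a::euclidean_space set \<Rightarrow> 'a set \<Rightarrow> ('a \<Rightarrow> 'a) \<Rightarrow> 'a topology \<Rightarrow> bool" where
  "curvature_surface N M \<nu> T \<longleftrightarrow>
     topspace T \<subseteq> M \<and> connected_space T \<and> (\<exists>k. immersed_submanifold k T) \<and>
     (\<forall>p\<in>topspace T. \<exists>\<kappa>\<in>principal_curvatures N M \<nu> p.
        immersed_tangent_space T p = principal_space N M \<nu> p \<kappa>)"

definition dupin :: "'a::euclidean_space set \<Rightarrow> 'a set \<Rightarrow> ('a \<Rightarrow> 'a) \<Rightarrow> bool" where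
  "dupin N M \<nu> \<longleftrightarrow> (\<forall>T. curvature_surface N M \<nu> T \<longrightarrow>
     (\<exists>\<kappa>. \<forall>p\<in>topspace T. \<kappa> \<in> principal_curvatures N M \<nu> p \<and>
        immersed_tangent_space T p = principal_space N M \<nu> p \<kappa>))"

definition proper_dupin :: "'a::euclidean_space set \<Rightarrow> 'a set \<Rightarrow> ('a \<Rightarrow> 'a) \<Rightarrow> bool" where
  "proper_dupin N M \<nu> \<longleftrightarrow> dupin N M \<nu> \<and>
     (\<exists>g. \<forall>p\<in>M. finite (principal_curvatures N M \<nu> p) \<and> card (principal_curvatures N M \<nu> p) = g)"

definition principal_multiplicities ::
  "'a::euclidean_space set \<Rightarrow> 'a set \<Rightarrow> ('a \<Rightarrow> 'a) \<Rightarrow> 'a \<Rightarrow> nat multiset" where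
  "principal_multiplicities N M \<nu> p =
     {#dim (principal_space N M \<nu> p \<kappa>). \<kappa> \<in># mset_set (principal_curvatures N M \<nu> p)#}"

section \<open>Spaces of traceless Hermitian matrices\<close>

definition E4 :: "('f::conjugation_algebra^4^4) set" where
  "E4 = {A. adjoint_matrix A = A \<and> trace A = 0}"

definition S4 :: "('f::conjugation_algebra^4^4) set" where
  "S4 = {A \<in> E4. norm A = 1}"

definition unitary_group :: "('f::conjugation_algebra^4^4) set" where
  "unitary_group = {P. adjoint_matrix P ** P = mat 1 \<and> P ** adjoint_matrix P = mat 1}"

definition SO4 :: "(real^4^4) set" where
  "SO4 = {P \<in> unitary_group. det P = 1}"

definition U4 :: "(complex^4^4) set" where
  "U4 = unitary_group"

text \<open>The compact symplectic group, i.e. the quaternionic unitary group.\<close>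

definition Sp4 :: "(quat^4^4) set" where
  "Sp4 = unitary_group"

definition diag_matrix :: "real list \<Rightarrow> real^4^4" where
  "diag_matrix d = (\<chi> i j. if i = j then vector d $ i else 0)"

definition D4_tilde :: "(real^4^4) set" where
  "D4_tilde = {A \<in> S4. \<exists>l1 l2. A = diag_matrix [l1, - l1, l2, - l2] \<and> l1 > l2 \<and> l2 > 0}"

text \<open>The orbit \<open>G \<cdot> D4_tilde\<close>, where \<open>G\<close> is one of \<open>SO4\<close>, \<open>U4\<close>, \<open>Sp4\<close>.\<close>

definition B4_tilde :: "('f::conjugation_algebra^4^4) set \<Rightarrow> ('f^4^4) set" where
  "B4_tilde G = {adjoint_matrix P ** map_matrix of_real A ** P | P A. P \<in> G \<and> A \<in> D4_tilde}"

end

theory Submission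
  imports "Jordan_Normal_Form.Determinant" Defs
begin

text \<open>
  A traceless Hermitian \<open>4 \<times> 4\<close> matrix over any of the three kinds of
  scalars has spectrum \<open>a, -a, b, -b\<close> exactly if the trace of its cube vanishes.
  On the unit sphere \<open>2 a\<^sup>2 + 2 b\<^sup>2 = 1\<close>, so the trace of the
  fourth power, \<open>2 a\<^sup>4 + 2 b\<^sup>4\<close>, lies between \<open>1/4\<close>
  (where \<open>a = b\<close>) and \<open>1/2\<close> (where \<open>b = 0\<close>). The orbit
  is therefore the part of the zero set of \<open>cubic\<close> in the sphere that lies over the
  open range \<open>1/4 < quartic A < 1/2\<close> (\<open>B4_tilde_unitary\<close>). All
  arguments are made once, for an arbitrary algebra with conjugation; only in the real case does
  one pass from the special orthogonal to the full orthogonal group, by a diagonal reflection,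
  which commutes with the diagonal matrices (\<open>B4_tilde_SO4\<close>).

  The spectral theorem and connectedness have a common source,
  \<open>connected_orbit_diagonal\<close>: on the connected component of a Hermitian matrix in its
  unitary orbit, which is compact, the inner product with a fixed diagonal matrix \<open>N\<close>
  with distinct entries attains its maximum. Rotations in coordinate planes do not leave the
  component, so the first derivative makes a maximum point commute with \<open>N\<close>, that is,
  makes it diagonal, and the quarter turns show that its entries are ordered like those of
  \<open>N\<close>. Thus each matrix is joined within its orbit to the standard diagonal matrix.

  That sphere and orbit are embedded submanifolds is an application of the regular level set
  theorem inside a submanifold (\<open>regular_level_set\<close>), first to the squared norm and
  then to the cubic; the charts come from the inverse function theorem. At a point
  \<open>A\<close> of the orbit the gradient of \<open>cubic\<close> is
  \<open>3 A\<^sup>2\<close>, and the part of \<open>A\<^sup>2\<close> tangent to the sphere is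
  \<open>A\<^sup>2 - I/4\<close>. Its norm is \<open>gap A = a\<^sup>2 - b\<^sup>2\<close>,
  so the unit normal is \<open>(A\<^sup>2 - I/4)\<close> divided by it, and the principal space
  for \<open>\<kappa>\<close> consists of the tangent vectors \<open>v\<close> for which
  \<open>\<langle> A v + v A, w \<rangle> = - \<kappa> * gap A * \<langle> v, w \<rangle>\<close>
  for all tangent vectors \<open>w\<close>. This weak form of the eigenvalue equation
  (\<open>curvature_space\<close>) avoids the projection and is invariant under unitary
  conjugation. For diagonal \<open>A\<close> it acts on the entry in place \<open>(i, j)\<close>
  through \<open>x\<^sub>i + x\<^sub>j\<close>, where \<open>x\<close> is the diagonal, and it
  sends the only diagonal tangent direction to a multiple of the normal. The pairs
  \<open>(1,2)\<close> and \<open>(3,4)\<close> and this direction give the curvature 0 with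
  multiplicity \<open>2m + 1\<close>, the four other pairs give
  \<open>\<plusminus> 1/(a + b)\<close> and \<open>\<plusminus> 1/(a - b)\<close> with
  multiplicity \<open>m\<close> each (\<open>dim_curvature_space\<close>). The list is symmetric
  under change of sign, whence austerity.

  For the Dupin condition (\<open>dupin_cubic_zeros\<close>) let the curvature not be 0. Then in a
  frame that diagonalizes \<open>A\<close> the tangent vectors of a curvature surface have zero
  diagonal, so they are orthogonal to \<open>A\<^sup>3\<close>, the gradient of
  \<open>quartic\<close> up to a factor. Along a curve in the surface \<open>quartic\<close>,
  hence the set of principal curvatures, is constant, and the curvature, being continuous with
  values in a finite set, is constant, too.
\<close>

(* The library of matrices with index ranges shares these names and symbols with Cartesian spaces. *)
hide_const (open) Matrix.mat Matrix.vec Determinant.det Conjugate.conjugate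
no_notation vec_index (infixl "$" 100) and scalar_prod (infix "\<bullet>" 70)

section \<open>Smooth maps\<close>

lemma times_differentiable_on_cong:
  assumes "open U" "\<And>x. x \<in> U \<Longrightarrow> f x = g x"
  shows "times_differentiable_on n U f \<longleftrightarrow> times_differentiable_on n U g"
  using assms(2)
proof (induction n arbitrary: f g)
  case 0
  then show ?case by (auto cong: continuous_on_cong)
next
  case (Suc n)
  have d: "(f has_derivative D) (at x) \<longleftrightarrow> (g has_derivative D) (at x)" if "x \<in> U" for x D
    using has_derivative_transform_within_open[OF _ assms(1) that, of f D UNIV g]
      has_derivative_transform_within_open[OF _ assms(1) that, of g D UNIV f] Suc.prems by auto
  have "frechet_derivative f (at x) = frechet_derivative g (at x)" if "x \<in> U" for x
    unfolding frechet_derivative_def using d[OF that] by simp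
  then have "times_differentiable_on n U (\<lambda>x. frechet_derivative f (at x) v)
      \<longleftrightarrow> times_differentiable_on n U (\<lambda>x. frechet_derivative g (at x) v)" for v
    by (intro Suc.IH) simp
  with d show ?case by (simp add: differentiable_def)
qed

lemma times_differentiable_on_subset:
  "times_differentiable_on n U f \<Longrightarrow> V \<subseteq> U \<Longrightarrow> times_differentiable_on n V f"
  by (induction n arbitrary: f) (auto intro: continuous_on_subset)

lemma times_differentiable_on_SucD:
  "times_differentiable_on (Suc n) U f \<Longrightarrow> times_differentiable_on n U f"
proof (induction n arbitrary: f)
  case 0
  then show ?case
    by (auto intro!: continuous_at_imp_continuous_on intro: differentiable_imp_continuous_within)
next
  case (Suc n)
  then show ?case by (metis times_differentiable_on.simps(2))
qed

text \<open>
  The definition of the classes \<open>C\<^sup>n\<close> refers to the chosen Frechet derivative;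
  this rule lets one work with any explicit formula for it.
\<close>

lemma times_differentiable_on_SucI:
  assumes "open U" "\<And>x. x \<in> U \<Longrightarrow> (f has_derivative f' x) (at x)"
    and "\<And>v. times_differentiable_on n U (\<lambda>x. f' x v)"
  shows "times_differentiable_on (Suc n) U f"
proof -
  have "frechet_derivative f (at x) = f' x" if "x \<in> U" for x
    using assms(2)[OF that] by (metis frechet_derivative_at)
  then have "times_differentiable_on n U (\<lambda>x. frechet_derivative f (at x) v)" for v
    using assms(3)[of v]
      times_differentiable_on_cong[OF assms(1), of "\<lambda>x. frechet_derivative f (at x) v" "\<lambda>x. f' x v" n]
    by simp
  with assms(2) show ?thesis by (auto simp: differentiable_def)
qed

lemma times_differentiable_on_has_derivative:
  "times_differentiable_on (Suc n) U f \<Longrightarrow> x \<in> U \<Longrightarrow>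
    (f has_derivative frechet_derivative f (at x)) (at x)"
  by (simp add: frechet_derivative_works)

lemma times_differentiable_on_const: "open U \<Longrightarrow> times_differentiable_on n U (\<lambda>_. c)"
  by (induction n arbitrary: c)
    (auto intro!: times_differentiable_on_SucI[where f' = "\<lambda>_ _. 0"] simp del: times_differentiable_on.simps(2))

lemma times_differentiable_on_linear_compose:
  "times_differentiable_on n U f \<Longrightarrow> open U \<Longrightarrow> bounded_linear L \<Longrightarrow>
    times_differentiable_on n U (\<lambda>x. L (f x))"
proof (induction n arbitrary: f)
  case 0
  then show ?case by (auto intro: bounded_linear.continuous_on)
next
  case (Suc n)
  show ?case
  proof (rule times_differentiable_on_SucI[where f' = "\<lambda>x v. L (frechet_derivative f (at x) v)"])
    show "((\<lambda>x. L (f x)) has_derivative (\<lambda>v. L (frechet_derivative f (at x) v))) (at x)"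
      if "x \<in> U" for x
      using times_differentiable_on_has_derivative[OF Suc.prems(1) that] Suc.prems(3)
      by (rule bounded_linear.has_derivative[rotated])
    show "times_differentiable_on n U (\<lambda>x. L (frechet_derivative f (at x) v))" for v
      using Suc by auto
  qed fact
qed

lemma times_differentiable_on_add:
  "times_differentiable_on n U f \<Longrightarrow> times_differentiable_on n U g \<Longrightarrow> open U \<Longrightarrow>
    times_differentiable_on n U (\<lambda>x. f x + g x)"
proof (induction n arbitrary: f g)
  case 0
  then show ?case by (auto intro: continuous_on_add)
next
  case (Suc n)
  show ?case
  proof (rule times_differentiable_on_SucI)
    show "((\<lambda>x. f x + g x) has_derivative
        (\<lambda>v. frechet_derivative f (at x) v + frechet_derivative g (at x) v)) (at x)" if "x \<in> U" for x
      by (intro has_derivative_add times_differentiable_on_has_derivative[OF _ that]) fact+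
    show "times_differentiable_on n U
        (\<lambda>x. frechet_derivative f (at x) v + frechet_derivative g (at x) v)" for v
      using Suc by auto
  qed fact
qed

lemma times_differentiable_on_bilinear:
  assumes B: "bounded_bilinear B"
  shows "times_differentiable_on n U f \<Longrightarrow> times_differentiable_on n U g \<Longrightarrow> open U \<Longrightarrow>
    times_differentiable_on n U (\<lambda>x. B (f x) (g x))"
proof (induction n arbitrary: f g)
  case 0
  then show ?case using bounded_bilinear.continuous_on[OF B] by auto
next
  case (Suc n)
  show ?case
  proof (rule times_differentiable_on_SucI)
    show "((\<lambda>x. B (f x) (g x)) has_derivative
        (\<lambda>v. B (f x) (frechet_derivative g (at x) v) + B (frechet_derivative f (at x) v) (g x))) (at x)"
      if "x \<in> U" for x
      by (intro bounded_bilinear.FDERIV[OF B] times_differentiable_on_has_derivative[OF _ that]) fact+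
    show "times_differentiable_on n U
        (\<lambda>x. B (f x) (frechet_derivative g (at x) v) + B (frechet_derivative f (at x) v) (g x))" for v
      using Suc.prems times_differentiable_on_SucD[OF Suc.prems(1)] times_differentiable_on_SucD[OF Suc.prems(2)]
      by (intro times_differentiable_on_add Suc.IH) auto
  qed fact
qed

lemma times_differentiable_on_sum:
  "finite I \<Longrightarrow> open U \<Longrightarrow> (\<And>i. i \<in> I \<Longrightarrow> times_differentiable_on n U (f i)) \<Longrightarrow>
    times_differentiable_on n U (\<lambda>x. \<Sum>i\<in>I. f i x)"
  by (induction I rule: finite_induct)
    (auto intro!: times_differentiable_on_const times_differentiable_on_add)

text \<open>
  The chain rule expresses the derivative of the composition, direction by direction, as a finite
  sum of products of the partial derivatives of \<open>g\<close>, composed with \<open>f\<close>,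
  and components of the derivative of \<open>f\<close>. Each factor is of class
  \<open>C\<^sup>n\<close>, those composed with \<open>f\<close> by the induction hypothesis.
\<close>

lemma times_differentiable_on_compose:
  assumes "open U" "open V" "f ` U \<subseteq> V"
  shows "times_differentiable_on n U f \<Longrightarrow> times_differentiable_on n V g \<Longrightarrow>
    times_differentiable_on n U (\<lambda>x. g (f x))"
proof (induction n arbitrary: g)
  case 0
  then show ?case
    using assms(3) continuous_on_compose2 by auto
next
  case (Suc n)
  let ?Df = "\<lambda>x. frechet_derivative f (at x)" and ?Dg = "\<lambda>y. frechet_derivative g (at y)"
  show ?case
  proof (rule times_differentiable_on_SucI[where f' = "\<lambda>x v. \<Sum>b\<in>Basis. inner (?Df x v) b *\<^sub>R ?Dg (f x) b"])
    fix x assume x: "x \<in> U"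
    have f: "(f has_derivative ?Df x) (at x)" and g: "(g has_derivative ?Dg (f x)) (at (f x))"
      using x assms(3) Suc.prems by (auto intro!: times_differentiable_on_has_derivative)
    have "?Dg (f x) (?Df x v) = (\<Sum>b\<in>Basis. inner (?Df x v) b *\<^sub>R ?Dg (f x) b)" for v
    proof -
      have l: "linear (?Dg (f x))" using g has_derivative_linear by blast
      have "?Dg (f x) (?Df x v) = ?Dg (f x) (\<Sum>b\<in>Basis. inner (?Df x v) b *\<^sub>R b)"
        by (simp add: euclidean_representation)
      then show ?thesis by (simp add: linear_sum[OF l] linear_scale[OF l])
    qed
    then show "((\<lambda>x. g (f x)) has_derivative
        (\<lambda>v. \<Sum>b\<in>Basis. inner (?Df x v) b *\<^sub>R ?Dg (f x) b)) (at x)"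
      using has_derivative_compose[OF f g] by simp
  next
    fix v
    have "times_differentiable_on n U (\<lambda>x. inner (?Df x v) b)" for b
      using times_differentiable_on_linear_compose[OF _ assms(1) bounded_linear_inner_left] Suc.prems(1)
      by (metis times_differentiable_on.simps(2))
    moreover have "times_differentiable_on n U (\<lambda>x. ?Dg (f x) b)" for b
      using Suc.IH[OF times_differentiable_on_SucD[OF Suc.prems(1)], of "\<lambda>y. ?Dg y b"] Suc.prems(2)
      by (metis times_differentiable_on.simps(2))
    ultimately show "times_differentiable_on n U (\<lambda>x. \<Sum>b\<in>Basis. inner (?Df x v) b *\<^sub>R ?Dg (f x) b)"
      by (intro times_differentiable_on_sum times_differentiable_on_bilinear[OF bounded_bilinear_scaleR]
          finite_Basis assms(1))
  qed (rule assms(1))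
qed

lemma smooth_on_subset: "smooth_on U f \<Longrightarrow> V \<subseteq> U \<Longrightarrow> smooth_on V f"
  unfolding smooth_on_def using times_differentiable_on_subset by blast

lemma smooth_on_has_derivative:
  "smooth_on U f \<Longrightarrow> x \<in> U \<Longrightarrow> (f has_derivative frechet_derivative f (at x)) (at x)"
  unfolding smooth_on_def using times_differentiable_on_has_derivative by blast

lemma smooth_on_frechet_derivative:
  "smooth_on U f \<Longrightarrow> smooth_on U (\<lambda>x. frechet_derivative f (at x) v)"
  unfolding smooth_on_def by (metis times_differentiable_on.simps(2))

lemma smooth_on_imp_continuous_on: "smooth_on U f \<Longrightarrow> continuous_on U f"
  unfolding smooth_on_def by (metis times_differentiable_on.simps(1))

lemma smooth_on_const: "open U \<Longrightarrow> smooth_on U (\<lambda>_. c)"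
  unfolding smooth_on_def by (intro allI times_differentiable_on_const)

lemma smooth_on_linear_compose:
  "smooth_on U f \<Longrightarrow> open U \<Longrightarrow> bounded_linear L \<Longrightarrow> smooth_on U (\<lambda>x. L (f x))"
  unfolding smooth_on_def using times_differentiable_on_linear_compose[of _ U f L] by simp

lemma smooth_on_id: "open U \<Longrightarrow> smooth_on U (\<lambda>x. x)"
  unfolding smooth_on_def
proof
  fix n assume U: "open U"
  then show "times_differentiable_on n U (\<lambda>x. x)"
    by (cases n) (auto intro!: times_differentiable_on_SucI[where f' = "\<lambda>_ v. v"]
        times_differentiable_on_const simp del: times_differentiable_on.simps(2))
qed

lemma smooth_on_linear: "open U \<Longrightarrow> bounded_linear L \<Longrightarrow> smooth_on U L"
  using smooth_on_linear_compose[OF smooth_on_id, of U L] by simp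

lemma smooth_on_add:
  "smooth_on U f \<Longrightarrow> smooth_on U g \<Longrightarrow> open U \<Longrightarrow> smooth_on U (\<lambda>x. f x + g x)"
  unfolding smooth_on_def using times_differentiable_on_add[of _ U f g] by simp

lemma smooth_on_diff:
  "smooth_on U f \<Longrightarrow> smooth_on U g \<Longrightarrow> open U \<Longrightarrow> smooth_on U (\<lambda>x. f x - g x)"
  using smooth_on_add[OF _ smooth_on_linear_compose[OF _ _ bounded_linear_minus[OF bounded_linear_ident]], of U f g]
  by simp

lemma smooth_on_bilinear:
  "bounded_bilinear B \<Longrightarrow> smooth_on U f \<Longrightarrow> smooth_on U g \<Longrightarrow> open U \<Longrightarrow>
    smooth_on U (\<lambda>x. B (f x) (g x))"
  unfolding smooth_on_def using times_differentiable_on_bilinear[of B _ U f g] by simp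

lemma smooth_on_compose:
  "smooth_on U f \<Longrightarrow> smooth_on V g \<Longrightarrow> open U \<Longrightarrow> open V \<Longrightarrow> f ` U \<subseteq> V \<Longrightarrow>
    smooth_on U (\<lambda>x. g (f x))"
  unfolding smooth_on_def using times_differentiable_on_compose[of U V f _ g] by simp

text \<open>
  Bootstrapping: if the derivative of \<open>g\<close> is a smooth function of the value of
  \<open>g\<close>, then \<open>g\<close> in \<open>C\<^sup>n\<close> forces its derivative into
  \<open>C\<^sup>n\<close>. This covers inverse functions, whose derivative is the inverse of the
  derivative at the value, and elementary functions solving such an equation.
\<close>

lemma smooth_on_autonomous:
  assumes "open U" "open V" "g ` V \<subseteq> U"
    and der: "\<And>y. y \<in> V \<Longrightarrow> (g has_derivative (\<lambda>w. H w (g y))) (at y)"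
    and H: "\<And>w. smooth_on U (H w)"
  shows "smooth_on V g"
  unfolding smooth_on_def
proof
  show "times_differentiable_on n V g" for n
  proof (induction n)
    case 0
    then show ?case
      using der by (auto intro!: continuous_at_imp_continuous_on has_derivative_continuous)
  next
    case (Suc n)
    show ?case
    proof (rule times_differentiable_on_SucI[where f' = "\<lambda>y w. H w (g y)"])
      show "times_differentiable_on n V (\<lambda>y. H w (g y))" for w
        by (rule times_differentiable_on_compose[OF assms(2,1,3) Suc])
          (use H in \<open>simp add: smooth_on_def\<close>)
    qed (use assms(2) der in simp_all)
  qed
qed

lemma smooth_on_inverse_real: "smooth_on (- {0}) (inverse :: real \<Rightarrow> real)"
proof (rule smooth_on_autonomous[where U = UNIV and H = "\<lambda>w u. - w * (u * u)"])
  show "(inverse has_derivative (\<lambda>w. - w * (inverse y * inverse y))) (at y)"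
    if "y \<in> - {0}" for y :: real
    using that by (auto intro!: derivative_eq_intros)
  show "smooth_on UNIV (\<lambda>u. - w * (u * u))" for w :: real
    by (intro smooth_on_bilinear[OF bounded_bilinear_mult] smooth_on_const smooth_on_id open_UNIV)
qed auto

lemma smooth_on_inverse_sqrt: "smooth_on {0<..} (\<lambda>r. inverse (sqrt r))"
proof (rule smooth_on_autonomous[where U = UNIV and H = "\<lambda>w u. (- w / 2) * (u * (u * u))"])
  show "((\<lambda>r. inverse (sqrt r)) has_derivative
      (\<lambda>w. (- w / 2) * (inverse (sqrt y) * (inverse (sqrt y) * inverse (sqrt y))))) (at y)"
    if "y \<in> {0<..}" for y :: real
    using that by (auto intro!: derivative_eq_intros simp: fun_eq_iff field_simps)
  show "smooth_on UNIV (\<lambda>u. (- w / 2) * (u * (u * u)))" for w :: real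
    by (intro smooth_on_bilinear[OF bounded_bilinear_mult] smooth_on_const smooth_on_id open_UNIV)
qed auto

section \<open>Slice charts and regular level sets\<close>

text \<open>
  The condition that the definition of embedded submanifolds imposes on a single chart, with the
  base point and the dimension left out.
\<close>

definition slice_chart ::
  "'a::euclidean_space set \<Rightarrow> 'a set \<Rightarrow> ('a \<Rightarrow> 'a) \<Rightarrow> ('a \<Rightarrow> 'a) \<Rightarrow> 'a set \<Rightarrow> bool" where
  "slice_chart M U \<phi> \<psi> L \<longleftrightarrow> open U \<and> open (\<phi> ` U) \<and> smooth_on U \<phi> \<and> smooth_on (\<phi> ` U) \<psi> \<and>
     (\<forall>x\<in>U. \<psi> (\<phi> x) = x) \<and> subspace L \<and> \<phi> ` (U \<inter> M) = \<phi> ` U \<inter> L"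

lemma embedded_submanifold_slice_chart:
  "embedded_submanifold k M \<longleftrightarrow>
     (\<forall>p\<in>M. \<exists>U \<phi> \<psi> L. slice_chart M U \<phi> \<psi> L \<and> p \<in> U \<and> dim L = k)"
  unfolding embedded_submanifold_def slice_chart_def by meson

lemma slice_chart_mem:
  assumes "slice_chart M U \<phi> \<psi> L" "x \<in> U"
  shows "x \<in> M \<longleftrightarrow> \<phi> x \<in> L"
proof
  assume "\<phi> x \<in> L"
  then have "\<phi> x \<in> \<phi> ` (U \<inter> M)" using assms unfolding slice_chart_def by blast
  then obtain y where "y \<in> U" "y \<in> M" "\<phi> x = \<phi> y" by blast
  then show "x \<in> M" using assms unfolding slice_chart_def by metis
qed (use assms in \<open>auto simp: slice_chart_def\<close>)

lemma slice_chart_inverse_derivatives: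
  assumes c: "slice_chart M U \<phi> \<psi> L" and p: "p \<in> U"
  shows "frechet_derivative \<psi> (at (\<phi> p)) (frechet_derivative \<phi> (at p) v) = v"
    and "frechet_derivative \<phi> (at p) (frechet_derivative \<psi> (at (\<phi> p)) v) = v"
proof -
  have U: "open U" "open (\<phi> ` U)" and inv: "\<And>x. x \<in> U \<Longrightarrow> \<psi> (\<phi> x) = x"
    using c by (auto simp: slice_chart_def)
  have f: "(\<phi> has_derivative frechet_derivative \<phi> (at p)) (at p)"
    and g: "(\<psi> has_derivative frechet_derivative \<psi> (at (\<phi> p))) (at (\<phi> p))"
    using c p by (auto simp: slice_chart_def intro!: smooth_on_has_derivative)
  have "((\<lambda>x. x) has_derivative (\<lambda>v. frechet_derivative \<psi> (at (\<phi> p)) (frechet_derivative \<phi> (at p) v))) (at p)"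
    by (rule has_derivative_transform_within_open[OF has_derivative_compose[OF f g] U(1) p]) (simp add: inv)
  from has_derivative_unique[OF this has_derivative_ident]
  show "frechet_derivative \<psi> (at (\<phi> p)) (frechet_derivative \<phi> (at p) v) = v" by metis
  have f': "(\<phi> has_derivative frechet_derivative \<phi> (at p)) (at (\<psi> (\<phi> p)))" using f p by (simp add: inv)
  have "((\<lambda>x. x) has_derivative (\<lambda>v. frechet_derivative \<phi> (at p) (frechet_derivative \<psi> (at (\<phi> p)) v))) (at (\<phi> p))"
    by (rule has_derivative_transform_within_open[OF has_derivative_compose[OF g f'] U(2)])
      (use p inv in auto)
  from has_derivative_unique[OF this has_derivative_ident]
  show "frechet_derivative \<phi> (at p) (frechet_derivative \<psi> (at (\<phi> p)) v) = v" by metis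
qed

lemma slice_chart_line:
  assumes c: "slice_chart M U \<phi> \<psi> L" and L: "a \<in> L" "l \<in> L" and J: "open J"
    and line: "\<And>t. t \<in> J \<Longrightarrow> a + t *\<^sub>R l \<in> \<phi> ` U"
  shows "smooth_on J (\<lambda>t. \<psi> (a + t *\<^sub>R l))"
    and "t \<in> J \<Longrightarrow> \<psi> (a + t *\<^sub>R l) \<in> U \<inter> M"
    and "t \<in> J \<Longrightarrow> ((\<lambda>t. \<psi> (a + t *\<^sub>R l)) has_vector_derivative
           frechet_derivative \<psi> (at (a + t *\<^sub>R l)) l) (at t)"
proof -
  have s: "smooth_on J (\<lambda>t. a + t *\<^sub>R l)"
    by (intro smooth_on_add smooth_on_const smooth_on_linear bounded_linear_scaleR_left J)
  show "smooth_on J (\<lambda>t. \<psi> (a + t *\<^sub>R l))"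
    using c J line unfolding slice_chart_def by (intro smooth_on_compose[OF s, where V = "\<phi> ` U"]) auto
  show "\<psi> (a + t *\<^sub>R l) \<in> U \<inter> M" if "t \<in> J"
  proof -
    have "a + t *\<^sub>R l \<in> \<phi> ` U \<inter> L"
      using line[OF that] c L by (auto simp: slice_chart_def intro!: subspace_add subspace_scale)
    then obtain x where x: "x \<in> U" "a + t *\<^sub>R l = \<phi> x" "\<phi> x \<in> L" by auto
    then have "x \<in> M" "\<psi> (\<phi> x) = x" using slice_chart_mem[OF c] c by (auto simp: slice_chart_def)
    with x show ?thesis by simp
  qed
  show "((\<lambda>t. \<psi> (a + t *\<^sub>R l)) has_vector_derivative
           frechet_derivative \<psi> (at (a + t *\<^sub>R l)) l) (at t)" if "t \<in> J"
  proof -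
    have d: "(\<psi> has_derivative frechet_derivative \<psi> (at (a + t *\<^sub>R l))) (at (a + t *\<^sub>R l))"
      using c line[OF that] by (auto simp: slice_chart_def intro!: smooth_on_has_derivative)
    have "((\<lambda>t. a + t *\<^sub>R l) has_derivative (\<lambda>s. s *\<^sub>R l)) (at t)"
      by (auto intro!: derivative_eq_intros)
    from has_derivative_compose[OF this d] show ?thesis
      unfolding has_vector_derivative_def
      using linear_scale[OF has_derivative_linear[OF d]] by simp
  qed
qed

text \<open>
  The component of the derivative orthogonal to the subspace is the derivative of a function that
  vanishes.
\<close>

lemma has_vector_derivative_in_subspace:
  fixes f :: "real \<Rightarrow> 'a::euclidean_space"
  assumes "subspace L" and ev: "\<And>t. t \<in> S \<Longrightarrow> f t \<in> L" and "open S" "0 \<in> S"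
    and d: "(f has_vector_derivative d) (at 0)"
  shows "d \<in> L"
proof -
  obtain y z where yz: "d = y + z" "y \<in> span L" "\<And>w. w \<in> span L \<Longrightarrow> orthogonal z w"
    using orthogonal_subspace_decomp_exists[of L d] by metis
  have "((\<lambda>t. inner (f t) z) has_derivative (\<lambda>s. inner (s *\<^sub>R d) z)) (at 0)"
    using d unfolding has_vector_derivative_def by (rule has_derivative_inner_left)
  moreover have "inner (f t) z = 0" if "t \<in> S" for t
    using yz(3)[of "f t"] ev[OF that] by (auto simp: span_base orthogonal_def inner_commute)
  ultimately have "((\<lambda>t. 0) has_derivative (\<lambda>s. inner (s *\<^sub>R d) z)) (at 0)"
    using has_derivative_transform_within_open[of "\<lambda>t. inner (f t) z" _ 0 UNIV S "\<lambda>_. 0"] assms by auto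
  then have "(\<lambda>s. inner (s *\<^sub>R d) z) = (\<lambda>s. 0)"
    using has_derivative_unique has_derivative_const by metis
  then have "inner d z = 0" by (metis scaleR_one)
  moreover have "inner y z = 0" using yz(2,3) by (simp add: orthogonal_def inner_commute)
  ultimately have "z = 0" using yz(1) by (simp add: inner_add_left)
  then show ?thesis using yz assms(1) by (simp add: span_eq_iff[THEN iffD2])
qed

text \<open>
  A curve in the submanifold becomes, in the chart, a curve in the slice; conversely straight
  lines in the slice give curves with every prescribed velocity.
\<close>

lemma tangent_space_slice_chart:
  assumes c: "slice_chart M U \<phi> \<psi> L" and p: "p \<in> U" "p \<in> M"
  shows "tangent_space M p = frechet_derivative \<psi> (at (\<phi> p)) ` L"
proof (intro equalityI subsetI)
  fix v assume "v \<in> tangent_space M p"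
  then obtain \<gamma> \<epsilon> where \<gamma>: "0 < \<epsilon>" "smooth_on {-\<epsilon><..<\<epsilon>} \<gamma>" "\<gamma> ` {-\<epsilon><..<\<epsilon>} \<subseteq> M" "\<gamma> 0 = p"
    "(\<gamma> has_vector_derivative v) (at (0::real))"
    unfolding tangent_space_altdef by blast
  let ?S = "{-\<epsilon><..<\<epsilon>} \<inter> \<gamma> -` U"
  have "open ?S"
    using \<gamma>(2) c by (intro continuous_open_preimage smooth_on_imp_continuous_on) (auto simp: slice_chart_def)
  moreover have "0 \<in> ?S" using \<gamma> p by auto
  moreover have "\<phi> (\<gamma> t) \<in> L" if "t \<in> ?S" for t
  proof -
    have "\<gamma> t \<in> U" "\<gamma> t \<in> M" using that \<gamma>(3) by blast+
    then show ?thesis using slice_chart_mem[OF c] by blast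
  qed
  moreover have "((\<lambda>t. \<phi> (\<gamma> t)) has_vector_derivative frechet_derivative \<phi> (at p) v) (at 0)"
  proof -
    have d: "(\<phi> has_derivative frechet_derivative \<phi> (at p)) (at (\<gamma> 0))"
      using c p \<gamma>(4) by (auto simp: slice_chart_def intro!: smooth_on_has_derivative)
    from has_derivative_compose[OF \<gamma>(5)[unfolded has_vector_derivative_def] d]
    show ?thesis unfolding has_vector_derivative_def
      using linear_scale[OF has_derivative_linear[OF d]] by simp
  qed
  ultimately have "frechet_derivative \<phi> (at p) v \<in> L"
    using c has_vector_derivative_in_subspace[of L ?S "\<lambda>t. \<phi> (\<gamma> t)"] by (auto simp: slice_chart_def)
  then show "v \<in> frechet_derivative \<psi> (at (\<phi> p)) ` L"
    using slice_chart_inverse_derivatives(1)[OF c p(1), of v] by (metis image_eqI)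
next
  fix v assume "v \<in> frechet_derivative \<psi> (at (\<phi> p)) ` L"
  then obtain l where l: "l \<in> L" "v = frechet_derivative \<psi> (at (\<phi> p)) l" by blast
  have a: "\<phi> p \<in> L" using slice_chart_mem[OF c] p by simp
  have "open (\<phi> ` U)" using c by (simp add: slice_chart_def)
  then obtain e where e: "0 < e" "ball (\<phi> p) e \<subseteq> \<phi> ` U"
    using p by (meson image_eqI open_contains_ball)
  define \<epsilon> where "\<epsilon> = e / (norm l + 1)"
  have \<epsilon>: "0 < \<epsilon>" using e by (simp add: \<epsilon>_def add_nonneg_pos)
  have line: "\<phi> p + t *\<^sub>R l \<in> \<phi> ` U" if "t \<in> {-\<epsilon><..<\<epsilon>}" for t
  proof -
    have "\<bar>t\<bar> * norm l \<le> \<bar>t\<bar> * (norm l + 1)" by (simp add: mult_left_mono)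
    also have "\<dots> < e"
    proof -
      have "\<bar>t\<bar> < e / (norm l + 1)" using that by (auto simp: \<epsilon>_def)
      then show ?thesis using norm_ge_zero[of l] by (subst (asm) pos_less_divide_eq) linarith+
    qed
    finally show ?thesis using e(2) by (auto simp: dist_norm)
  qed
  note r = slice_chart_line[OF c a l(1) open_greaterThanLessThan[of "-\<epsilon>" \<epsilon>] line]
  show "v \<in> tangent_space M p"
    unfolding tangent_space_altdef
  proof (intro CollectI exI[of _ "\<lambda>t. \<psi> (\<phi> p + t *\<^sub>R l)"] exI[of _ \<epsilon>] conjI)
    show "smooth_on {-\<epsilon><..<\<epsilon>} (\<lambda>t. \<psi> (\<phi> p + t *\<^sub>R l))" by (rule r(1))
    show "(\<lambda>t. \<psi> (\<phi> p + t *\<^sub>R l)) ` {-\<epsilon><..<\<epsilon>} \<subseteq> M" using r(2) by blast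
    have "((\<lambda>t. \<psi> (\<phi> p + t *\<^sub>R l)) has_vector_derivative
        frechet_derivative \<psi> (at (\<phi> p + 0 *\<^sub>R l)) l) (at 0)"
      by (rule r(3)) (use \<epsilon> in auto)
    then show "((\<lambda>t. \<psi> (\<phi> p + t *\<^sub>R l)) has_vector_derivative v) (at 0)" using l(2) by simp
  qed (use \<epsilon> p c in \<open>auto simp: slice_chart_def\<close>)
qed

lemma tangent_space_subspace_dim:
  assumes "embedded_submanifold k M" "p \<in> M"
  shows "subspace (tangent_space M p)" "dim (tangent_space M p) = k"
proof -
  obtain U \<phi> \<psi> L where c: "slice_chart M U \<phi> \<psi> L" and p: "p \<in> U" and k: "dim L = k"
    using assms unfolding embedded_submanifold_slice_chart by blast
  let ?D = "frechet_derivative \<psi> (at (\<phi> p))"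
  have l: "linear ?D"
    using c p by (intro has_derivative_linear[of \<psi> _ "at (\<phi> p)"] smooth_on_has_derivative[of "\<phi> ` U"])
      (auto simp: slice_chart_def)
  have "inj ?D" using slice_chart_inverse_derivatives(2)[OF c p] by (metis injI)
  then have "inj_on ?D (span L)" by (rule inj_on_subset) simp
  with l k show "subspace (tangent_space M p)" "dim (tangent_space M p) = k"
    unfolding tangent_space_slice_chart[OF c p assms(2)] using c
    by (auto intro: linear_subspace_image dim_image_eq simp: slice_chart_def)
qed

text \<open>
  Continuity into the finer topology keeps a curve inside the open piece for small times, so an
  immersed submanifold has the tangent spaces of its embedded pieces.
\<close>

lemma immersed_tangent_space_openin:
  assumes "openin T W" "p \<in> W" "subtopology T W = top_of_set W"
  shows "immersed_tangent_space T p = tangent_space W p"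
proof (intro equalityI subsetI)
  fix v assume "v \<in> tangent_space W p"
  then show "v \<in> immersed_tangent_space T p"
    unfolding tangent_space_def immersed_tangent_space_def assms(3)[symmetric]
    by (auto simp: continuous_map_in_subtopology)
next
  fix v assume "v \<in> immersed_tangent_space T p"
  then obtain \<gamma> \<epsilon> where \<gamma>: "0 < \<epsilon>" "smooth_on {-\<epsilon><..<\<epsilon>} \<gamma>"
    "continuous_map (top_of_set {-\<epsilon><..<\<epsilon>}) T \<gamma>" "\<gamma> 0 = p"
    "(\<gamma> has_vector_derivative v) (at (0::real))"
    unfolding immersed_tangent_space_def by blast
  have "openin (top_of_set {-\<epsilon><..<\<epsilon>}) {t \<in> {-\<epsilon><..<\<epsilon>}. \<gamma> t \<in> W}"
    using openin_continuous_map_preimage[OF \<gamma>(3) assms(1)] by simp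
  then have "open {t \<in> {-\<epsilon><..<\<epsilon>}. \<gamma> t \<in> W}"
    by (metis openin_open_trans open_greaterThanLessThan)
  moreover have "0 \<in> {t \<in> {-\<epsilon><..<\<epsilon>}. \<gamma> t \<in> W}" using \<gamma> assms by auto
  ultimately obtain \<delta> where \<delta>: "\<delta> > 0" "ball 0 \<delta> \<subseteq> {t \<in> {-\<epsilon><..<\<epsilon>}. \<gamma> t \<in> W}"
    by (meson open_contains_ball)
  have b: "{-\<delta><..<\<delta>} = ball (0::real) \<delta>" by (auto simp: dist_real_def)
  have "smooth_on {-\<delta><..<\<delta>} \<gamma>" by (rule smooth_on_subset[OF \<gamma>(2)]) (use \<delta> b in auto)
  moreover have "continuous_map (top_of_set {-\<delta><..<\<delta>}) (subtopology T W) \<gamma>"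
    using \<gamma>(3) \<delta> b by (intro continuous_map_into_subtopology continuous_map_from_subtopology_mono[OF \<gamma>(3)]) auto
  ultimately show "v \<in> tangent_space W p"
    unfolding tangent_space_def immersed_tangent_space_def assms(3)[symmetric] using \<gamma> \<delta>(1) by blast
qed

lemma embedded_submanifold_subspace: "subspace L \<Longrightarrow> embedded_submanifold (dim L) L"
  unfolding embedded_submanifold_slice_chart slice_chart_def
  by (intro ballI exI[of _ UNIV] exI[of _ "\<lambda>x. x"] exI[of _ L]) (auto intro: smooth_on_id)

text \<open>
  The map \<open>\<theta>\<close> replaces the coordinate along \<open>n\<close> by the value of
  \<open>h\<close> and keeps the others. Its derivative is the identity plus a map of rank one, so
  the inverse of the derivative has a closed form, smooth in the base point. The inverse function
  theorem gives a differentiable local inverse, and this closed form makes it smooth by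
  bootstrapping.
\<close>

lemma shear_inverse:
  fixes h :: "'a::euclidean_space \<Rightarrow> real" and n :: 'a
  assumes n: "norm n = 1" and O: "open O'" and h: "smooth_on O' h" and a: "a \<in> O'"
    and nz: "frechet_derivative h (at a) n \<noteq> 0"
  defines "\<theta> \<equiv> \<lambda>y. y + (h y - inner y n) *\<^sub>R n"
  obtains U V g where "open U" "a \<in> U" "U \<subseteq> O'" "open V" "\<theta> ` U = V" "smooth_on V g"
    "\<And>y. y \<in> U \<Longrightarrow> g (\<theta> y) = y" "smooth_on U \<theta>"
proof -
  let ?D = "\<lambda>y. frechet_derivative h (at y)"
  have nn: "inner n n = 1" using n by (simp add: norm_eq_1)
  define U0 where "U0 = {y \<in> O'. ?D y n \<noteq> 0}"
  have cD: "continuous_on O' (\<lambda>y. ?D y w)" for w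
    by (intro smooth_on_imp_continuous_on smooth_on_frechet_derivative h)
  have U0: "open U0"
  proof -
    have "open (O' \<inter> (\<lambda>y. ?D y n) -` (- {0}))"
      by (rule continuous_open_preimage[OF cD O]) auto
    moreover have "O' \<inter> (\<lambda>y. ?D y n) -` (- {0}) = U0" by (auto simp: U0_def)
    ultimately show ?thesis by simp
  qed
  have U0O: "U0 \<subseteq> O'" by (auto simp: U0_def)
  have hd: "(h has_derivative ?D y) (at y)" if "y \<in> O'" for y
    using smooth_on_has_derivative[OF h that] .
  define D\<theta> where "D\<theta> = (\<lambda>y w. w + (?D y w - inner w n) *\<^sub>R n)"
  (* K y inverts D\<theta> y: it keeps the part orthogonal to n and solves for the component along n. *)
  define K where "K = (\<lambda>y w. (w - inner w n *\<^sub>R n) +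
     ((inner w n - ?D y (w - inner w n *\<^sub>R n)) * inverse (?D y n)) *\<^sub>R n)"
  have td: "(\<theta> has_derivative D\<theta> y) (at y)" if "y \<in> O'" for y
    unfolding \<theta>_def D\<theta>_def using hd[OF that] by (auto intro!: derivative_eq_intros)
  have lD: "linear (?D y)" if "y \<in> O'" for y using hd[OF that] has_derivative_linear by blast
  have bD: "bounded_linear (D\<theta> y)" if "y \<in> O'" for y using td[OF that] by (rule has_derivative_bounded_linear)
  have bK: "bounded_linear (K y)" if "y \<in> O'" for y
  proof -
    have "bounded_linear (?D y)" using hd[OF that] by (rule has_derivative_bounded_linear)
    then have "bounded_linear (\<lambda>w. ?D y (w - inner w n *\<^sub>R n))"
      by (rule bounded_linear_compose)
        (intro bounded_linear_sub bounded_linear_ident bounded_linear_compose[OF bounded_linear_scaleR_left] bounded_linear_inner_left)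
    then show ?thesis unfolding K_def
      by (intro bounded_linear_sub bounded_linear_add bounded_linear_ident
          bounded_linear_compose[OF bounded_linear_scaleR_left]
          bounded_linear_compose[OF bounded_linear_mult_left] bounded_linear_inner_left)
  qed
  have DK: "D\<theta> y (K y w) = w" if "y \<in> U0" for y w
  proof -
    let ?w = "w - inner w n *\<^sub>R n" and ?s = "(inner w n - ?D y (w - inner w n *\<^sub>R n)) * inverse (?D y n)"
    have y: "y \<in> O'" "?D y n \<noteq> 0" using that by (auto simp: U0_def)
    have "inner (K y w) n = ?s" by (simp add: K_def inner_add_left inner_diff_left nn)
    moreover have "?D y (K y w) = ?D y ?w + ?s * ?D y n"
      using linear_add[OF lD[OF y(1)]] linear_scale[OF lD[OF y(1)]] by (simp add: K_def)
    then have "?D y (K y w) = inner w n" using y(2) by (simp only: mult.assoc) simp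
    ultimately have "D\<theta> y (K y w) = K y w + (inner w n - ?s) *\<^sub>R n" by (simp add: D\<theta>_def)
    also have "\<dots> = w" by (simp add: K_def scaleR_left_diff_distrib)
    finally show ?thesis .
  qed
  have KD: "K y (D\<theta> y w) = w" if "y \<in> U0" for y w
  proof -
    have "linear (D\<theta> y)" "linear (K y)" using that bD bK U0O by (auto simp: bounded_linear.linear)
    then show ?thesis using linear_inverse_left[of "D\<theta> y" "K y"] DK[OF that]
      by (auto simp: fun_eq_iff o_def id_def)
  qed
  define B where "B = (\<lambda>y. Blinfun (D\<theta> y))"
  have B: "blinfun_apply (B y) = D\<theta> y" if "y \<in> O'" for y
    unfolding B_def using bounded_linear_Blinfun_apply[OF bD[OF that]] .
  have aU0: "a \<in> U0" using a nz by (simp add: U0_def)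
  have id: "Blinfun (K a) o\<^sub>L B a = id_blinfun"
    using bounded_linear_Blinfun_apply[OF bK[OF a]] KD[OF aU0] B[OF a]
    by (intro blinfun_eqI) simp
  have cB: "continuous_on U0 B"
  proof (rule continuous_on_blinfun_componentwise)
    fix i :: 'a
    have "continuous_on U0 (\<lambda>y. D\<theta> y i)" unfolding D\<theta>_def
      by (intro continuous_intros continuous_on_subset[OF cD U0O])
    then show "continuous_on U0 (\<lambda>x. blinfun_apply (B x) i)"
      using U0O by (subst continuous_on_cong[OF refl, of _ _ "\<lambda>y. D\<theta> y i"]) (auto simp: B)
  qed
  have tdB: "(\<theta> has_derivative blinfun_apply (B y)) (at y)" if "y \<in> U0" for y
    using td[of y] that U0O B[of y] by auto
  obtain U V g g' where U: "open U" "U \<subseteq> U0" "a \<in> U" "open V" "homeomorphism U V \<theta> g"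
    and g: "\<And>y. y \<in> V \<Longrightarrow> (g has_derivative (g' y)) (at y)"
      "\<And>y. y \<in> V \<Longrightarrow> g' y = inv_into UNIV (blinfun_apply (B (g y)))"
      "\<And>y. y \<in> V \<Longrightarrow> bij (blinfun_apply (B (g y)))"
    using inverse_function_theorem[OF U0 tdB cB aU0 id] by metis
  have gV: "g ` V \<subseteq> U0" using U(2,5) by (auto simp: homeomorphism_def)
  have g'K: "g' y = K (g y)" if "y \<in> V" for y
  proof -
    have "g y \<in> U0" using gV that by blast
    then show ?thesis
      using g(2)[OF that] B[of "g y"] U0O inv_equality[of "K (g y)" "D\<theta> (g y)"] DK KD by auto
  qed
  have sg: "smooth_on V g"
  proof (rule smooth_on_autonomous[OF U0 U(4) gV])
    show "(g has_derivative (\<lambda>w. K (g y) w)) (at y)" if "y \<in> V" for y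
      using g(1)[OF that] g'K[OF that] by simp
    show "smooth_on U0 (\<lambda>x. K x w)" for w
    proof -
      have s: "smooth_on U0 (\<lambda>x. ?D x u)" for u
        by (rule smooth_on_subset[OF smooth_on_frechet_derivative[OF h] U0O])
      have "smooth_on U0 (\<lambda>x. inverse (?D x n))"
        by (rule smooth_on_compose[OF s smooth_on_inverse_real U0]) (auto simp: U0_def)
      then show ?thesis unfolding K_def
        by (intro smooth_on_add smooth_on_const U0 smooth_on_bilinear[OF bounded_bilinear_scaleR]
            smooth_on_bilinear[OF bounded_bilinear_mult] smooth_on_diff s)
    qed
  qed
  have "smooth_on U \<theta>"
    unfolding \<theta>_def using U(1,2) U0O
    by (intro smooth_on_add smooth_on_id smooth_on_bilinear[OF bounded_bilinear_scaleR] smooth_on_diff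
        smooth_on_const smooth_on_linear bounded_linear_inner_left smooth_on_subset[OF h]) auto
  then show thesis
    using that[of U V g] U U0O sg by (auto simp: homeomorphism_def)
qed

text \<open>
  Straighten the ambient submanifold by one of its charts and then the function by a shear along a
  unit vector \<open>n\<close> of the slice on which its derivative does not vanish: the level set
  becomes the part of the slice orthogonal to \<open>n\<close>. The tangent space is contained in
  the kernel of the derivative, and both have dimension \<open>k\<close>.
\<close>

theorem regular_level_set:
  fixes f :: "'a::euclidean_space \<Rightarrow> real"
  assumes N: "embedded_submanifold (Suc k) N" and W: "open W" and f: "smooth_on W f"
    and reg: "\<And>p. p \<in> N \<Longrightarrow> p \<in> W \<Longrightarrow> f p = 0 \<Longrightarrow> \<exists>v\<in>tangent_space N p. frechet_derivative f (at p) v \<noteq> 0"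
  shows "embedded_submanifold k {x \<in> N \<inter> W. f x = 0}" (is "embedded_submanifold k ?M")
    and "p \<in> {x \<in> N \<inter> W. f x = 0} \<Longrightarrow> tangent_space {x \<in> N \<inter> W. f x = 0} p
           = {v \<in> tangent_space N p. frechet_derivative f (at p) v = 0}"
proof -
  show M: "embedded_submanifold k ?M"
    unfolding embedded_submanifold_slice_chart
  proof
    fix p assume p: "p \<in> ?M"
    then obtain U \<phi> \<psi> L where c: "slice_chart N U \<phi> \<psi> L" and pU: "p \<in> U" and k: "dim L = Suc k"
      using N unfolding embedded_submanifold_slice_chart by blast
    have c': "open U" "open (\<phi> ` U)" "smooth_on U \<phi>" "smooth_on (\<phi> ` U) \<psi>" "\<And>x. x \<in> U \<Longrightarrow> \<psi> (\<phi> x) = x" "subspace L"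
      using c by (auto simp: slice_chart_def)
    define a where "a = \<phi> p"
    define O' where "O' = \<phi> ` U \<inter> \<psi> -` W"
    define h where "h = (\<lambda>y. f (\<psi> y))"
    have O: "open O'" unfolding O'_def
      using c' W by (intro continuous_open_preimage smooth_on_imp_continuous_on)
    have sh: "smooth_on O' h" unfolding h_def
      by (rule smooth_on_compose[OF smooth_on_subset[OF c'(4)] f O W]) (auto simp: O'_def)
    have aO: "a \<in> O'" using p pU c' by (auto simp: O'_def a_def)
    obtain v where v: "v \<in> tangent_space N p" "frechet_derivative f (at p) v \<noteq> 0" using reg p by blast
    then obtain l where l: "l \<in> L" "v = frechet_derivative \<psi> (at a) l"
      using tangent_space_slice_chart[OF c pU] p by (auto simp: a_def)
    have Dh: "frechet_derivative h (at a) w = frechet_derivative f (at p) (frechet_derivative \<psi> (at a) w)" for w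
    proof -
      have 1: "(\<psi> has_derivative frechet_derivative \<psi> (at a)) (at a)"
        using smooth_on_has_derivative[OF c'(4)] pU by (simp add: a_def)
      have 2: "(f has_derivative frechet_derivative f (at p)) (at (\<psi> a))"
        using smooth_on_has_derivative[OF f] p pU c' by (simp add: a_def)
      show ?thesis
        using frechet_derivative_at[OF has_derivative_compose[OF 1 2]] unfolding h_def by metis
    qed
    have lh: "linear (frechet_derivative h (at a))"
      using smooth_on_has_derivative[OF sh aO] has_derivative_linear by blast
    have hl: "frechet_derivative h (at a) l \<noteq> 0" using v l Dh by simp
    then have "l \<noteq> 0" using linear_0[OF lh] by auto
    define n where "n = l /\<^sub>R norm l"
    have n: "norm n = 1" "n \<in> L" using \<open>l \<noteq> 0\<close> l(1) c'(6) by (auto simp: n_def subspace_scale)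
    have hn: "frechet_derivative h (at a) n \<noteq> 0"
      using hl \<open>l \<noteq> 0\<close> linear_scale[OF lh] by (simp add: n_def)
    define \<theta> where "\<theta> = (\<lambda>y. y + (h y - inner y n) *\<^sub>R n)"
    obtain U' V g where U': "open U'" "a \<in> U'" "U' \<subseteq> O'" "open V" "\<theta> ` U' = V" "smooth_on V g"
      "\<And>y. y \<in> U' \<Longrightarrow> g (\<theta> y) = y" "smooth_on U' \<theta>"
      using shear_inverse[OF n(1) O sh aO hn] unfolding \<theta>_def by blast
    define U2 where "U2 = U \<inter> \<phi> -` U'"
    define L2 where "L2 = {z \<in> L. \<forall>x\<in>span {n}. orthogonal x z}"
    have U2: "open U2" unfolding U2_def
      using c' U' by (intro continuous_open_preimage smooth_on_imp_continuous_on)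
    have p2: "\<phi> ` U2 = U'" using U'(3) by (auto simp: U2_def O'_def)
    have L2: "L2 = {z \<in> L. inner z n = 0}"
      unfolding L2_def by (auto simp: orthogonal_def span_singleton inner_commute)
    have "dim L2 + dim (span {n}) = dim L"
      unfolding L2_def using n(2) c'(6) by (intro dim_subspace_orthogonal_to_vectors) (auto simp: span_minimal)
    moreover have "dim (span {n}) = 1" using n(1) by (auto simp: dim_singleton)
    ultimately have dimL2: "dim L2 = k" using k by simp
    have sL2: "subspace L2" using c'(6) unfolding L2
      by (auto simp: subspace_def inner_add_left)
    have \<theta>L: "\<theta> y \<in> L2 \<longleftrightarrow> y \<in> L \<and> h y = 0" for y
    proof -
      have "inner (\<theta> y) n = h y" using n(1) by (simp add: \<theta>_def inner_add_left norm_eq_1)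
      moreover have "\<theta> y \<in> L \<longleftrightarrow> y \<in> L"
      proof
        assume "\<theta> y \<in> L"
        then have "\<theta> y - (h y - inner y n) *\<^sub>R n \<in> L"
          using n(2) c'(6) by (intro subspace_diff subspace_scale)
        then show "y \<in> L" by (simp add: \<theta>_def)
      next
        assume "y \<in> L"
        then show "\<theta> y \<in> L" unfolding \<theta>_def using n(2) c'(6) by (intro subspace_add subspace_scale)
      qed
      ultimately show ?thesis by (auto simp: L2)
    qed
    have mem: "x \<in> ?M \<longleftrightarrow> \<theta> (\<phi> x) \<in> L2" if "x \<in> U2" for x
    proof -
      have x: "x \<in> U" "\<phi> x \<in> O'" using that U'(3) by (auto simp: U2_def)
      then show ?thesis using slice_chart_mem[OF c x(1)] \<theta>L c'(5)[OF x(1)]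
        by (auto simp: h_def O'_def)
    qed
    have im: "(\<lambda>x. \<theta> (\<phi> x)) ` U2 = V" using p2 U'(5) by auto
    have "slice_chart ?M U2 (\<lambda>x. \<theta> (\<phi> x)) (\<lambda>y. \<psi> (g y)) L2"
      unfolding slice_chart_def im
    proof (intro conjI)
      show "smooth_on U2 (\<lambda>x. \<theta> (\<phi> x))"
        by (rule smooth_on_compose[OF smooth_on_subset[OF c'(3)] U'(8) U2 U'(1)]) (auto simp: U2_def)
      have "g ` V \<subseteq> \<phi> ` U" using U'(3,5,7) by (auto simp: O'_def)
      then show "smooth_on V (\<lambda>y. \<psi> (g y))"
        by (intro smooth_on_compose[OF U'(6) c'(4) U'(4) c'(2)])
      show "\<forall>x\<in>U2. \<psi> (g (\<theta> (\<phi> x))) = x" using U'(7) c'(5) by (auto simp: U2_def)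
      show "(\<lambda>x. \<theta> (\<phi> x)) ` (U2 \<inter> ?M) = V \<inter> L2" using mem im by blast
    qed (use U2 U' sL2 in auto)
    moreover have "p \<in> U2" using pU U'(2) by (simp add: U2_def a_def)
    ultimately show "\<exists>U \<phi> \<psi> L. slice_chart ?M U \<phi> \<psi> L \<and> p \<in> U \<and> dim L = k" using dimL2 by blast
  qed
  assume p: "p \<in> ?M"
  let ?T = "{v \<in> tangent_space N p. frechet_derivative f (at p) v = 0}"
  have fd: "(f has_derivative frechet_derivative f (at p)) (at p)"
    using smooth_on_has_derivative[OF f] p by auto
  note lf = has_derivative_linear[OF fd]
  have "tangent_space ?M p \<subseteq> ?T"
  proof
    fix v assume "v \<in> tangent_space ?M p"
    then obtain \<gamma> \<epsilon> where \<gamma>: "0 < \<epsilon>" "smooth_on {-\<epsilon><..<\<epsilon>} \<gamma>" "\<gamma> ` {-\<epsilon><..<\<epsilon>} \<subseteq> ?M" "\<gamma> 0 = p"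
      "(\<gamma> has_vector_derivative v) (at (0::real))"
      unfolding tangent_space_altdef by blast
    have "v \<in> tangent_space N p" unfolding tangent_space_altdef using \<gamma> by blast
    moreover have "frechet_derivative f (at p) v = 0"
    proof -
      have "((\<lambda>t. f (\<gamma> t)) has_derivative (\<lambda>s. frechet_derivative f (at p) (s *\<^sub>R v))) (at 0)"
        using has_derivative_compose[OF \<gamma>(5)[unfolded has_vector_derivative_def]] fd \<gamma>(4) by simp
      then have "((\<lambda>t. 0) has_derivative (\<lambda>s. frechet_derivative f (at p) (s *\<^sub>R v))) (at (0::real))"
        by (rule has_derivative_transform_within_open[of _ _ _ _ "{-\<epsilon><..<\<epsilon>}"]) (use \<gamma>(1,3) in \<open>auto simp: image_subset_iff\<close>)
      from has_derivative_unique[OF this has_derivative_const]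
      show ?thesis by (metis scaleR_one)
    qed
    ultimately show "v \<in> ?T" by simp
  qed
  moreover have "subspace (tangent_space ?M p)" "dim (tangent_space ?M p) = k"
    using tangent_space_subspace_dim[OF M p] by auto
  moreover have TN: "subspace (tangent_space N p)" "dim (tangent_space N p) = Suc k"
    using tangent_space_subspace_dim[OF N, of p] p by auto
  moreover have sT: "subspace ?T"
    using TN(1) linear_0[OF lf] linear_add[OF lf] linear_scale[OF lf] by (auto simp: subspace_def)
  moreover have "dim ?T \<le> k"
  proof -
    have "?T \<subset> tangent_space N p" using reg[of p] p by blast
    then have "span ?T \<subset> span (tangent_space N p)" using sT TN(1) by (simp add: span_eq_iff[THEN iffD2])
    then show ?thesis using dim_psubset[of ?T "tangent_space N p"] TN(2) by simp
  qed
  ultimately show "tangent_space ?M p = ?T"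
    by (metis (no_types, lifting) subspace_dim_equal)
qed

section \<open>Orientability from a normal frame\<close>

lemma leibniz_det_mult:
  "leibniz_det k (\<lambda>i j. \<Sum>l<k. A i l * B l j) = leibniz_det k A * leibniz_det k B"
proof -
  have eq: "leibniz_det k C = Determinant.det (Matrix.mat k k (\<lambda>(i,j). C i j))" for C
    by (simp add: leibniz_det_def Determinant.det_def lessThan_atLeast0 cong: sum.cong prod.cong)
      (rule sum.cong, auto intro!: prod.cong simp: permutes_in_image)
  have "Matrix.mat k k (\<lambda>(i,j). \<Sum>l<k. A i l * B l j)
      = Matrix.mat k k (\<lambda>(i,j). A i j) * Matrix.mat k k (\<lambda>(i,j). B i j)"
    by (rule eq_matI) (auto simp: scalar_prod_def lessThan_atLeast0)
  then show ?thesis by (simp add: eq Determinant.det_mult[of _ k])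
qed

lemma leibniz_det_cong:
  assumes "\<And>i j. i < k \<Longrightarrow> j < k \<Longrightarrow> A i j = B i j"
  shows "leibniz_det k A = leibniz_det k B"
proof -
  have "(\<Prod>i<k. A i (p i)) = (\<Prod>i<k. B i (p i))" if "p permutes {..<k}" for p
    using assms permutes_in_image[OF that] by (intro prod.cong) auto
  then show ?thesis unfolding leibniz_det_def by (intro sum.cong) auto
qed

text \<open>
  Permutations that move the last index pick a zero in the last row, so only those of the smaller
  set contribute.
\<close>

lemma leibniz_det_unit_row:
  assumes "A n n = 1" "\<And>j. j < n \<Longrightarrow> A n j = 0"
  shows "leibniz_det (Suc n) A = leibniz_det n A"
proof -
  let ?t = "\<lambda>p. of_int (sign p) * (\<Prod>i<Suc n. A i (p i))"
  have sub: "{p. p permutes {..<n}} \<subseteq> {p. p permutes {..<Suc n}}"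
    by (auto intro: permutes_subset)
  have "leibniz_det (Suc n) A = (\<Sum>p | p permutes {..<n}. ?t p)"
    unfolding leibniz_det_def
  proof (rule sum.mono_neutral_right[OF finite_permutations sub])
    show "\<forall>p\<in>{p. p permutes {..<Suc n}} - {p. p permutes {..<n}}. ?t p = 0"
    proof
      fix p assume p: "p \<in> {p. p permutes {..<Suc n}} - {p. p permutes {..<n}}"
      then have pS: "p permutes {..<Suc n}" by simp
      have "p n \<noteq> n"
      proof
        assume "p n = n"
        then have "p permutes {..<n}"
          by (intro permutes_superset[OF pS]) (auto simp: less_Suc_eq)
        with p show False by simp
      qed
      moreover have "p n < Suc n" using permutes_in_image[OF pS, of n] by auto
      ultimately show "?t p = 0" using assms(2)[of "p n"] by simp
    qed
  qed simp
  also have "\<dots> = leibniz_det n A"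
    unfolding leibniz_det_def using assms(1)
    by (intro sum.cong) (auto simp: permutes_not_in)
  finally show ?thesis .
qed

text \<open>
  The block matrix with \<open>A\<close> in the upper left corner and an identity block below it.
  It extends a change of basis of a tangent space by the identity on a normal frame.
\<close>

definition unit_extension :: "nat \<Rightarrow> (nat \<Rightarrow> nat \<Rightarrow> real) \<Rightarrow> nat \<Rightarrow> nat \<Rightarrow> real" where
  "unit_extension k A i j = (if i < k \<and> j < k then A i j else if i = j then 1 else 0)"

lemma leibniz_det_unit_extension:
  "k \<le> n \<Longrightarrow> leibniz_det n (unit_extension k A) = leibniz_det k A"
proof (induction n rule: dec_induct)
  case base
  show ?case by (rule leibniz_det_cong) (simp add: unit_extension_def)
next
  case (step n)
  have "leibniz_det (Suc n) (unit_extension k A) = leibniz_det n (unit_extension k A)"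
    by (rule leibniz_det_unit_row) (use step in \<open>auto simp: unit_extension_def\<close>)
  with step show ?case by simp
qed

lemma leibniz_det_identity: "leibniz_det n (\<lambda>i j. if i = j then 1 else 0) = 1"
  using leibniz_det_unit_extension[of 0 n "\<lambda>_ _. 0"]
  by (simp add: unit_extension_def leibniz_det_def)

lemma leibniz_det_scale_first:
  assumes "0 < n"
  shows "leibniz_det n (unit_extension 1 (\<lambda>_ _. s)) = s"
  using leibniz_det_unit_extension[of 1 n "\<lambda>_ _. s"] assms
  by (simp add: leibniz_det_def lessThan_Suc)

text \<open>
  The determinant of the coordinates of \<open>x\<close> with respect to \<open>e\<close>; its
  sign compares the orientations of frames of the ambient space.
\<close>

definition frame_volume :: "(nat \<Rightarrow> 'a::euclidean_space) \<Rightarrow> (nat \<Rightarrow> 'a) \<Rightarrow> real" where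
  "frame_volume e x = leibniz_det DIM('a) (\<lambda>i j. inner (x j) (e i))"

lemma frame_volume_change:
  fixes x y e :: "nat \<Rightarrow> 'a::euclidean_space"
  assumes "\<And>j. j < DIM('a) \<Longrightarrow> y j = (\<Sum>l<DIM('a). C l j *\<^sub>R x l)"
  shows "frame_volume e y = frame_volume e x * leibniz_det DIM('a) C"
proof -
  have "frame_volume e y = leibniz_det DIM('a) (\<lambda>i j. \<Sum>l<DIM('a). inner (x l) (e i) * C l j)"
    unfolding frame_volume_def
    by (rule leibniz_det_cong) (simp add: assms inner_sum_left mult.commute)
  then show ?thesis by (simp add: leibniz_det_mult frame_volume_def)
qed

text \<open>
  The coordinate matrix of an orthonormal frame is orthogonal, so its determinant has the square
  1.
\<close>

lemma frame_volume_orthonormal: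
  fixes x e :: "nat \<Rightarrow> 'a::euclidean_space"
  assumes e: "bij_betw e {..<DIM('a)} Basis"
    and x: "\<And>i j. i < DIM('a) \<Longrightarrow> j < DIM('a) \<Longrightarrow> inner (x i) (x j) = (if i = j then 1 else 0)"
  shows "frame_volume e x \<noteq> 0"
proof -
  have "inner (x a) (x b) = (\<Sum>i<DIM('a). inner (x a) (e i) * inner (x b) (e i))" for a b
    by (subst euclidean_inner) (rule sum.reindex_bij_betw[OF e, symmetric])
  then have "leibniz_det DIM('a) (\<lambda>a b. \<Sum>i<DIM('a). inner (x a) (e i) * inner (x b) (e i))
      = leibniz_det DIM('a) (\<lambda>a b. if a = b then 1 else 0)"
    by (intro leibniz_det_cong) (metis x)
  then have "leibniz_det DIM('a) (\<lambda>a i. inner (x a) (e i)) * frame_volume e x = 1"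
    by (simp only: leibniz_det_mult frame_volume_def leibniz_det_identity)
  then show ?thesis by auto
qed

lemma orthonormal_ordered_basis:
  fixes b :: "nat \<Rightarrow> 'a::euclidean_space"
  assumes V: "subspace V" "dim V = k" and b: "\<And>i. i < k \<Longrightarrow> b i \<in> V"
    and on: "\<And>i j. i < k \<Longrightarrow> j < k \<Longrightarrow> inner (b i) (b j) = (if i = j then 1 else 0)"
  shows "ordered_basis k V b" and "v \<in> V \<Longrightarrow> v = (\<Sum>i<k. inner v (b i) *\<^sub>R b i)"
proof -
  have inj: "inj_on b {..<k}"
  proof (rule inj_onI)
    fix i j assume "i \<in> {..<k}" "j \<in> {..<k}" "b i = b j"
    then show "i = j" using on[of i j] on[of i i] by (auto split: if_splits)
  qed
  have orth: "pairwise orthogonal (b ` {..<k})"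
    using on by (auto simp: pairwise_def orthogonal_def)
  have nrm: "\<And>x. x \<in> b ` {..<k} \<Longrightarrow> norm x = 1" using on by (auto simp: norm_eq_1)
  have ind: "independent (b ` {..<k})"
    using nrm by (intro pairwise_orthogonal_independent[OF orth]) force
  have "span (b ` {..<k}) = V"
  proof (rule subspace_dim_equal)
    show "dim V \<le> dim (span (b ` {..<k}))"
      using V ind inj by (simp add: dim_eq_card_independent card_image)
    show "span (b ` {..<k}) \<subseteq> V" using b V by (intro span_minimal) auto
  qed (use V in auto)
  with inj ind show "ordered_basis k V b" by (simp add: ordered_basis_def)
  assume "v \<in> V"
  then have "(\<Sum>x\<in>b ` {..<k}. inner v x *\<^sub>R x) = v"
    using \<open>span (b ` {..<k}) = V\<close> orth nrm by (intro orthonormal_basis_expand) auto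
  then show "v = (\<Sum>i<k. inner v (b i) *\<^sub>R b i)" by (simp add: sum.reindex[OF inj])
qed

text \<open>
  The normal frame orients the tangent spaces: call a basis positive if the normal frame completes
  it to a positive frame of the ambient space. Near a point, projecting a positive basis
  orthogonally to the neighbouring tangent spaces gives a continuous frame, which stays positive
  since its volume is continuous. Two positive frames of the same tangent space differ by a matrix
  whose unit extension, and hence which itself, has positive determinant.
\<close>

theorem orientable_of_orthonormal_normal_frame:
  fixes M :: "'a::euclidean_space set" and g :: "nat \<Rightarrow> 'a \<Rightarrow> 'a"
  assumes k: "0 < k" "k + r = DIM('a)"
    and cont: "\<And>i. i < r \<Longrightarrow> continuous_on M (g i)"
    and on: "\<And>p i j. p \<in> M \<Longrightarrow> i < r \<Longrightarrow> j < r \<Longrightarrow> inner (g i p) (g j p) = (if i = j then 1 else 0)"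
    and T: "\<And>p. p \<in> M \<Longrightarrow> tangent_space M p = {v. \<forall>i<r. inner v (g i p) = 0}"
    and dimT: "\<And>p. p \<in> M \<Longrightarrow> dim (tangent_space M p) = k"
  shows "orientable k M"
proof -
  let ?n = "DIM('a)"
  obtain e where e: "bij_betw e {..<?n} (Basis :: 'a set)"
    using ex_bij_betw_nat_finite[OF finite_Basis] by (metis atLeast0LessThan)
  define fr where "fr = (\<lambda>b q i. if i < k then b i else g (i - k) q)"
  have sT: "subspace (tangent_space M p)" if "p \<in> M" for p
    unfolding T[OF that] by (auto simp: subspace_def inner_add_left)
  have fr_on: "inner (fr b q i) (fr b q j) = (if i = j then 1 else 0)"
    if "q \<in> M" "\<And>i. i < k \<Longrightarrow> b i \<in> tangent_space M q"
      "\<And>i j. i < k \<Longrightarrow> j < k \<Longrightarrow> inner (b i) (b j) = (if i = j then 1 else 0)" "i < ?n" "j < ?n" for b q i j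
  proof -
    have "inner (b i) (g l q) = 0" "inner (g l q) (b i) = 0" if "i < k" "l < r" for i l
      using \<open>i < k\<close> \<open>l < r\<close> that(1) \<open>\<And>i. i < k \<Longrightarrow> b i \<in> tangent_space M q\<close> T[OF \<open>q \<in> M\<close>]
      by (auto simp: inner_commute)
    moreover have "i - k < r" if "\<not> i < k" "i < ?n" for i using that k by linarith
    ultimately show ?thesis using that on[OF that(1)] unfolding fr_def by auto
  qed
  have "\<exists>b. (\<forall>i<k. b i \<in> tangent_space M p) \<and>
      (\<forall>i<k. \<forall>j<k. inner (b i) (b j) = (if i = j then 1 else 0)) \<and>
      0 < frame_volume e (fr b p)" if p: "p \<in> M" for p
  proof -
    obtain B where B: "B \<subseteq> tangent_space M p" "pairwise orthogonal B" "\<And>x. x \<in> B \<Longrightarrow> norm x = 1"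
      "independent B" "card B = dim (tangent_space M p)"
      using orthonormal_basis_subspace[OF sT[OF p]] by metis
    obtain b where b: "bij_betw b {..<k} B"
      using ex_bij_betw_nat_finite[of B] B(4,5) dimT[OF p] independent_imp_finite
      by (metis atLeast0LessThan)
    have bT: "b i \<in> tangent_space M p" if "i < k" for i using b B(1) that by (auto simp: bij_betw_def)
    have bo: "inner (b i) (b j) = (if i = j then 1 else 0)" if "i < k" "j < k" for i j
    proof (cases "i = j")
      case True
      then show ?thesis using b B(3)[of "b i"] that by (auto simp: bij_betw_def norm_eq_1)
    next
      case False
      then have "b i \<noteq> b j" "b i \<in> B" "b j \<in> B" using b that by (auto simp: bij_betw_def inj_on_def)
      then show ?thesis using B(2) False by (auto simp: pairwise_def orthogonal_def)
    qed
    have nz: "frame_volume e (fr b p) \<noteq> 0"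
      by (intro frame_volume_orthonormal[OF e] fr_on[OF p]) (use bT bo in auto)
    define s where "s = sgn (frame_volume e (fr b p))"
    have s: "s * s = 1" "0 < frame_volume e (fr b p) * s"
      using nz by (auto simp: s_def sgn_real_def)
    (* Rescaling the first vector by the sign of the volume makes the basis positive. *)
    define b' where "b' = b(0 := s *\<^sub>R b 0)"
    have "frame_volume e (fr b' p) = frame_volume e (fr b p) * leibniz_det ?n (unit_extension 1 (\<lambda>_ _. s))"
    proof (rule frame_volume_change)
      fix j assume j: "j < ?n"
      have "(\<Sum>l<?n. unit_extension 1 (\<lambda>_ _. s) l j *\<^sub>R fr b p l)
          = (\<Sum>l<?n. if l = j then (if j = 0 then s else 1) *\<^sub>R fr b p j else 0)"
        by (intro sum.cong) (auto simp: unit_extension_def)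
      also have "\<dots> = fr b' p j" using j k by (auto simp: fr_def b'_def)
      finally show "fr b' p j = (\<Sum>l<?n. unit_extension 1 (\<lambda>_ _. s) l j *\<^sub>R fr b p l)" by simp
    qed
    then have "0 < frame_volume e (fr b' p)" using s leibniz_det_scale_first[of ?n s] by simp
    moreover have "b' i \<in> tangent_space M p" if "i < k" for i
      using bT sT[OF p] that k(1) by (auto simp: b'_def subspace_scale)
    moreover have "inner (b' i) (b' j) = (if i = j then 1 else 0)" if "i < k" "j < k" for i j
      using bo that s k(1) by (auto simp: b'_def)
    ultimately show ?thesis by blast
  qed
  then obtain b where b: "\<And>p. p \<in> M \<Longrightarrow> \<forall>i<k. b p i \<in> tangent_space M p"
    "\<And>p. p \<in> M \<Longrightarrow> \<forall>i<k. \<forall>j<k. inner (b p i) (b p j) = (if i = j then 1 else 0)"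
    "\<And>p. p \<in> M \<Longrightarrow> 0 < frame_volume e (fr (b p) p)"
    by metis
  show ?thesis
    unfolding orientable_def
  proof (intro exI[of _ b] ballI conjI)
    fix p assume p: "p \<in> M"
    show "ordered_basis k (tangent_space M p) (b p)"
      using b[OF p] sT[OF p] dimT[OF p] by (intro orthonormal_ordered_basis) auto
    (* The orthogonal projections of the basis at p to the tangent spaces at nearby points q. *)
    define X where "X = (\<lambda>i q. b p i - (\<Sum>l<r. inner (b p i) (g l q) *\<^sub>R g l q))"
    define w where "w = (\<lambda>q. frame_volume e (fr (\<lambda>i. X i q) q))"
    have cX: "continuous_on M (X i)" for i
      unfolding X_def by (intro continuous_intros cont) auto
    have "continuous_on M (\<lambda>q. fr (\<lambda>i. X i q) q j)" if "j < ?n" for j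
      using cX cont[of "j - k"] that k unfolding fr_def by (cases "j < k") auto
    then have "continuous_on M w"
      unfolding w_def frame_volume_def leibniz_det_def
      by (intro continuous_intros) (auto dest: permutes_in_image)
    then have "openin (top_of_set M) (M \<inter> w -` {0<..})"
      by (intro continuous_openin_preimage_gen) auto
    then obtain U where U: "open U" "M \<inter> w -` {0<..} = M \<inter> U"
      by (auto simp: openin_open)
    have "X i p = b p i" if "i < k" for i
      using b(1)[OF p] T[OF p] that by (auto simp: X_def)
    then have "fr (\<lambda>i. X i p) p = fr (b p) p" by (auto simp: fr_def)
    then have "p \<in> U" using U(2) p b(3)[OF p] unfolding w_def by fastforce
    moreover have "same_orientation k (b q) (\<lambda>i. X i q)" if q: "q \<in> U \<inter> M" for q
    proof -
      have qM: "q \<in> M" and wq: "0 < w q" using q U(2) by auto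
      have XT: "X i q \<in> tangent_space M q" for i
      proof -
        have "inner (X i q) (g j q) = 0" if "j < r" for j
        proof -
          have "inner (\<Sum>l<r. inner (b p i) (g l q) *\<^sub>R g l q) (g j q)
              = (\<Sum>l<r. if l = j then inner (b p i) (g j q) else 0)"
            unfolding inner_sum_left by (intro sum.cong) (auto simp: on[OF qM _ that])
          then show ?thesis using that by (simp add: X_def inner_diff_left)
        qed
        then show ?thesis by (simp add: T[OF qM])
      qed
      define C where "C = (\<lambda>i j. inner (X j q) (b q i))"
      have XC: "X j q = (\<Sum>i<k. C i j *\<^sub>R b q i)" for j
        unfolding C_def
        using b[OF qM] sT[OF qM] dimT[OF qM] by (intro orthonormal_ordered_basis(2)[OF _ _ _ _ XT]) auto
      have "w q = frame_volume e (fr (b q) q) * leibniz_det ?n (unit_extension k C)"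
        unfolding w_def
      proof (rule frame_volume_change)
        fix j assume j: "j < ?n"
        show "fr (\<lambda>i. X i q) q j = (\<Sum>l<?n. unit_extension k C l j *\<^sub>R fr (b q) q l)"
        proof (cases "j < k")
          case True
          have "(\<Sum>l<?n. unit_extension k C l j *\<^sub>R fr (b q) q l) = (\<Sum>l<k. C l j *\<^sub>R b q l)"
            by (rule sum.mono_neutral_cong_right) (use True k in \<open>auto simp: unit_extension_def fr_def\<close>)
          then show ?thesis using True XC[of j] by (simp add: fr_def)
        next
          case False
          have "(\<Sum>l<?n. unit_extension k C l j *\<^sub>R fr (b q) q l)
              = (\<Sum>l<?n. if l = j then fr (b q) q j else 0)"
            by (intro sum.cong) (use False in \<open>auto simp: unit_extension_def\<close>)
          then show ?thesis using False j by (simp add: fr_def)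
        qed
      qed
      then have "0 < leibniz_det k C"
        using wq b(3)[OF qM] leibniz_det_unit_extension[of k ?n C] k(2) by (simp add: zero_less_mult_iff)
      then show ?thesis using XC unfolding same_orientation_def by blast
    qed
    ultimately show "\<exists>U X. open U \<and> p \<in> U \<and> (\<forall>i<k. continuous_on (U \<inter> M) (X i)) \<and>
        (\<forall>q\<in>U \<inter> M. same_orientation k (b q) (\<lambda>i. X i q))"
      using U(1) cX by (intro exI[of _ U] exI[of _ X]) (auto intro: continuous_on_subset)
  qed
qed

section \<open>Scalars with conjugation\<close>

lemma conjugate_zero [simp]: "conjugate (0::'f::conjugation_algebra) = 0"
  using conjugate_scaleR[of 0 "0::'f"] by simp

lemma conjugate_one [simp]: "conjugate (1::'f::conjugation_algebra) = 1"
  using mult_conjugate[of "1::'f"] by simp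

lemma conjugate_minus: "conjugate (- x) = - conjugate (x::'f::conjugation_algebra)"
  using conjugate_scaleR[of "-1" x] by simp

lemma conjugate_diff: "conjugate (x - y) = conjugate x - conjugate (y::'f::conjugation_algebra)"
  using conjugate_add[of x "- y"] by (simp add: conjugate_minus)

lemma conjugate_of_real [simp]: "conjugate (of_real r :: 'f::conjugation_algebra) = of_real r"
  by (simp add: of_real_def conjugate_scaleR)

lemma conjugate_sum: "conjugate (sum f A) = (\<Sum>x\<in>A. conjugate (f x :: 'f::conjugation_algebra))"
  by (induction A rule: infinite_finite_induct) (simp_all add: conjugate_add)

lemma norm_conjugate [simp]: "norm (conjugate x) = norm (x::'f::conjugation_algebra)"
proof (cases "x = 0")
  case False
  have "norm (x * conjugate x) = norm x * norm x"
    unfolding mult_conjugate by (simp add: power2_eq_square)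
  then have "norm x * norm (conjugate x) = norm x * norm x" by (simp add: norm_mult)
  with False show ?thesis by simp
qed simp

lemma inner_one_one [simp]: "inner (1::'f::conjugation_algebra) 1 = 1"
  by (simp add: power2_norm_eq_inner[symmetric])

lemma conjugate_mult_self: "conjugate x * x = (norm x)\<^sup>2 *\<^sub>R (1::'f::conjugation_algebra)"
  using mult_conjugate[of "conjugate x"] by simp

lemma inner_conjugate_conjugate [simp]:
  "inner (conjugate x) (conjugate y) = inner x (y::'f::conjugation_algebra)"
  by (simp add: dot_norm conjugate_add[symmetric])

lemma inner_mult_right_conjugate: "inner (x * y) z = inner x (z * conjugate (y::'f::conjugation_algebra))"
  by (subst (1 2) inner_conjugate) (simp add: conjugate_mult mult.assoc)

text \<open>
  Since multiplication need not commute, left factors are moved across the inner product by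
  passing to conjugates, where they become right factors.
\<close>

lemma inner_mult_left_conjugate: "inner (x * y) z = inner y (conjugate x * (z::'f::conjugation_algebra))"
proof -
  have "inner (x * y) z = inner (conjugate y * conjugate x) (conjugate z)"
    by (metis inner_conjugate_conjugate conjugate_mult)
  also have "\<dots> = inner (conjugate y) (conjugate (conjugate x * z))"
    by (simp add: inner_mult_right_conjugate conjugate_mult)
  finally show ?thesis by simp
qed

text \<open>
  Both \<open>x\<close> and \<open>x + 1\<close> are self-conjugate, so both squares are real,
  and their difference is \<open>2 x + 1\<close>.
\<close>

lemma self_conjugate_real:
  assumes "conjugate x = (x::'f::conjugation_algebra)"
  shows "x = of_real (inner x 1)"
proof -
  have 1: "(x + 1) * (x + 1) = (norm (x + 1))\<^sup>2 *\<^sub>R 1"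
    using mult_conjugate[of "x + 1"] assms by (simp add: conjugate_add)
  have 2: "x * x = (norm x)\<^sup>2 *\<^sub>R 1" using mult_conjugate[of x] assms by simp
  have "x + x = ((norm (x + 1))\<^sup>2 - (norm x)\<^sup>2 - 1) *\<^sub>R 1"
    using 1 2 by (simp add: algebra_simps)
  then have "x = (((norm (x + 1))\<^sup>2 - (norm x)\<^sup>2 - 1) / 2) *\<^sub>R 1"
    by (metis (no_types, lifting) add_diff_cancel_left' scaleR_half_double scaleR_scaleR times_divide_eq_left mult_1 divide_inverse mult.commute inverse_eq_divide)
  then obtain r where "x = r *\<^sub>R 1" by blast
  then show ?thesis by (simp add: of_real_def)
qed

section \<open>Matrices with conjugation\<close>

lemma adjoint_matrix_nth [simp]: "adjoint_matrix A $ i $ j = conjugate (A $ j $ i)"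
  by (simp add: adjoint_matrix_def transpose_def)

lemma adjoint_adjoint [simp]: "adjoint_matrix (adjoint_matrix A) = A"
  by (simp add: vec_eq_iff)

lemma adjoint_add: "adjoint_matrix (A + B) = adjoint_matrix A + adjoint_matrix B"
  by (simp add: vec_eq_iff conjugate_add)

lemma adjoint_diff: "adjoint_matrix (A - B) = adjoint_matrix A - adjoint_matrix B"
  by (simp add: vec_eq_iff conjugate_diff)

lemma adjoint_scaleR: "adjoint_matrix (r *\<^sub>R A) = r *\<^sub>R adjoint_matrix A"
  by (simp add: vec_eq_iff conjugate_scaleR)

lemma adjoint_zero [simp]: "adjoint_matrix 0 = 0"
  by (simp add: vec_eq_iff)

lemma adjoint_mat_1 [simp]: "adjoint_matrix (mat 1 :: 'f::conjugation_algebra^'n^'n) = mat 1"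
  by (simp add: vec_eq_iff mat_def)

lemma matrix_mult_nth: "(A ** B) $ i $ j = (\<Sum>k\<in>UNIV. A $ i $ k * B $ k $ j)"
  by (simp add: matrix_matrix_mult_def)

lemma adjoint_mult:
  "adjoint_matrix (A ** B) = adjoint_matrix B ** adjoint_matrix (A :: 'f::conjugation_algebra^'n^'m)"
  by (simp add: vec_eq_iff matrix_mult_nth conjugate_sum conjugate_mult)

lemma inner_matrix_nth: "inner A B = (\<Sum>i\<in>UNIV. \<Sum>j\<in>UNIV. inner (A $ i $ j) (B $ i $ j))"
  by (simp add: inner_vec_def)

text \<open>
  Together with the next lemma this replaces the cyclicity of the trace, which fails for
  quaternionic matrices and holds for the real part only.
\<close>

lemma inner_matrix_mult_right:
  fixes A B C :: "'f::conjugation_algebra^'n^'n"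
  shows "inner (A ** B) C = inner A (C ** adjoint_matrix B)"
proof -
  have "inner (A ** B) C = (\<Sum>i\<in>UNIV. \<Sum>j\<in>UNIV. \<Sum>k\<in>UNIV. inner (A $ i $ k) (C $ i $ j * conjugate (B $ k $ j)))"
    by (simp add: inner_matrix_nth matrix_mult_nth inner_sum_left inner_mult_right_conjugate)
  also have "\<dots> = (\<Sum>i\<in>UNIV. \<Sum>k\<in>UNIV. \<Sum>j\<in>UNIV. inner (A $ i $ k) (C $ i $ j * conjugate (B $ k $ j)))"
    by (intro sum.cong refl sum.swap)
  also have "\<dots> = inner A (C ** adjoint_matrix B)"
    by (simp add: inner_matrix_nth matrix_mult_nth inner_sum_right)
  finally show ?thesis .
qed

lemma inner_matrix_mult_left:
  fixes A B C :: "'f::conjugation_algebra^'n^'n"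
  shows "inner (A ** B) C = inner B (adjoint_matrix A ** C)"
proof -
  have "inner (A ** B) C = (\<Sum>i\<in>UNIV. \<Sum>j\<in>UNIV. \<Sum>k\<in>UNIV. inner (B $ k $ j) (conjugate (A $ i $ k) * C $ i $ j))"
    by (simp add: inner_matrix_nth matrix_mult_nth inner_sum_left inner_mult_left_conjugate)
  also have "\<dots> = (\<Sum>i\<in>UNIV. \<Sum>k\<in>UNIV. \<Sum>j\<in>UNIV. inner (B $ k $ j) (conjugate (A $ i $ k) * C $ i $ j))"
    by (intro sum.cong refl sum.swap)
  also have "\<dots> = (\<Sum>k\<in>UNIV. \<Sum>i\<in>UNIV. \<Sum>j\<in>UNIV. inner (B $ k $ j) (conjugate (A $ i $ k) * C $ i $ j))"
    by (rule sum.swap)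
  also have "\<dots> = (\<Sum>k\<in>UNIV. \<Sum>j\<in>UNIV. \<Sum>i\<in>UNIV. inner (B $ k $ j) (conjugate (A $ i $ k) * C $ i $ j))"
    by (intro sum.cong refl sum.swap)
  also have "\<dots> = inner B (adjoint_matrix A ** C)"
    by (simp add: inner_matrix_nth matrix_mult_nth inner_sum_right)
  finally show ?thesis .
qed

lemma bounded_bilinear_matrix_mult:
  "bounded_bilinear (\<lambda>A B :: 'f::conjugation_algebra^'n^'n. A ** B)"
proof -
  have "bilinear (\<lambda>A B :: 'f::conjugation_algebra^'n^'n. A ** B)"
    unfolding bilinear_def
    by (auto intro!: linearI
        simp: vec_eq_iff matrix_mult_nth algebra_simps sum.distrib scaleR_sum_right)
  then show ?thesis by (simp add: bilinear_conv_bounded_bilinear)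
qed

lemmas matrix_mult_linear = bounded_bilinear.add_left[OF bounded_bilinear_matrix_mult]
  bounded_bilinear.add_right[OF bounded_bilinear_matrix_mult]
  bounded_bilinear.diff_left[OF bounded_bilinear_matrix_mult]
  bounded_bilinear.diff_right[OF bounded_bilinear_matrix_mult]
  bounded_bilinear.minus_left[OF bounded_bilinear_matrix_mult]
  bounded_bilinear.minus_right[OF bounded_bilinear_matrix_mult]
  bounded_bilinear.scaleR_left[OF bounded_bilinear_matrix_mult]
  bounded_bilinear.scaleR_right[OF bounded_bilinear_matrix_mult]
  bounded_bilinear.zero_left[OF bounded_bilinear_matrix_mult]
  bounded_bilinear.zero_right[OF bounded_bilinear_matrix_mult]

lemma linear_adjoint_matrix: "linear (adjoint_matrix :: 'f::conjugation_algebra^'n^'n \<Rightarrow> _)"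
  by (intro linearI adjoint_add adjoint_scaleR)

section \<open>Conjugation by unitary matrices\<close>

definition unitary_conj :: "'f::conjugation_algebra^'n^'n \<Rightarrow> 'f^'n^'n \<Rightarrow> 'f^'n^'n" where
  "unitary_conj P A = adjoint_matrix P ** A ** P"

lemma unitary_groupD:
  assumes "P \<in> unitary_group"
  shows "adjoint_matrix P ** P = mat 1" "P ** adjoint_matrix P = mat 1"
  using assms by (auto simp: unitary_group_def)

lemma unitary_adjoint: "P \<in> unitary_group \<Longrightarrow> adjoint_matrix P \<in> unitary_group"
  by (simp add: unitary_group_def)

lemma unitary_mult:
  assumes "P \<in> unitary_group" "Q \<in> unitary_group"
  shows "P ** Q \<in> unitary_group"
proof -
  have "adjoint_matrix (P ** Q) ** (P ** Q) = adjoint_matrix Q ** (adjoint_matrix P ** P) ** Q"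
    "(P ** Q) ** adjoint_matrix (P ** Q) = P ** (Q ** adjoint_matrix Q) ** adjoint_matrix P"
    by (simp_all only: adjoint_mult matrix_mul_assoc)
  then show ?thesis using assms by (simp add: unitary_groupD) (simp add: unitary_group_def)
qed

lemma mat_1_unitary: "mat 1 \<in> unitary_group"
  by (simp add: unitary_group_def)

lemma unitary_conj_mat_1 [simp]: "unitary_conj (mat 1) A = A"
  by (simp add: unitary_conj_def)

lemma unitary_conj_conj: "unitary_conj Q (unitary_conj P A) = unitary_conj (P ** Q) A"
  by (simp add: unitary_conj_def adjoint_mult matrix_mul_assoc)

lemma unitary_conj_inverse:
  assumes "P \<in> unitary_group"
  shows "unitary_conj (adjoint_matrix P) (unitary_conj P A) = A"
    "unitary_conj P (unitary_conj (adjoint_matrix P) A) = A"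
  using assms by (simp_all add: unitary_conj_conj unitary_groupD)

lemma unitary_conj_mult:
  assumes "P \<in> unitary_group"
  shows "unitary_conj P A ** unitary_conj P B = unitary_conj P (A ** B)"
proof -
  have "unitary_conj P A ** unitary_conj P B = adjoint_matrix P ** A ** (P ** adjoint_matrix P) ** B ** P"
    by (simp only: unitary_conj_def matrix_mul_assoc)
  then show ?thesis using assms by (simp add: unitary_groupD unitary_conj_def matrix_mul_assoc)
qed

lemma inner_unitary_conj:
  assumes "P \<in> unitary_group"
  shows "inner (unitary_conj P A) (unitary_conj P B) = inner A B"
proof -
  have "inner (unitary_conj P A) (unitary_conj P B)
      = inner (adjoint_matrix P ** A) (adjoint_matrix P ** B ** (P ** adjoint_matrix P))"
    unfolding unitary_conj_def inner_matrix_mult_right by (simp only: matrix_mul_assoc)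
  also have "\<dots> = inner A ((P ** adjoint_matrix P) ** B)"
    using assms by (simp add: unitary_groupD(2) inner_matrix_mult_left matrix_mul_assoc)
  finally show ?thesis using assms by (simp add: unitary_groupD(2))
qed

lemma unitary_conj_one: "P \<in> unitary_group \<Longrightarrow> unitary_conj P (mat 1) = mat 1"
  by (simp add: unitary_conj_def unitary_groupD)

lemma adjoint_unitary_conj: "adjoint_matrix (unitary_conj P A) = unitary_conj P (adjoint_matrix A)"
  by (simp add: unitary_conj_def adjoint_mult matrix_mul_assoc)

lemma linear_unitary_conj: "linear (unitary_conj P)"
  unfolding unitary_conj_def by (intro linearI) (simp_all add: matrix_mult_linear)

lemma inj_unitary_conj: "P \<in> unitary_group \<Longrightarrow> inj (unitary_conj P)"
  by (metis injI unitary_conj_inverse(1))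

text \<open>
  Boundedness: all unitary matrices have the norm of the identity.
\<close>

lemma compact_unitary_group: "compact (unitary_group :: ('f::conjugation_algebra^4^4) set)"
proof -
  have "continuous_on UNIV (adjoint_matrix :: 'f^4^4 \<Rightarrow> _)"
    by (rule linear_continuous_on) (simp add: linear_conv_bounded_linear[symmetric] linear_adjoint_matrix)
  then have "continuous_on UNIV (\<lambda>P :: 'f^4^4. adjoint_matrix P ** P)"
    "continuous_on UNIV (\<lambda>P :: 'f^4^4. P ** adjoint_matrix P)"
    by (auto intro!: bounded_bilinear.continuous_on[OF bounded_bilinear_matrix_mult] continuous_on_id)
  then have "closed ({P :: 'f^4^4. adjoint_matrix P ** P = mat 1} \<inter> {P. P ** adjoint_matrix P = mat 1})"
    by (intro closed_Int closed_Collect_eq continuous_on_const)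
  moreover have "{P :: 'f^4^4. adjoint_matrix P ** P = mat 1} \<inter> {P. P ** adjoint_matrix P = mat 1} = unitary_group"
    by (auto simp: unitary_group_def)
  moreover have "norm P \<le> norm (mat 1 :: 'f^4^4)" if "P \<in> unitary_group" for P :: "'f^4^4"
  proof -
    have "inner P P = inner (mat 1 ** P) P" by simp
    also have "\<dots> = inner (mat 1 :: 'f^4^4) (mat 1)"
      unfolding inner_matrix_mult_right using that by (simp add: unitary_groupD)
    finally show ?thesis by (simp add: norm_eq_sqrt_inner)
  qed
  ultimately show ?thesis by (auto simp: compact_eq_bounded_closed bounded_iff)
qed

section \<open>Real diagonal matrices and matrix units\<close>

definition real_diag :: "(4 \<Rightarrow> real) \<Rightarrow> 'f::conjugation_algebra^4^4" where
  "real_diag x = (\<chi> i j. if i = j then of_real (x i) else 0)"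

lemma real_diag_nth [simp]: "real_diag x $ i $ j = (if i = j then of_real (x i) else 0)"
  by (simp add: real_diag_def)

lemma adjoint_real_diag [simp]: "adjoint_matrix (real_diag x) = real_diag x"
  by (simp add: vec_eq_iff)

lemma real_diag_mult_nth [simp]: "(real_diag x ** A) $ i $ j = x i *\<^sub>R A $ i $ j"
proof -
  have "(real_diag x ** A) $ i $ j = (\<Sum>k\<in>UNIV. if k = i then x i *\<^sub>R A $ i $ j else 0)"
    unfolding matrix_mult_nth by (intro sum.cong) (auto simp: scaleR_conv_of_real)
  then show ?thesis by simp
qed

lemma mult_real_diag_nth [simp]: "(A ** real_diag x) $ i $ j = x j *\<^sub>R A $ i $ j"
proof -
  have "(A ** real_diag x) $ i $ j = (\<Sum>k\<in>UNIV. if k = j then x j *\<^sub>R A $ i $ j else 0)"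
    unfolding matrix_mult_nth by (intro sum.cong) (auto simp: of_real_def)
  then show ?thesis by simp
qed

lemma real_diag_mult [simp]: "real_diag x ** real_diag y = real_diag (\<lambda>i. x i * y i)"
  by (simp add: vec_eq_iff of_real_def)

lemma inner_real_diag: "inner (real_diag x) A = (\<Sum>i\<in>UNIV. x i * inner (A $ i $ i) 1)"
proof -
  have "inner (real_diag x) A = (\<Sum>i\<in>UNIV. \<Sum>j\<in>UNIV. if j = i then x i * inner (A $ i $ i) 1 else 0)"
    unfolding inner_matrix_nth
    by (intro sum.cong) (auto simp: of_real_def inner_commute)
  then show ?thesis by simp
qed

lemma inner_real_diag_real_diag [simp]:
  "inner (real_diag x) (real_diag y :: 'f::conjugation_algebra^4^4) = (\<Sum>i\<in>UNIV. x i * y i)"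
  unfolding inner_real_diag by (simp add: of_real_def)

lemma mat_1_real_diag: "mat 1 = real_diag (\<lambda>_. 1)"
  by (simp add: vec_eq_iff mat_def)

definition entry_matrix :: "'n \<Rightarrow> 'n \<Rightarrow> 'f \<Rightarrow> 'f::conjugation_algebra^'n^'n" where
  "entry_matrix i j u = (\<chi> k l. if k = i \<and> l = j then u else 0)"

lemma entry_matrix_nth [simp]: "entry_matrix i j u $ k $ l = (if k = i \<and> l = j then u else 0)"
  by (simp add: entry_matrix_def)

lemma entry_matrix_mult_nth [simp]:
  "(entry_matrix i j u ** A) $ k $ l = (if k = i then u * A $ j $ l else 0)"
proof -
  have "(entry_matrix i j u ** A) $ k $ l = (\<Sum>m\<in>UNIV. if m = j then (if k = i then u * A $ j $ l else 0) else 0)"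
    unfolding matrix_mult_nth by (intro sum.cong) auto
  then show ?thesis by simp
qed

lemma entry_matrix_mult:
  "entry_matrix i j u ** entry_matrix k l v = (if j = k then entry_matrix i l (u * v) else 0)"
  by (simp add: vec_eq_iff)

lemma adjoint_entry_matrix: "adjoint_matrix (entry_matrix i j u) = entry_matrix j i (conjugate u)"
  by (auto simp: vec_eq_iff)

lemma inner_entry_matrix: "inner A (entry_matrix i j u) = inner (A $ i $ j) u"
proof -
  have "inner A (entry_matrix i j u)
      = (\<Sum>k\<in>UNIV. \<Sum>l\<in>UNIV. if l = j then if k = i then inner (A $ i $ j) u else 0 else 0)"
    unfolding inner_matrix_nth by (intro sum.cong) auto
  then show ?thesis by simp
qed

section \<open>Plane rotations\<close>

text \<open>
  The exponential of \<open>t Z\<close> for \<open>Z\<close> with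
  \<open>Z\<^sup>3 = - Z\<close>, by the formula of Rodrigues.
\<close>

definition rotation :: "'f::conjugation_algebra^4^4 \<Rightarrow> real \<Rightarrow> 'f^4^4" where
  "rotation Z t = mat 1 + sin t *\<^sub>R Z + (1 - cos t) *\<^sub>R (Z ** Z)"

lemma rotation_unitary:
  assumes Z: "adjoint_matrix Z = - Z" "Z ** Z ** Z = - Z"
  shows "rotation Z t \<in> unitary_group"
proof -
  have ad: "adjoint_matrix (rotation Z t) = mat 1 - sin t *\<^sub>R Z + (1 - cos t) *\<^sub>R (Z ** Z)"
    by (simp add: rotation_def adjoint_add adjoint_scaleR adjoint_mult Z matrix_mult_linear)
  have Z3: "Z ** (Z ** Z) = - Z" "Z ** Z ** (Z ** Z) = - (Z ** Z)"
    using Z(2) by (simp_all add: matrix_mul_assoc matrix_mult_linear)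
  have r: "(cos t * cos t) *\<^sub>R (Z ** Z) + (sin t * sin t) *\<^sub>R (Z ** Z) = Z ** Z"
    using sin_cos_squared_add3[of t] by (simp add: scaleR_add_left[symmetric])
  have "adjoint_matrix (rotation Z t) ** rotation Z t = mat 1"
    "rotation Z t ** adjoint_matrix (rotation Z t) = mat 1"
    unfolding ad unfolding rotation_def
    by (simp_all add: matrix_mult_linear Z(2) Z3 algebra_simps r)
  then show ?thesis by (simp add: unitary_group_def)
qed

lemma rotation_0 [simp]: "rotation Z 0 = mat 1"
  by (simp add: rotation_def)

lemma rotation_has_derivative: "((rotation Z) has_vector_derivative Z) (at 0)"
  unfolding rotation_def
  by (auto intro!: derivative_eq_intros simp: has_vector_derivative_def)

text \<open>
  The skew-Hermitian generator of the rotations in the plane of the coordinates \<open>i\<close>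
  and \<open>j\<close>, twisted by the unit scalar \<open>u\<close>.
\<close>

definition plane_generator :: "4 \<Rightarrow> 4 \<Rightarrow> 'f \<Rightarrow> 'f::conjugation_algebra^4^4" where
  "plane_generator i j u = entry_matrix i j u - entry_matrix j i (conjugate u)"

lemma plane_generator_skew:
  assumes "i \<noteq> j" "norm u = 1"
  shows "adjoint_matrix (plane_generator i j u) = - plane_generator i j u"
    and "plane_generator i j u ** plane_generator i j u = - (entry_matrix i i 1 + entry_matrix j j 1)"
    and "plane_generator i j u ** plane_generator i j u ** plane_generator i j u = - plane_generator i j u"
proof -
  show "adjoint_matrix (plane_generator i j u) = - plane_generator i j u"
    by (simp add: plane_generator_def adjoint_diff adjoint_entry_matrix)
  have "u * conjugate u = 1" "conjugate u * u = 1" using assms(2) by (simp_all add: mult_conjugate conjugate_mult_self)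
  then show sq: "plane_generator i j u ** plane_generator i j u = - (entry_matrix i i 1 + entry_matrix j j 1)"
    using assms(1) by (simp add: plane_generator_def matrix_mult_linear entry_matrix_mult)
  show "plane_generator i j u ** plane_generator i j u ** plane_generator i j u = - plane_generator i j u"
    unfolding sq using assms(1) by (simp add: plane_generator_def matrix_mult_linear entry_matrix_mult)
qed

text \<open>
  On the right hand side the diagonal entries in the places \<open>i\<close> and \<open>j\<close>
  are exchanged.
\<close>

lemma quarter_turn_swaps:
  assumes "i \<noteq> j"
  shows "unitary_conj (rotation (plane_generator i j 1) (pi / 2)) (real_diag x)
    = real_diag x + entry_matrix i i (of_real (x j - x i)) + entry_matrix j j (of_real (x i - x j) :: 'f::conjugation_algebra)"
proof -
  let ?e = "\<lambda>i j. entry_matrix i j (1::'f)" and ?D = "real_diag x :: 'f^4^4"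
  have De: "?D ** ?e k l = entry_matrix k l (of_real (x k))" for k l
    by (simp add: vec_eq_iff scaleR_conv_of_real)
  have eD: "?e k l ** ?D = entry_matrix k l (of_real (x l))" for k l
    by (simp add: vec_eq_iff scaleR_conv_of_real)
  have R: "rotation (plane_generator i j (1::'f)) (pi / 2) = mat 1 + ?e i j - ?e j i - ?e i i - ?e j j"
    using plane_generator_skew(2)[of i j "1::'f"] assms by (simp add: rotation_def plane_generator_def)
  have aR: "adjoint_matrix (rotation (plane_generator i j (1::'f)) (pi / 2)) = mat 1 + ?e j i - ?e i j - ?e i i - ?e j j"
    unfolding R by (simp add: adjoint_add adjoint_diff adjoint_entry_matrix)
  have off: "entry_matrix i i (of_real (x j - x i)) = entry_matrix i i (of_real (x j)) - entry_matrix i i (of_real (x i) :: 'f)"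
    "entry_matrix j j (of_real (x i - x j)) = entry_matrix j j (of_real (x i)) - entry_matrix j j (of_real (x j) :: 'f)"
    by (simp_all add: vec_eq_iff)
  have DR: "?D ** rotation (plane_generator i j (1::'f)) (pi / 2)
     = ?D + entry_matrix i j (of_real (x i)) - entry_matrix j i (of_real (x j)) - entry_matrix i i (of_real (x i)) - entry_matrix j j (of_real (x j))"
    unfolding R by (simp add: matrix_mult_linear De)
  show ?thesis
    unfolding unitary_conj_def matrix_mul_assoc[symmetric] DR aR off
    using assms by (simp add: matrix_mult_linear eD entry_matrix_mult)
qed

section \<open>Diagonalization within a connected piece of the orbit\<close>

text \<open>
  The weights are distinct, so only diagonal matrices commute with the diagonal matrix that they
  form; their order is the one in which the spectrum \<open>a, - a, b, - b\<close> with
  \<open>a > b > 0\<close> is listed: the places 1, 3, 4, 2 carry decreasing entries.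
\<close>

definition trace_weight :: "4 \<Rightarrow> real" where
  "trace_weight i = vector [4, 1, 3, 2] $ i"

lemma trace_weight_simps [simp]: "trace_weight 1 = 4" "trace_weight 2 = 1" "trace_weight 3 = 3" "trace_weight 4 = 2"
  by (simp_all add: trace_weight_def vector_def)

lemma inj_trace_weight: "inj trace_weight"
proof (rule injI)
  fix i j :: 4 assume "trace_weight i = trace_weight j"
  then show "i = j" using exhaust_4[of i] exhaust_4[of j] by auto
qed

text \<open>
  A point \<open>X\<close> where the inner product with \<open>N\<close> is maximal on the
  component is critical for every rotation; for the generator \<open>Z\<close> the derivative is
  the inner product of \<open>X N - N X\<close> with \<open>Z\<close>. With generators twisted
  along the entries of \<open>X\<close> this forces the off-diagonal entries to vanish. A quarter
  turn exchanges two diagonal entries without leaving the component, so maximality also sorts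
  them.
\<close>

theorem connected_orbit_diagonal:
  fixes A :: "'f::conjugation_algebra^4^4"
  assumes A: "adjoint_matrix A = A"
  obtains C x where "connected C" "A \<in> C" "C \<subseteq> (\<lambda>P. unitary_conj P A) ` unitary_group"
    "real_diag x \<in> C" "x 1 \<ge> x 3" "x 3 \<ge> x 4" "x 4 \<ge> x 2"
proof -
  define Orb where "Orb = (\<lambda>P. unitary_conj P A) ` unitary_group"
  have cont: "continuous_on S (\<lambda>P. unitary_conj P B)" for B :: "'f^4^4" and S
  proof -
    have "continuous_on S (adjoint_matrix :: 'f^4^4 \<Rightarrow> _)"
      by (rule linear_continuous_on) (simp add: linear_conv_bounded_linear[symmetric] linear_adjoint_matrix)
    then show ?thesis unfolding unitary_conj_def
      by (intro bounded_bilinear.continuous_on[OF bounded_bilinear_matrix_mult] continuous_on_id continuous_on_const)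
  qed
  have AO: "A \<in> Orb" unfolding Orb_def using mat_1_unitary by (intro image_eqI[of _ _ "mat 1"]) auto
  have cO: "compact Orb" unfolding Orb_def
    by (intro compact_continuous_image cont compact_unitary_group)
  define C where "C = connected_component_set Orb A"
  have "C \<in> components Orb" using AO by (simp add: C_def componentsI)
  then have cC: "compact C" using compact_components cO by blast
  have AC: "A \<in> C" using AO by (simp add: C_def)
  let ?N = "real_diag trace_weight :: 'f^4^4"
  have "continuous_on C (\<lambda>X. inner ?N X)" by (intro continuous_intros)
  then obtain X where X: "X \<in> C" "\<And>Y. Y \<in> C \<Longrightarrow> inner ?N Y \<le> inner ?N X"
    using continuous_attains_sup[OF cC, of "\<lambda>X. inner ?N X"] AC by blast
  have XO: "X \<in> Orb" using X(1) connected_component_subset by (auto simp: C_def)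
  then obtain P where P: "P \<in> unitary_group" "X = unitary_conj P A" by (auto simp: Orb_def)
  have aX: "adjoint_matrix X = X" by (simp add: P adjoint_unitary_conj A)
  have rotC: "unitary_conj (rotation Z t) X \<in> C"
    if Z: "adjoint_matrix Z = - Z" "Z ** Z ** Z = - Z" for Z t
  proof -
    have cR: "continuous_on UNIV (rotation Z)" unfolding rotation_def by (intro continuous_intros)
    have "connected (range (\<lambda>t. unitary_conj (rotation Z t) X))"
      by (intro connected_continuous_image continuous_on_compose2[OF cont[of UNIV] cR]) auto
    moreover have "range (\<lambda>t. unitary_conj (rotation Z t) X) \<subseteq> Orb"
      unfolding P(2) unitary_conj_conj Orb_def using rotation_unitary[OF Z] unitary_mult P(1) by blast
    moreover have "X \<in> range (\<lambda>t. unitary_conj (rotation Z t) X)"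
      by (rule image_eqI[of _ _ 0]) auto
    ultimately have "range (\<lambda>t. unitary_conj (rotation Z t) X) \<subseteq> connected_component_set Orb X"
      by (intro connected_component_maximal) auto
    also have "\<dots> = C" using X(1) unfolding C_def by (metis connected_component_eq)
    finally show ?thesis by blast
  qed
  have crit: "inner (X ** ?N - ?N ** X) Z = 0"
    if Z: "adjoint_matrix Z = - Z" "Z ** Z ** Z = - Z" for Z
  proof -
    have dR: "((rotation Z) has_derivative (\<lambda>s. s *\<^sub>R Z)) (at 0)"
      using rotation_has_derivative[of Z] by (simp add: has_vector_derivative_def)
    have "bounded_linear (adjoint_matrix :: 'f^4^4 \<Rightarrow> _)"
      by (simp add: linear_conv_bounded_linear[symmetric] linear_adjoint_matrix)
    from bounded_linear.has_derivative[OF this dR]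
    have daR: "((\<lambda>t. adjoint_matrix (rotation Z t)) has_derivative (\<lambda>s. s *\<^sub>R (- Z))) (at 0)"
      by (simp add: adjoint_scaleR Z(1))
    have "((\<lambda>t. unitary_conj (rotation Z t) X) has_derivative (\<lambda>s. s *\<^sub>R (X ** Z - Z ** X))) (at 0)"
      unfolding unitary_conj_def
      by (rule has_derivative_eq_rhs[OF bounded_bilinear.FDERIV[OF bounded_bilinear_matrix_mult
              bounded_bilinear.FDERIV[OF bounded_bilinear_matrix_mult daR has_derivative_const] dR]])
        (auto simp: fun_eq_iff matrix_mult_linear algebra_simps)
    from has_derivative_inner_right[OF this, of ?N]
    have "((\<lambda>t. inner ?N (unitary_conj (rotation Z t) X)) has_derivative
        (\<lambda>s. inner ?N (s *\<^sub>R (X ** Z - Z ** X)))) (at 0)" .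
    then have "((\<lambda>t. inner ?N (unitary_conj (rotation Z t) X)) has_real_derivative
        inner ?N (X ** Z - Z ** X)) (at 0)"
      by (auto simp: has_field_derivative_def elim!: has_derivative_eq_rhs)
    then have "inner ?N (X ** Z - Z ** X) = 0"
      by (rule DERIV_local_max[where d = 1]) (use X(2)[OF rotC[OF Z]] in auto)
    moreover have "inner ?N (X ** Z) = inner (X ** ?N) Z"
      by (metis inner_matrix_mult_left aX inner_commute)
    moreover have "inner ?N (Z ** X) = inner (?N ** X) Z"
      by (metis inner_matrix_mult_right aX inner_commute)
    ultimately show ?thesis by (simp add: inner_diff_right inner_diff_left)
  qed
  have off: "X $ i $ j = 0" if ij: "i \<noteq> j" for i j
  proof (rule ccontr)
    assume nz: "X $ i $ j \<noteq> 0"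
    (* Twisting by the direction of the entry turns the derivative into a multiple of its norm. *)
    define u where "u = sgn (X $ i $ j)"
    have u: "norm u = 1" using nz by (simp add: u_def norm_sgn)
    have Xji: "X $ j $ i = conjugate (X $ i $ j)" using aX adjoint_matrix_nth by metis
    have "inner (X ** ?N - ?N ** X) (plane_generator i j u) = 0"
      using plane_generator_skew[OF ij u] by (intro crit)
    then have "(trace_weight j - trace_weight i) * inner (X $ i $ j) u = 0"
      by (simp add: plane_generator_def inner_diff_right inner_entry_matrix Xji inner_diff_left algebra_simps)
    moreover have "trace_weight j \<noteq> trace_weight i" using inj_trace_weight ij by (auto simp: inj_def)
    moreover have "inner (X $ i $ j) u = norm (X $ i $ j)"
      using nz by (simp add: u_def sgn_div_norm power2_norm_eq_inner[symmetric] power2_eq_square)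
    ultimately show False using nz by simp
  qed
  define x where "x = (\<lambda>i. inner (X $ i $ i) 1)"
  have Xd: "X = real_diag x"
  proof -
    have "X $ i $ i = of_real (x i)" for i
      unfolding x_def by (rule self_conjugate_real) (metis aX adjoint_matrix_nth)
    then show ?thesis using off by (simp add: vec_eq_iff)
  qed
  have ord: "x j \<le> x i" if ij: "trace_weight j < trace_weight i" for i j
  proof -
    have "i \<noteq> j" using ij by auto
    have "inner ?N (unitary_conj (rotation (plane_generator i j 1) (pi / 2)) X) \<le> inner ?N X"
      using plane_generator_skew[OF \<open>i \<noteq> j\<close>, of 1] by (intro X(2) rotC) auto
    then have "trace_weight i * (x j - x i) + trace_weight j * (x i - x j) \<le> 0"
      unfolding Xd quarter_turn_swaps[OF \<open>i \<noteq> j\<close>]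
      by (simp add: inner_add_right inner_entry_matrix of_real_def mult.commute)
    then have "(trace_weight i - trace_weight j) * (x j - x i) \<le> 0" by (simp add: algebra_simps)
    with ij show ?thesis by (simp add: mult_le_0_iff)
  qed
  show thesis
    by (rule that[of C x])
      (use X(1) Xd AC ord[of 3 1] ord[of 4 3] ord[of 2 4] connected_component_subset[of Orb A]
       in \<open>auto simp: C_def Orb_def\<close>)
qed

section \<open>The orbit as a level set\<close>

text \<open>
  The diagonal of a Hermitian matrix is real, so its trace is given by the inner product with the
  identity.
\<close>

lemma E4_altdef: "E4 = {A :: 'f::conjugation_algebra^4^4. adjoint_matrix A = A \<and> inner A (mat 1) = 0}"
proof -
  have "trace A = of_real (inner A (mat 1))" if A: "adjoint_matrix A = A" for A :: "'f^4^4"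
  proof -
    have d: "A $ i $ i = of_real (inner (A $ i $ i) 1)" for i
      by (rule self_conjugate_real) (metis A adjoint_matrix_nth)
    have "trace A = (\<Sum>i\<in>UNIV. of_real (inner (A $ i $ i) 1))"
      unfolding trace_def by (intro sum.cong refl d)
    also have "\<dots> = of_real (inner A (mat 1))"
      by (subst inner_commute) (simp add: mat_1_real_diag inner_real_diag)
    finally show ?thesis .
  qed
  then show ?thesis unfolding E4_def by auto
qed

lemma subspace_E4: "subspace (E4 :: ('f::conjugation_algebra^4^4) set)"
  unfolding E4_altdef by (auto simp: subspace_def adjoint_add adjoint_scaleR inner_add_left)

lemma unitary_conj_E4: "P \<in> unitary_group \<Longrightarrow> unitary_conj P A \<in> E4 \<longleftrightarrow> A \<in> E4"
proof -
  assume P: "P \<in> unitary_group"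
  have "inner (unitary_conj P A) (mat 1) = inner A (mat 1)"
    by (metis P inner_unitary_conj unitary_conj_one)
  moreover have "unitary_conj P (adjoint_matrix A) = unitary_conj P A \<longleftrightarrow> adjoint_matrix A = A"
    using inj_unitary_conj[OF P] by (auto simp: inj_def)
  ultimately show ?thesis by (simp add: E4_altdef adjoint_unitary_conj)
qed

text \<open>
  For Hermitian \<open>A\<close> this is the trace of the third power of \<open>A\<close>, and
  \<open>quartic A\<close> is that of the fourth power.
\<close>

definition cubic :: "'f::conjugation_algebra^4^4 \<Rightarrow> real" where
  "cubic A = inner (A ** A) A"

definition quartic :: "'f::conjugation_algebra^4^4 \<Rightarrow> real" where
  "quartic A = inner (A ** A) (A ** A)"

definition cubic_zeros :: "('f::conjugation_algebra^4^4) set" where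
  "cubic_zeros = {A \<in> S4. cubic A = 0 \<and> 1 / 4 < quartic A \<and> quartic A < 1 / 2}"

lemma S4_altdef: "S4 = {A \<in> E4. inner A A = 1}"
  by (simp add: S4_def norm_eq_1)

lemma unitary_conj_invariants:
  assumes "P \<in> unitary_group"
  shows "unitary_conj P A \<in> S4 \<longleftrightarrow> A \<in> S4" "cubic (unitary_conj P A) = cubic A"
    "quartic (unitary_conj P A) = quartic A"
  using assms
  by (simp_all add: S4_altdef unitary_conj_E4 inner_unitary_conj cubic_def quartic_def unitary_conj_mult)

lemma unitary_conj_cubic_zeros:
  "P \<in> unitary_group \<Longrightarrow> unitary_conj P A \<in> cubic_zeros \<longleftrightarrow> A \<in> cubic_zeros"
  by (simp add: cubic_zeros_def unitary_conj_invariants)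

text \<open>
  The diagonal of the matrices in \<open>D4_tilde\<close>, as a function on the index type.
\<close>

definition spectrum4 :: "real \<Rightarrow> real \<Rightarrow> 4 \<Rightarrow> real" where
  "spectrum4 a b i = (if i = 1 then a else if i = 2 then - a else if i = 3 then b else - b)"

lemma spectrum4_simps [simp]: "spectrum4 a b 1 = a" "spectrum4 a b 2 = - a" "spectrum4 a b 3 = b"
  "spectrum4 a b 4 = - b"
  by (simp_all add: spectrum4_def)

lemma diag_matrix_spectrum4:
  "map_matrix of_real (diag_matrix [a, - a, b, - b]) = (real_diag (spectrum4 a b) :: 'f::conjugation_algebra^4^4)"
proof -
  have "vector [a, - a, b, - b] $ i = spectrum4 a b i" for i :: 4
    using exhaust_4[of i] by (auto simp: vector_def)
  then show ?thesis by (simp add: vec_eq_iff diag_matrix_def)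
qed

lemma real_diag_E4: "(real_diag x :: 'f::conjugation_algebra^4^4) \<in> E4 \<longleftrightarrow> x 1 + x 2 + x 3 + x 4 = 0"
  by (simp add: E4_altdef mat_1_real_diag sum_4)

lemma real_diag_invariants:
  fixes x :: "4 \<Rightarrow> real"
  shows "(real_diag x :: 'f::conjugation_algebra^4^4) \<in> S4 \<longleftrightarrow>
      x 1 + x 2 + x 3 + x 4 = 0 \<and> (x 1)\<^sup>2 + (x 2)\<^sup>2 + (x 3)\<^sup>2 + (x 4)\<^sup>2 = 1"
    "cubic (real_diag x :: 'f^4^4) = x 1 ^ 3 + x 2 ^ 3 + x 3 ^ 3 + x 4 ^ 3"
    "quartic (real_diag x :: 'f^4^4) = x 1 ^ 4 + x 2 ^ 4 + x 3 ^ 4 + x 4 ^ 4"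
  by (simp_all add: S4_altdef real_diag_E4 cubic_def quartic_def sum_4 power2_eq_square
      power3_eq_cube power4_eq_xxxx mult.assoc)

lemma spectrum4_S4:
  "(real_diag (spectrum4 a b) :: 'f::conjugation_algebra^4^4) \<in> S4 \<longleftrightarrow> 2 * a\<^sup>2 + 2 * b\<^sup>2 = 1"
  by (auto simp: real_diag_invariants)

lemma D4_tilde_altdef:
  "D4_tilde = {diag_matrix [a, - a, b, - b] | a b. b < a \<and> 0 < b \<and> 2 * a\<^sup>2 + 2 * b\<^sup>2 = 1}"
proof -
  have "diag_matrix [a, - a, b, - b] = (real_diag (spectrum4 a b) :: real^4^4)" for a b
    using diag_matrix_spectrum4[of a b, where 'f = real] by (simp add: vec_eq_iff)
  then show ?thesis unfolding D4_tilde_def using spectrum4_S4[where 'f = real] by fastforce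
qed

lemma B4_tilde_altdef:
  "B4_tilde G = {unitary_conj P (real_diag (spectrum4 a b)) | P a b.
     P \<in> G \<and> b < a \<and> 0 < b \<and> 2 * a\<^sup>2 + 2 * b\<^sup>2 = 1}"
  unfolding B4_tilde_def D4_tilde_altdef unitary_conj_def diag_matrix_spectrum4[symmetric] by blast

lemma spectrum4_cubic_zeros:
  assumes "b < a" "0 < b" "2 * a\<^sup>2 + 2 * b\<^sup>2 = 1"
  shows "real_diag (spectrum4 a b) \<in> (cubic_zeros :: ('f::conjugation_algebra^4^4) set)"
proof -
  have a2: "a\<^sup>2 = 1 / 2 - b\<^sup>2" using assms(3) by simp
  have q: "quartic (real_diag (spectrum4 a b) :: 'f^4^4) = 2 * (a\<^sup>2)\<^sup>2 + 2 * (b\<^sup>2)\<^sup>2"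
    by (simp add: real_diag_invariants)
  have "b\<^sup>2 < a\<^sup>2" using assms by (intro power_strict_mono) auto
  then have b2: "0 < b\<^sup>2" "b\<^sup>2 < 1 / 4" using assms a2 by auto
  have q2: "quartic (real_diag (spectrum4 a b) :: 'f^4^4) = 1 / 2 - 2 * (b\<^sup>2 * (1 - 2 * b\<^sup>2))"
    unfolding q a2 by (simp add: power2_eq_square algebra_simps)
  have q3: "quartic (real_diag (spectrum4 a b) :: 'f^4^4) = 1 / 4 + (1 / 2 - 2 * b\<^sup>2)\<^sup>2"
    unfolding q a2 by (simp add: power2_eq_square algebra_simps)
  have "0 < b\<^sup>2 * (1 - 2 * b\<^sup>2)" using b2 by simp
  then have "quartic (real_diag (spectrum4 a b) :: 'f^4^4) < 1 / 2" using q2 by linarith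
  moreover have "1 / 4 < quartic (real_diag (spectrum4 a b) :: 'f^4^4)" unfolding q3 using b2 by simp
  ultimately show ?thesis
    using assms(3) by (simp add: cubic_zeros_def spectrum4_S4 real_diag_invariants(2))
qed

text \<open>
  If \<open>x 1, ..., x 4\<close> have sum 0, the sum of their cubes is
  \<open>-3 (x 1 + x 2) (x 2 + x 3) (x 1 + x 3)\<close>. So the entries cancel in
  pairs, and by the ordering the first and the second place cancel in any case. The bounds on the
  fourth powers exclude a vanishing or a double eigenvalue.
\<close>

lemma real_diag_cubic_zeros_spectrum4:
  fixes x :: "4 \<Rightarrow> real"
  assumes x: "real_diag x \<in> (cubic_zeros :: ('f::conjugation_algebra^4^4) set)"
    and ord: "x 1 \<ge> x 3" "x 3 \<ge> x 4" "x 4 \<ge> x 2"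
  obtains a b where "x = spectrum4 a b" "b < a" "0 < b" "2 * a\<^sup>2 + 2 * b\<^sup>2 = 1"
proof -
  have s: "x 1 + x 2 + x 3 + x 4 = 0" "(x 1)\<^sup>2 + (x 2)\<^sup>2 + (x 3)\<^sup>2 + (x 4)\<^sup>2 = 1"
    "x 1 ^ 3 + x 2 ^ 3 + x 3 ^ 3 + x 4 ^ 3 = 0"
    "1 / 4 < x 1 ^ 4 + x 2 ^ 4 + x 3 ^ 4 + x 4 ^ 4" "x 1 ^ 4 + x 2 ^ 4 + x 3 ^ 4 + x 4 ^ 4 < 1 / 2"
    using x by (auto simp: cubic_zeros_def real_diag_invariants)
  have x4: "x 4 = - x 1 - x 2 - x 3" using s(1) by simp
  have "(x 1 + x 2) * ((x 2 + x 3) * (x 1 + x 3)) = 0"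
    using s(3) unfolding x4 by (simp add: power3_eq_cube algebra_simps)
  then consider "x 1 + x 2 = 0" | "x 2 + x 3 = 0" | "x 1 + x 3 = 0" by auto
  then have x2: "x 2 = - x 1"
  proof cases
    case 2
    then show ?thesis using s(1) ord by linarith
  next
    case 3
    then show ?thesis using s(1) ord by linarith
  qed simp
  then have x4': "x 4 = - x 3" using s(1) by simp
  have sq: "2 * (x 1)\<^sup>2 + 2 * (x 3)\<^sup>2 = 1" using s(2) by (simp add: x2 x4')
  have x3: "0 \<le> x 3" using ord x4' by simp
  have "x 3 \<noteq> 0"
  proof
    assume "x 3 = 0"
    then have "(x 1)\<^sup>2 = 1 / 2" using sq by simp
    moreover have "x 1 ^ 4 = (x 1)\<^sup>2 * (x 1)\<^sup>2" by (simp add: power4_eq_xxxx power2_eq_square)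
    ultimately have "x 1 ^ 4 = (1 / 2) * (1 / 2)" by (simp only:)
    then show False using s(5) \<open>x 3 = 0\<close> by (simp add: x2 x4')
  qed
  moreover have "x 3 \<noteq> x 1"
  proof
    assume eq: "x 3 = x 1"
    then have "(x 1)\<^sup>2 = 1 / 4" using sq by simp
    moreover have "x 1 ^ 4 = (x 1)\<^sup>2 * (x 1)\<^sup>2" by (simp add: power4_eq_xxxx power2_eq_square)
    ultimately have "x 1 ^ 4 = (1 / 4) * (1 / 4)" by (simp only:)
    then show False using s(4) eq by (simp add: x2 x4')
  qed
  moreover have "x = spectrum4 (x 1) (x 3)"
  proof
    fix i show "x i = spectrum4 (x 1) (x 3) i" using exhaust_4[of i] by (auto simp: x2 x4')
  qed
  ultimately show thesis using that[of "x 1" "x 3"] sq x3 ord by simp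
qed

theorem cubic_zeros_connected_to_diagonal:
  fixes A :: "'f::conjugation_algebra^4^4"
  assumes A: "A \<in> cubic_zeros"
  obtains C P a b where "connected C" "A \<in> C" "C \<subseteq> cubic_zeros" "real_diag (spectrum4 a b) \<in> C"
    "b < a" "0 < b" "2 * a\<^sup>2 + 2 * b\<^sup>2 = 1" "P \<in> unitary_group"
    "A = unitary_conj P (real_diag (spectrum4 a b))"
proof -
  have "adjoint_matrix A = A" using A by (simp add: cubic_zeros_def S4_def E4_def)
  then obtain C x where C: "connected C" "A \<in> C" "C \<subseteq> (\<lambda>P. unitary_conj P A) ` unitary_group"
    "real_diag x \<in> C" and ord: "x 1 \<ge> x 3" "x 3 \<ge> x 4" "x 4 \<ge> x 2"
    by (rule connected_orbit_diagonal)
  have CB: "C \<subseteq> cubic_zeros" using C(3) A unitary_conj_cubic_zeros by blast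
  then obtain a b where ab: "x = spectrum4 a b" "b < a" "0 < b" "2 * a\<^sup>2 + 2 * b\<^sup>2 = 1"
    using real_diag_cubic_zeros_spectrum4[OF _ ord] C(4) by blast
  obtain Q where Q: "Q \<in> unitary_group" "real_diag x = unitary_conj Q A" using C(3,4) by blast
  then have "A = unitary_conj (adjoint_matrix Q) (real_diag x)" by (simp add: unitary_conj_inverse)
  then show thesis
    using that[of C a b "adjoint_matrix Q"] C CB ab unitary_adjoint[OF Q(1)] by simp
qed

lemma B4_tilde_unitary: "B4_tilde unitary_group = (cubic_zeros :: ('f::conjugation_algebra^4^4) set)"
proof
  show "B4_tilde unitary_group \<subseteq> (cubic_zeros :: ('f^4^4) set)"
    unfolding B4_tilde_altdef using unitary_conj_cubic_zeros spectrum4_cubic_zeros by blast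
  show "(cubic_zeros :: ('f^4^4) set) \<subseteq> B4_tilde unitary_group"
    unfolding B4_tilde_altdef by (auto elim!: cubic_zeros_connected_to_diagonal)
qed

text \<open>
  If the determinant is negative, a reflection in the first coordinate corrects it; being
  diagonal, it does not change the conjugated matrix.
\<close>

lemma B4_tilde_SO4: "B4_tilde SO4 = B4_tilde unitary_group"
proof
  show "B4_tilde SO4 \<subseteq> B4_tilde unitary_group" unfolding B4_tilde_altdef SO4_def by blast
  show "B4_tilde unitary_group \<subseteq> B4_tilde SO4"
  proof
    fix A :: "real^4^4" assume "A \<in> B4_tilde unitary_group"
    then obtain P a b where P: "P \<in> unitary_group" and A: "A = unitary_conj P (real_diag (spectrum4 a b))"
      and ab: "b < a" "0 < b" "2 * a\<^sup>2 + 2 * b\<^sup>2 = 1"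
      unfolding B4_tilde_altdef by blast
    define J :: "real^4^4" where "J = real_diag (\<lambda>i. if i = 1 then - 1 else 1)"
    have J: "J \<in> unitary_group"
      by (auto simp: unitary_group_def J_def vec_eq_iff mat_def)
    have "det J = (\<Prod>i\<in>UNIV. J $ i $ i)" by (rule det_diagonal) (simp add: J_def)
    also have "\<dots> = (\<Prod>i\<in>(UNIV :: 4 set). if i = 1 then - 1 else 1)" by (intro prod.cong) (auto simp: J_def)
    finally have dJ: "det J = - 1" by simp
    have "adjoint_matrix P = transpose P" by (simp add: vec_eq_iff conjugate_real_def transpose_def)
    then have "transpose P ** P = mat 1" using unitary_groupD(1)[OF P] by simp
    then have "det (transpose P) * det P = 1" by (metis det_mul det_I)
    then have "det P = 1 \<or> det P = - 1"
      by (metis det_transpose square_eq_1_iff)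
    then show "A \<in> B4_tilde SO4"
    proof
      assume "det P = 1"
      then show ?thesis using P A ab unfolding B4_tilde_altdef SO4_def by blast
    next
      assume "det P = - 1"
      then have "J ** P \<in> SO4" using unitary_mult[OF J P] dJ by (simp add: SO4_def det_mul)
      moreover have "A = unitary_conj (J ** P) (real_diag (spectrum4 a b))"
        unfolding A unitary_conj_conj[symmetric]
        by (rule arg_cong[where f = "unitary_conj P"])
          (auto simp: unitary_conj_def J_def vec_eq_iff)
      ultimately show ?thesis using ab unfolding B4_tilde_altdef by blast
    qed
  qed
qed

lemma continuous_on_quartic: "continuous_on S (quartic :: 'f::conjugation_algebra^4^4 \<Rightarrow> real)"
  unfolding quartic_def
  by (intro continuous_intros bounded_bilinear.continuous_on[OF bounded_bilinear_matrix_mult] continuous_on_id)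

lemma spectrum4_sqrt_cubic_zeros:
  assumes "0 < s" "s < 1 / 4"
  shows "real_diag (spectrum4 (sqrt (1 / 2 - s)) (sqrt s)) \<in> (cubic_zeros :: ('f::conjugation_algebra^4^4) set)"
  using assms by (intro spectrum4_cubic_zeros) auto

text \<open>
  Each point is joined to a diagonal one, and the diagonal points form an arc, parametrized by
  \<open>s = b\<^sup>2\<close> in \<open>(0, 1/4)\<close>.
\<close>

lemma connected_cubic_zeros: "connected (cubic_zeros :: ('f::conjugation_algebra^4^4) set)"
proof -
  let ?m = "\<lambda>s. real_diag (spectrum4 (sqrt (1 / 2 - s)) (sqrt s)) :: 'f^4^4"
  have "continuous_on {0<..<1 / 4} (\<lambda>s. of_real (spectrum4 (sqrt (1 / 2 - s)) (sqrt s) i) :: 'f)" for i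
    unfolding spectrum4_def
    by (cases "i = 1"; cases "i = 2"; cases "i = 3") (auto intro!: continuous_intros)
  then have "continuous_on {0<..<1 / 4} ?m"
    unfolding real_diag_def
  proof (intro continuous_on_vec_lambda)
    fix i j :: 4
    show "continuous_on {0<..<1 / 4}
        (\<lambda>s. if i = j then of_real (spectrum4 (sqrt (1 / 2 - s)) (sqrt s) i) else 0 :: 'f)"
      using \<open>\<And>i. continuous_on {0<..<1 / 4} (\<lambda>s. of_real (spectrum4 (sqrt (1 / 2 - s)) (sqrt s) i) :: 'f)\<close>[of i]
      by (cases "i = j") auto
  qed
  then have m: "connected (?m ` {0<..<1 / 4})" by (intro connected_continuous_image) auto
  have msub: "?m ` {0<..<1 / 4} \<subseteq> cubic_zeros" using spectrum4_sqrt_cubic_zeros by auto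
  have to_m: "\<exists>B\<in>?m ` {0<..<1 / 4}. connected_component cubic_zeros A B" if A: "A \<in> cubic_zeros" for A
  proof -
    obtain C a b where C: "connected C" "A \<in> C" "C \<subseteq> cubic_zeros" "real_diag (spectrum4 a b) \<in> C"
      and ab: "b < a" "0 < b" "2 * a\<^sup>2 + 2 * b\<^sup>2 = 1"
      using cubic_zeros_connected_to_diagonal[OF A] by metis
    have "b\<^sup>2 < a\<^sup>2" using ab by (intro power_strict_mono) auto
    moreover have a2: "1 / 2 - b\<^sup>2 = a\<^sup>2" using ab by simp
    ultimately have s: "b\<^sup>2 \<in> {0<..<1 / 4}" using ab by auto
    have "sqrt (1 / 2 - b\<^sup>2) = a" unfolding a2 using ab by simp
    then have "?m (b\<^sup>2) \<in> C" using C(4) ab by simp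
    then have "connected_component cubic_zeros A (?m (b\<^sup>2))"
      using C unfolding connected_component_def by blast
    with s show ?thesis by blast
  qed
  show ?thesis
    unfolding connected_iff_connected_component
  proof (intro ballI)
    fix A B :: "'f^4^4" assume "A \<in> cubic_zeros" "B \<in> cubic_zeros"
    then obtain A' B' where "A' \<in> ?m ` {0<..<1 / 4}" "connected_component cubic_zeros A A'"
      "B' \<in> ?m ` {0<..<1 / 4}" "connected_component cubic_zeros B B'"
      using to_m by meson
    moreover have "connected_component cubic_zeros A' B'"
      using calculation m msub unfolding connected_component_def by blast
    ultimately show "connected_component cubic_zeros A B"
      by (meson connected_component_sym connected_component_trans)
  qed
qed

lemma spectrum4_quartic:
  "2 * a\<^sup>2 + 2 * b\<^sup>2 = 1 \<Longrightarrow>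
    quartic (real_diag (spectrum4 a b) :: 'f::conjugation_algebra^4^4) = 1 / 2 - 2 * b\<^sup>2 + 4 * (b\<^sup>2)\<^sup>2"
proof -
  assume "2 * a\<^sup>2 + 2 * b\<^sup>2 = 1"
  then have a2: "a\<^sup>2 = 1 / 2 - b\<^sup>2" by simp
  have "quartic (real_diag (spectrum4 a b) :: 'f^4^4) = 2 * (a\<^sup>2)\<^sup>2 + 2 * (b\<^sup>2)\<^sup>2"
    by (simp add: real_diag_invariants)
  then show ?thesis unfolding a2 by (simp add: power2_eq_square algebra_simps)
qed

text \<open>
  On the arc of diagonal points \<open>quartic\<close> decreases in \<open>b\<^sup>2\<close>, so
  it has no maximum: halving \<open>b\<^sup>2\<close> increases it.
\<close>

lemma not_compact_cubic_zeros: "\<not> compact (cubic_zeros :: ('f::conjugation_algebra^4^4) set)"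
proof
  assume c: "compact (cubic_zeros :: ('f^4^4) set)"
  have "(cubic_zeros :: ('f^4^4) set) \<noteq> {}" using spectrum4_sqrt_cubic_zeros[of "1 / 8"] by auto
  then obtain A :: "'f^4^4" where A: "A \<in> cubic_zeros" "\<And>B :: 'f^4^4. B \<in> cubic_zeros \<Longrightarrow> quartic B \<le> quartic A"
    using continuous_attains_sup[OF c _ continuous_on_quartic] by blast
  obtain P a b where ab: "b < a" "0 < b" "2 * a\<^sup>2 + 2 * b\<^sup>2 = 1" and P: "P \<in> unitary_group"
    "A = unitary_conj P (real_diag (spectrum4 a b))"
    using cubic_zeros_connected_to_diagonal[OF A(1)] by metis
  have "b\<^sup>2 < a\<^sup>2" using ab by (intro power_strict_mono) auto
  then have b2: "0 < b\<^sup>2" "b\<^sup>2 < 1 / 4" using ab by auto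
  let ?s = "b\<^sup>2 / 2"
  have "quartic (real_diag (spectrum4 (sqrt (1 / 2 - ?s)) (sqrt ?s)) :: 'f^4^4) \<le> quartic A"
    using b2 by (intro A(2) spectrum4_sqrt_cubic_zeros) auto
  moreover have "quartic A = 1 / 2 - 2 * b\<^sup>2 + 4 * (b\<^sup>2)\<^sup>2"
    using P ab by (simp add: unitary_conj_invariants spectrum4_quartic)
  moreover have "quartic (real_diag (spectrum4 (sqrt (1 / 2 - ?s)) (sqrt ?s)) :: 'f^4^4)
      = 1 / 2 - 2 * ?s + 4 * ?s\<^sup>2"
    using b2 by (subst spectrum4_quartic) auto
  ultimately have "b\<^sup>2 * (1 - 3 * b\<^sup>2) \<le> 0" by (simp add: power2_eq_square algebra_simps)
  then show False using b2 by (simp add: mult_le_0_iff)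
qed

section \<open>Dimension of the space of traceless Hermitian matrices\<close>

text \<open>
  These matrices span the off-diagonal Hermitian matrices and serve as test vectors in the weak
  eigenvalue equation.
\<close>

definition herm_entry :: "4 \<Rightarrow> 4 \<Rightarrow> 'f \<Rightarrow> 'f::conjugation_algebra^4^4" where
  "herm_entry i j u = entry_matrix i j u + entry_matrix j i (conjugate u)"

lemma adjoint_herm_entry [simp]: "adjoint_matrix (herm_entry i j u) = herm_entry i j u"
  by (simp add: herm_entry_def adjoint_add adjoint_entry_matrix)

lemma linear_herm_entry: "linear (herm_entry i j :: 'f::conjugation_algebra \<Rightarrow> _)"
proof -
  have "entry_matrix k l (u + v :: 'f) = entry_matrix k l u + entry_matrix k l v"
    "entry_matrix k l (r *\<^sub>R u) = r *\<^sub>R entry_matrix k l u" for k l :: 4 and u v :: 'f and r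
    by (simp_all add: vec_eq_iff)
  then show ?thesis
    by (intro linearI) (simp_all add: herm_entry_def conjugate_add conjugate_scaleR scaleR_right_distrib)
qed

lemma hermitian_entries:
  assumes "adjoint_matrix A = (A :: 'f::conjugation_algebra^4^4)"
  shows "A $ j $ i = conjugate (A $ i $ j)" "A $ i $ i = of_real (inner (A $ i $ i) 1)"
  by (metis assms adjoint_matrix_nth, rule self_conjugate_real, metis assms adjoint_matrix_nth)

lemma herm_entry_E4: "i \<noteq> j \<Longrightarrow> herm_entry i j u \<in> E4"
proof -
  assume "i \<noteq> j"
  then have "inner (mat 1) (herm_entry i j u) = 0"
    by (simp add: herm_entry_def inner_add_right inner_entry_matrix mat_def)
  then show ?thesis by (simp add: E4_altdef inner_commute)
qed

text \<open>
  Six scalars above the diagonal and three real numbers on it are free.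
\<close>

lemma dim_E4: "dim (E4 :: ('f::conjugation_algebra^4^4) set) = 6 * DIM('f) + 3"
proof -
  define D where "D = (\<lambda>(r, s, t) i :: 4. if i = 1 then r else if i = 2 then s else if i = 3 then t else - r - s - t :: real)"
  define F :: "('f \<times> 'f \<times> 'f \<times> 'f \<times> 'f \<times> 'f) \<times> (real \<times> real \<times> real) \<Rightarrow> 'f^4^4" where
    "F = (\<lambda>((a, b, c, d, e, f), z). herm_entry 1 2 a + herm_entry 1 3 b + herm_entry 1 4 c
      + herm_entry 2 3 d + herm_entry 2 4 e + herm_entry 3 4 f + real_diag (D z))"
  have entries: "F ((a, b, c, d, e, f), (r, s, t)) $ 1 $ 2 = a"
    "F ((a, b, c, d, e, f), (r, s, t)) $ 1 $ 3 = b"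
    "F ((a, b, c, d, e, f), (r, s, t)) $ 1 $ 4 = c"
    "F ((a, b, c, d, e, f), (r, s, t)) $ 2 $ 3 = d"
    "F ((a, b, c, d, e, f), (r, s, t)) $ 2 $ 4 = e"
    "F ((a, b, c, d, e, f), (r, s, t)) $ 3 $ 4 = f"
    "F ((a, b, c, d, e, f), (r, s, t)) $ 2 $ 1 = conjugate a"
    "F ((a, b, c, d, e, f), (r, s, t)) $ 3 $ 1 = conjugate b"
    "F ((a, b, c, d, e, f), (r, s, t)) $ 4 $ 1 = conjugate c"
    "F ((a, b, c, d, e, f), (r, s, t)) $ 3 $ 2 = conjugate d"
    "F ((a, b, c, d, e, f), (r, s, t)) $ 4 $ 2 = conjugate e"
    "F ((a, b, c, d, e, f), (r, s, t)) $ 4 $ 3 = conjugate f"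
    "F ((a, b, c, d, e, f), (r, s, t)) $ 1 $ 1 = of_real r"
    "F ((a, b, c, d, e, f), (r, s, t)) $ 2 $ 2 = of_real s"
    "F ((a, b, c, d, e, f), (r, s, t)) $ 3 $ 3 = of_real t"
    "F ((a, b, c, d, e, f), (r, s, t)) $ 4 $ 4 = of_real (- r - s - t)" for a b c d e f r s t
    by (simp_all add: F_def herm_entry_def D_def)
  have F_add: "F (p + q) = F p + F q" for p q
    by (cases p; cases q) (auto simp: vec_eq_iff forall_4 entries conjugate_add)
  have F_scale: "F (k *\<^sub>R p) = k *\<^sub>R F p" for k p
    by (cases p) (auto simp: vec_eq_iff forall_4 entries conjugate_scaleR of_real_def algebra_simps)
  have lin: "linear F" by (intro linearI F_add F_scale)
  have inj: "inj F"
  proof (rule injI)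
    fix p q assume eq: "F p = F q"
    obtain a b c d e f r s t where p: "p = ((a, b, c, d, e, f), (r, s, t))" by (metis prod.exhaust)
    obtain a' b' c' d' e' f' r' s' t' where q: "q = ((a', b', c', d', e', f'), (r', s', t'))" by (metis prod.exhaust)
    have "F p $ i $ j = F q $ i $ j" for i j using eq by simp
    from this[of 1 2] this[of 1 3] this[of 1 4] this[of 2 3] this[of 2 4] this[of 3 4]
      this[of 1 1] this[of 2 2] this[of 3 3]
    show "p = q" unfolding p q entries by simp
  qed
  have "range F = E4"
  proof (intro equalityI subsetI)
    fix A assume "A \<in> range F"
    moreover have "real_diag (D z) \<in> E4" for z by (cases z) (simp add: real_diag_E4 D_def)
    ultimately show "A \<in> E4"
      by (auto simp: F_def intro!: subspace_add[OF subspace_E4] herm_entry_E4)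
  next
    fix A :: "'f^4^4" assume A: "A \<in> E4"
    then have h: "adjoint_matrix A = A" by (simp add: E4_def)
    define x where "x = (\<lambda>i. inner (A $ i $ i) 1)"
    have d: "A $ i $ i = of_real (x i)" for i unfolding x_def by (rule hermitian_entries[OF h])
    have "inner (real_diag (\<lambda>_. 1)) A = 0"
      using A by (simp add: E4_altdef mat_1_real_diag inner_commute)
    then have "x 1 + x 2 + x 3 + x 4 = 0" by (simp add: inner_real_diag sum_4 x_def)
    then have x4: "x 4 = - x 1 - x 2 - x 3" by simp
    have "A = F ((A $ 1 $ 2, A $ 1 $ 3, A $ 1 $ 4, A $ 2 $ 3, A $ 2 $ 4, A $ 3 $ 4), (x 1, x 2, x 3))"
      unfolding vec_eq_iff forall_4 entries d x4 using hermitian_entries(1)[OF h] by blast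
    then show "A \<in> range F" by blast
  qed
  then have "dim (E4 :: ('f^4^4) set)
      = dim (UNIV :: (('f \<times> 'f \<times> 'f \<times> 'f \<times> 'f \<times> 'f) \<times> (real \<times> real \<times> real)) set)"
    using dim_image_eq[OF lin, of UNIV] inj by simp
  then show ?thesis by simp
qed

section \<open>Curvature spaces\<close>

text \<open>
  The orthogonal complement in \<open>E4\<close> of the position vector and of the gradient of
  \<open>cubic\<close>.
\<close>

definition regular_tangent :: "'f::conjugation_algebra^4^4 \<Rightarrow> ('f^4^4) set" where
  "regular_tangent A = {v \<in> E4. inner A v = 0 \<and> inner (A ** A) v = 0}"

text \<open>
  For a matrix with spectrum \<open>a, -a, b, -b\<close> and unit norm this is
  \<open>a\<^sup>2 - b\<^sup>2\<close>.
\<close>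

definition gap :: "'f::conjugation_algebra^4^4 \<Rightarrow> real" where
  "gap A = sqrt (quartic A - 1 / 4)"

text \<open>
  The eigenspace of the shape operator, in weak form: the derivative of the unit normal in the
  direction \<open>v\<close> is, up to multiples of the normal, \<open>(A v + v A)\<close>
  divided by \<open>gap A\<close>.
\<close>

definition curvature_space :: "'f::conjugation_algebra^4^4 \<Rightarrow> real \<Rightarrow> ('f^4^4) set" where
  "curvature_space A \<kappa> = {v \<in> regular_tangent A.
     \<forall>w\<in>regular_tangent A. inner (A ** v + v ** A) w = - \<kappa> * gap A * inner v w}"

lemma subspace_regular_tangent: "subspace (regular_tangent A)"
  using subspace_E4 unfolding regular_tangent_def
  by (auto simp: subspace_def inner_add_right)

lemma subspace_curvature_space: "subspace (curvature_space A \<kappa>)"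
proof -
  have "inner (A ** (c *\<^sub>R v) + (c *\<^sub>R v) ** A) w = c * inner (A ** v + v ** A) w" for c v w
    by (simp add: matrix_mult_linear inner_add_left distrib_left)
  then have "c *\<^sub>R v \<in> curvature_space A \<kappa>" if "v \<in> curvature_space A \<kappa>" for c v
    using subspace_scale[OF subspace_regular_tangent] that unfolding curvature_space_def by auto
  moreover have "u + v \<in> curvature_space A \<kappa>"
    if "u \<in> curvature_space A \<kappa>" "v \<in> curvature_space A \<kappa>" for u v
    using subspace_add[OF subspace_regular_tangent] that
    by (auto simp: curvature_space_def matrix_mult_linear inner_add_left algebra_simps)
  moreover have "0 \<in> curvature_space A \<kappa>"
    using subspace_0[OF subspace_regular_tangent] by (simp add: curvature_space_def matrix_mult_linear)
  ultimately show ?thesis by (simp add: subspace_def)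
qed

lemma regular_tangent_unitary_conj:
  "P \<in> unitary_group \<Longrightarrow> unitary_conj P v \<in> regular_tangent (unitary_conj P A) \<longleftrightarrow> v \<in> regular_tangent A"
  by (simp add: regular_tangent_def unitary_conj_E4 inner_unitary_conj unitary_conj_mult)

lemma curvature_space_unitary_conj:
  assumes P: "P \<in> unitary_group"
  shows "curvature_space (unitary_conj P A) \<kappa> = unitary_conj P ` curvature_space A \<kappa>"
proof -
  have mem: "unitary_conj P v \<in> curvature_space (unitary_conj P A) \<kappa> \<longleftrightarrow> v \<in> curvature_space A \<kappa>" for v
  proof -
    have all: "(\<forall>w\<in>regular_tangent (unitary_conj P A). Q w) \<longleftrightarrow> (\<forall>w\<in>regular_tangent A. Q (unitary_conj P w))" for Q
      by (metis P regular_tangent_unitary_conj unitary_conj_inverse(2))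
    have "inner (unitary_conj P A ** unitary_conj P v + unitary_conj P v ** unitary_conj P A) (unitary_conj P w)
        = inner (A ** v + v ** A) w" for w
      using P by (simp add: unitary_conj_mult linear_add[OF linear_unitary_conj, symmetric] inner_unitary_conj)
    then show ?thesis
      unfolding curvature_space_def mem_Collect_eq all
      using P by (simp add: regular_tangent_unitary_conj inner_unitary_conj gap_def unitary_conj_invariants)
  qed
  show ?thesis
  proof (intro equalityI subsetI)
    fix v assume "v \<in> curvature_space (unitary_conj P A) \<kappa>"
    then have "unitary_conj (adjoint_matrix P) v \<in> curvature_space A \<kappa>"
      using mem[of "unitary_conj (adjoint_matrix P) v"] P by (simp add: unitary_conj_inverse)
    then show "v \<in> unitary_conj P ` curvature_space A \<kappa>"
      using P by (intro image_eqI[of _ _ "unitary_conj (adjoint_matrix P) v"]) (simp_all add: unitary_conj_inverse)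
  qed (use mem in auto)
qed

lemma hermitian_diagonal:
  assumes "adjoint_matrix v = (v :: 'f::conjugation_algebra^4^4)"
  obtains y where "\<And>i. v $ i $ i = of_real (y i)"
proof (rule that)
  show "v $ i $ i = of_real (inner (v $ i $ i) 1)" for i
    by (rule hermitian_entries(2)[OF assms])
qed

text \<open>
  The diagonal of a tangent vector is orthogonal to \<open>(1, 1, 1, 1)\<close>,
  \<open>(a, -a, b, -b)\<close> and
  \<open>(a\<^sup>2, a\<^sup>2, b\<^sup>2, b\<^sup>2)\<close>; since
  \<open>a \<noteq> b\<close>, one direction remains.
\<close>

lemma spectrum4_tangent_diagonal:
  fixes v :: "'f::conjugation_algebra^4^4"
  assumes ab: "b < a" "0 < b" and v: "v \<in> regular_tangent (real_diag (spectrum4 a b))"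
  obtains s where "v $ 1 $ 1 = of_real (s * b)" "v $ 2 $ 2 = of_real (- s * b)"
    "v $ 3 $ 3 = of_real (- s * a)" "v $ 4 $ 4 = of_real (s * a)"
proof -
  have vE: "v \<in> E4" and 1: "inner (real_diag (spectrum4 a b)) v = 0"
    "inner (real_diag (\<lambda>i. spectrum4 a b i * spectrum4 a b i)) v = 0"
    using v by (auto simp: regular_tangent_def)
  obtain y where y: "\<And>i. v $ i $ i = of_real (y i)"
    using vE hermitian_diagonal[of v] by (auto simp: E4_def)
  have in1: "inner (real_diag x) v = (\<Sum>i\<in>UNIV. x i * y i)" for x
    by (simp add: inner_real_diag y of_real_def)
  have "inner (real_diag (\<lambda>_. 1)) v = 0"
    using vE by (simp add: E4_altdef mat_1_real_diag inner_commute)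
  then have e: "y 1 + y 2 + y 3 + y 4 = 0" "a * y 1 - a * y 2 + b * y 3 - b * y 4 = 0"
    "a * a * y 1 + a * a * y 2 + b * b * y 3 + b * b * y 4 = 0"
    using 1 by (simp_all add: in1 sum_4)
  have y34: "y 4 = - y 1 - y 2 - y 3" using e(1) by simp
  have "(a * a - b * b) * (y 1 + y 2) = 0" using e(3) unfolding y34 by (simp add: algebra_simps)
  moreover have "0 < a * a - b * b" using ab mult_strict_mono[of b a b a] by simp
  ultimately have y2: "y 2 = - y 1" by simp
  then have y4: "y 4 = - y 3" using y34 by simp
  have y3: "y 3 = - (y 1 / b) * a" using e(2) ab unfolding y2 y4 by (simp add: field_simps)
  have "y 1 = y 1 / b * b" using ab by simp
  then show thesis using that[of "y 1 / b"] y[of 1] y[of 2] y[of 3] y[of 4] y2 y3 y4 by simp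
qed

lemma gap_spectrum4:
  assumes "b < a" "0 < b" "2 * a\<^sup>2 + 2 * b\<^sup>2 = 1"
  shows "gap (real_diag (spectrum4 a b) :: 'f::conjugation_algebra^4^4) = a\<^sup>2 - b\<^sup>2"
proof -
  have a2: "a\<^sup>2 = 1 / 2 - b\<^sup>2" using assms(3) by simp
  have "b\<^sup>2 < a\<^sup>2" using assms by (intro power_strict_mono) auto
  moreover have "quartic (real_diag (spectrum4 a b) :: 'f^4^4) - 1 / 4 = (a\<^sup>2 - b\<^sup>2)\<^sup>2"
    unfolding spectrum4_quartic[OF assms(3)] a2 by (simp add: power2_eq_square algebra_simps)
  ultimately show ?thesis by (simp add: gap_def)
qed

lemma herm_entry_regular_tangent:
  assumes "i \<noteq> j" shows "herm_entry i j u \<in> regular_tangent (real_diag x)"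
proof -
  have "inner (real_diag y) (herm_entry i j u) = 0" for y
    using assms by (simp add: herm_entry_def inner_add_right inner_entry_matrix)
  then show ?thesis using herm_entry_E4[OF assms] by (simp add: regular_tangent_def)
qed

lemma inner_herm_entry:
  "adjoint_matrix A = A \<Longrightarrow> inner A (herm_entry i j u) = 2 * inner (A $ i $ j) u"
  using hermitian_entries(1)[of A j i]
  by (simp add: herm_entry_def inner_add_right inner_entry_matrix)

text \<open>
  The map \<open>v \<mapsto> A v + v A\<close> multiplies the entry in place
  \<open>(i, j)\<close> by \<open>x\<^sub>i + x\<^sub>j\<close>. Testing with Hermitian
  matrices supported in one pair of places isolates the off-diagonal entries. On the diagonal the
  map sends the unique tangent direction to a multiple of \<open>(1, 1, -1, -1)\<close>, which
  is orthogonal to it; so this direction has curvature 0.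
\<close>

lemma curvature_space_spectrum4:
  fixes v :: "'f::conjugation_algebra^4^4"
  assumes ab: "b < a" "0 < b" "2 * a\<^sup>2 + 2 * b\<^sup>2 = 1"
  defines "x \<equiv> spectrum4 a b"
  shows "v \<in> curvature_space (real_diag x) \<kappa> \<longleftrightarrow> v \<in> regular_tangent (real_diag x) \<and>
    (\<forall>i j. i \<noteq> j \<longrightarrow> x i + x j + \<kappa> * (a\<^sup>2 - b\<^sup>2) = 0 \<or> v $ i $ j = 0) \<and> (\<kappa> = 0 \<or> (\<forall>i. v $ i $ i = 0))"
    (is "?l \<longleftrightarrow> ?t \<and> ?off \<and> ?diag")
proof -
  let ?c = "a\<^sup>2 - b\<^sup>2"
  have c: "gap (real_diag x :: 'f^4^4) = ?c" unfolding x_def by (rule gap_spectrum4[OF ab])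
  have c0: "0 < ?c" using ab by (simp add: power_strict_mono)
  define Q where "Q = (\<lambda>v :: 'f^4^4. real_diag x ** v + v ** real_diag x)"
  have Q_nth: "Q v $ i $ j = (x i + x j) *\<^sub>R v $ i $ j" for i j v
    by (simp add: Q_def scaleR_left_distrib)
  have aQ: "adjoint_matrix (Q v) = Q v" if "adjoint_matrix v = v" for v
    using that by (simp add: Q_def adjoint_add adjoint_mult add.commute)
  have l: "?l \<longleftrightarrow> ?t \<and> (\<forall>w\<in>regular_tangent (real_diag x). inner (Q v + (\<kappa> * ?c) *\<^sub>R v) w = 0)"
    by (auto simp: curvature_space_def Q_def c inner_add_left)
  have diag0: "inner (Q v $ i $ i) (w $ i $ i) = 2 * x i * inner (v $ i $ i) (w $ i $ i)" for i w
    by (simp add: Q_nth)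
  show ?thesis
  proof (cases "?t")
    case t: True
    then have h: "adjoint_matrix v = v" by (simp add: regular_tangent_def E4_def)
    obtain s where s: "v $ 1 $ 1 = of_real (s * b)" "v $ 2 $ 2 = of_real (- s * b)"
      "v $ 3 $ 3 = of_real (- s * a)" "v $ 4 $ 4 = of_real (s * a)"
      using spectrum4_tangent_diagonal[OF ab(1,2)] t unfolding x_def by blast
    have dd: "(\<Sum>i\<in>UNIV. inner (Q v $ i $ i) (w $ i $ i)) = 0"
      if w: "w \<in> regular_tangent (real_diag x)" for w
    proof -
      obtain r where r: "w $ 1 $ 1 = of_real (r * b)" "w $ 2 $ 2 = of_real (- r * b)"
        "w $ 3 $ 3 = of_real (- r * a)" "w $ 4 $ 4 = of_real (r * a)"
        using spectrum4_tangent_diagonal[OF ab(1,2)] w unfolding x_def by blast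
      show ?thesis unfolding diag0 by (simp only: sum_4 s r) (simp add: x_def of_real_def)
    qed
    show ?thesis
    proof
      assume ?l
      then have test: "inner (Q v + (\<kappa> * ?c) *\<^sub>R v) w = 0" if "w \<in> regular_tangent (real_diag x)" for w
        using l that by blast
      have "?off"
      proof (intro allI impI)
        fix i j :: 4 assume ij: "i \<noteq> j"
        let ?u = "v $ i $ j"
        have "inner (Q v) (herm_entry i j ?u) + \<kappa> * ?c * inner v (herm_entry i j ?u) = 0"
          using test[OF herm_entry_regular_tangent[OF ij]] by (simp add: inner_add_left)
        then have "(x i + x j + \<kappa> * ?c) * inner ?u ?u = 0"
          unfolding inner_herm_entry[OF aQ[OF h]] inner_herm_entry[OF h]
          by (simp add: Q_nth algebra_simps)
        then show "x i + x j + \<kappa> * ?c = 0 \<or> v $ i $ j = 0" by simp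
      qed
      moreover have "?diag"
      proof -
        let ?y = "\<lambda>i :: 4. if i = 1 then b else if i = 2 then - b else if i = 3 then - a else a"
        have "real_diag ?y \<in> regular_tangent (real_diag x :: 'f^4^4)"
          by (simp add: regular_tangent_def real_diag_E4 sum_4 x_def)
        note w = this test[OF this]
        have "inner (Q v) (real_diag ?y) = 0"
        proof -
          have "inner (Q v) (real_diag ?y) = (\<Sum>i\<in>UNIV. ?y i * inner (Q v $ i $ i) 1)"
            by (subst inner_commute) (rule inner_real_diag)
          also have "\<dots> = (\<Sum>i\<in>UNIV. inner (Q v $ i $ i) (real_diag ?y $ i $ i))"
            by (intro sum.cong) (auto simp: of_real_def)
          finally show ?thesis using dd[OF w(1)] by simp
        qed
        then have "\<kappa> * ?c * inner v (real_diag ?y) = 0" using w(2) by (simp add: inner_add_left)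
        moreover have "inner v (real_diag ?y) = s * (2 * a\<^sup>2 + 2 * b\<^sup>2)"
          by (subst inner_commute) (simp add: inner_real_diag sum_4 s of_real_def power2_eq_square algebra_simps)
        ultimately have "\<kappa> = 0 \<or> s = 0" using c0 ab(3) by simp
        then show ?thesis using s by (auto simp: forall_4)
      qed
      ultimately show "?t \<and> ?off \<and> ?diag" using t by blast
    next
      assume r: "?t \<and> ?off \<and> ?diag"
      have "inner (Q v + (\<kappa> * ?c) *\<^sub>R v) w = 0" if w: "w \<in> regular_tangent (real_diag x)" for w
      proof -
        have "inner ((Q v + (\<kappa> * ?c) *\<^sub>R v) $ i $ j) (w $ i $ j)
            = (if j = i then inner (Q v $ i $ i) (w $ i $ i) else 0)" for i j
        proof (cases "i = j")
          case True
          then show ?thesis using r by (auto simp: inner_add_left)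
        next
          case False
          then have "(x i + x j + \<kappa> * ?c) = 0 \<or> v $ i $ j = 0" using r by blast
          moreover have "(Q v + (\<kappa> * ?c) *\<^sub>R v) $ i $ j = (x i + x j + \<kappa> * ?c) *\<^sub>R v $ i $ j"
            by (simp add: Q_nth scaleR_left_distrib)
          ultimately show ?thesis using False by auto
        qed
        then have "inner (Q v + (\<kappa> * ?c) *\<^sub>R v) w
            = (\<Sum>i\<in>UNIV. \<Sum>j\<in>UNIV. if j = i then inner (Q v $ i $ i) (w $ i $ i) else 0)"
          unfolding inner_matrix_nth by (intro sum.cong) auto
        also have "\<dots> = 0" using dd[OF w] by simp
        finally show ?thesis .
      qed
      then show ?l using l t by blast
    qed
  qed (auto simp: l)
qed

text \<open>
  If the sum \<open>x\<^sub>i + x\<^sub>j\<close> determines the pair, the curvature space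
  consists of the Hermitian matrices supported in the places \<open>(i, j)\<close> and
  \<open>(j, i)\<close>, and the entry in place \<open>(i, j)\<close> is an arbitrary scalar.
\<close>

lemma curvature_space_spectrum4_simple:
  assumes ab: "b < a" "0 < b" "2 * a\<^sup>2 + 2 * b\<^sup>2 = 1"
  defines "x \<equiv> spectrum4 a b"
  assumes ij: "i \<noteq> j" "x i + x j \<noteq> 0"
    and uniq: "\<And>k l. k \<noteq> l \<Longrightarrow> x k + x l = x i + x j \<Longrightarrow> (k = i \<and> l = j) \<or> (k = j \<and> l = i)"
  shows "dim (curvature_space (real_diag x :: 'f::conjugation_algebra^4^4) (- (x i + x j) / (a\<^sup>2 - b\<^sup>2))) = DIM('f)"
proof -
  let ?\<kappa> = "- (x i + x j) / (a\<^sup>2 - b\<^sup>2)"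
  have c0: "0 < a\<^sup>2 - b\<^sup>2" using ab by (simp add: power_strict_mono)
  then have k: "?\<kappa> * (a\<^sup>2 - b\<^sup>2) = - (x i + x j)" "?\<kappa> \<noteq> 0" using ij(2) by auto
  have "curvature_space (real_diag x :: 'f^4^4) ?\<kappa> = range (herm_entry i j)"
  proof (intro equalityI subsetI)
    fix v :: "'f^4^4" assume "v \<in> curvature_space (real_diag x) ?\<kappa>"
    then have "v \<in> regular_tangent (real_diag x) \<and>
        (\<forall>k l. k \<noteq> l \<longrightarrow> x k + x l + - (x i + x j) = 0 \<or> v $ k $ l = 0) \<and> (?\<kappa> = 0 \<or> (\<forall>k. v $ k $ k = 0))"
      unfolding x_def curvature_space_spectrum4[OF ab] unfolding x_def[symmetric] k(1) .
    then have v: "v \<in> regular_tangent (real_diag x)" "k \<noteq> l \<Longrightarrow> x k + x l + - (x i + x j) = 0 \<or> v $ k $ l = 0"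
      "v $ k $ k = 0" for k l
      using k(2) by blast+
    have h: "adjoint_matrix v = v" using v(1) by (simp add: regular_tangent_def E4_def)
    have "v = herm_entry i j (v $ i $ j)"
      unfolding vec_eq_iff
    proof (intro allI)
      fix k l
      show "v $ k $ l = herm_entry i j (v $ i $ j) $ k $ l"
        using v(2)[of k l] v(3)[of k] uniq[of k l] ij(1) hermitian_entries(1)[OF h, of j i]
        by (cases "k = l") (auto simp: herm_entry_def)
    qed
    then show "v \<in> range (herm_entry i j)" by blast
  next
    fix v :: "'f^4^4" assume "v \<in> range (herm_entry i j)"
    then obtain u where u: "v = herm_entry i j u" by blast
    show "v \<in> curvature_space (real_diag x) ?\<kappa>"
      unfolding x_def curvature_space_spectrum4[OF ab] unfolding x_def[symmetric] k(1) u
      using herm_entry_regular_tangent[OF ij(1)] ij(1) by (auto simp: herm_entry_def)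
  qed
  moreover have "inj (herm_entry i j :: 'f \<Rightarrow> _)"
  proof (rule injI)
    fix u v :: 'f assume "herm_entry i j u = herm_entry i j v"
    then have "herm_entry i j u $ i $ j = herm_entry i j v $ i $ j" by simp
    then show "u = v" using ij(1) by (simp add: herm_entry_def)
  qed
  ultimately show ?thesis using dim_image_eq[OF linear_herm_entry[of i j], of UNIV] by simp
qed

text \<open>
  The norm condition recovers \<open>a\<close> and \<open>b\<close> from
  \<open>g = a\<^sup>2 - b\<^sup>2\<close>, so the principal curvatures are functions of
  \<open>g\<close> alone. In the Dupin condition this makes them constant where \<open>gap\<close>
  is.
\<close>

definition nonzero_curvatures :: "real \<Rightarrow> real set" where
  "nonzero_curvatures g = (let a = sqrt (1 / 4 + g / 2); b = sqrt (1 / 4 - g / 2) in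
     {(a + b) / g, - ((a + b) / g), (a - b) / g, - ((a - b) / g)})"

lemma nonzero_curvatures_spectrum4:
  assumes "b < a" "0 < b" "2 * a\<^sup>2 + 2 * b\<^sup>2 = 1"
  shows "nonzero_curvatures (a\<^sup>2 - b\<^sup>2)
     = {(a + b) / (a\<^sup>2 - b\<^sup>2), - ((a + b) / (a\<^sup>2 - b\<^sup>2)), (a - b) / (a\<^sup>2 - b\<^sup>2), - ((a - b) / (a\<^sup>2 - b\<^sup>2))}"
proof -
  have "1 / 4 + (a\<^sup>2 - b\<^sup>2) / 2 = a\<^sup>2" "1 / 4 - (a\<^sup>2 - b\<^sup>2) / 2 = b\<^sup>2"
    using assms(3) by (simp_all add: field_simps)
  then have "sqrt (1 / 4 + (a\<^sup>2 - b\<^sup>2) / 2) = a" "sqrt (1 / 4 - (a\<^sup>2 - b\<^sup>2) / 2) = b"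
    using assms by (simp_all only: real_sqrt_abs)
  then show ?thesis by (simp only: nonzero_curvatures_def Let_def)
qed

lemma nonzero_curvatures_uminus: "- \<kappa> \<in> nonzero_curvatures g \<longleftrightarrow> \<kappa> \<in> nonzero_curvatures g"
proof -
  have "- \<kappa> \<in> {x, - x, y, - y} \<longleftrightarrow> \<kappa> \<in> {x, - x, y, - y}" for x y :: real by auto
  then show ?thesis unfolding nonzero_curvatures_def Let_def by blast
qed

lemma finite_nonzero_curvatures: "finite (nonzero_curvatures g)"
  by (simp add: nonzero_curvatures_def Let_def)

lemma nonzero_curvatures_distinct:
  assumes "0 < g" "g < 1 / 2"
  shows "card (nonzero_curvatures g) = 4" "0 \<notin> nonzero_curvatures g"
proof -
  define a where "a = sqrt (1 / 4 + g / 2)"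
  define b where "b = sqrt (1 / 4 - g / 2)"
  have ab: "0 < b" "b < a" unfolding a_def b_def using assms by auto
  have K: "nonzero_curvatures g = {(a + b) / g, - ((a + b) / g), (a - b) / g, - ((a - b) / g)}"
    by (simp only: nonzero_curvatures_def Let_def a_def b_def)
  have "0 < (a - b) / g" "(a - b) / g < (a + b) / g" using ab assms by (auto simp: divide_strict_right_mono)
  then show "card (nonzero_curvatures g) = 4" "0 \<notin> nonzero_curvatures g"
    unfolding K by (auto simp: card_insert_if simp del: divide_eq_0_iff)
qed

lemma dim_curvature_space_spectrum4_zero:
  assumes ab: "b < a" "0 < b" "2 * a\<^sup>2 + 2 * b\<^sup>2 = 1"
  shows "dim (curvature_space (real_diag (spectrum4 a b) :: 'f::conjugation_algebra^4^4) 0) = 2 * DIM('f) + 1"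
proof -
  let ?x = "spectrum4 a b"
  let ?y = "\<lambda>i :: 4. if i = 1 then b else if i = 2 then - b else if i = 3 then - a else a"
  define F :: "('f \<times> 'f) \<times> real \<Rightarrow> 'f^4^4" where
    "F = (\<lambda>p. herm_entry 1 2 (fst (fst p)) + herm_entry 3 4 (snd (fst p)) + snd p *\<^sub>R real_diag ?y)"
  have lin: "linear F"
    unfolding F_def
    by (intro linearI)
      (simp_all add: linear_add[OF linear_herm_entry] linear_scale[OF linear_herm_entry] algebra_simps)
  have entries: "F p $ 1 $ 2 = fst (fst p)" "F p $ 3 $ 4 = snd (fst p)" "F p $ 1 $ 1 = of_real (snd p * b)" for p
    by (simp_all add: F_def herm_entry_def of_real_def)
  have inj: "inj F"
  proof (rule injI)
    fix p q assume "F p = F q"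
    then have "F p $ i $ j = F q $ i $ j" for i j by simp
    from this[of 1 2] this[of 3 4] this[of 1 1] show "p = q"
      using ab(2) by (simp add: entries prod_eq_iff)
  qed
  have C: "v \<in> curvature_space (real_diag ?x) 0 \<longleftrightarrow> v \<in> regular_tangent (real_diag ?x) \<and>
      (\<forall>i j. i \<noteq> j \<longrightarrow> ?x i + ?x j = 0 \<or> v $ i $ j = 0)" for v :: "'f^4^4"
    unfolding curvature_space_spectrum4[OF ab] by simp
  have "range F = curvature_space (real_diag ?x) 0"
  proof (intro equalityI subsetI)
    fix v assume "v \<in> range F"
    then obtain p where p: "v = F p" by blast
    have "real_diag ?y \<in> regular_tangent (real_diag ?x :: 'f^4^4)"
      by (simp add: regular_tangent_def real_diag_E4 sum_4)
    then have "v \<in> regular_tangent (real_diag ?x)"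
      unfolding p F_def
      by (intro subspace_add[OF subspace_regular_tangent] subspace_scale[OF subspace_regular_tangent]
          herm_entry_regular_tangent) auto
    moreover have "?x i + ?x j = 0 \<or> v $ i $ j = 0" if "i \<noteq> j" for i j
      using that exhaust_4[of i] exhaust_4[of j] by (auto simp: p F_def herm_entry_def)
    ultimately show "v \<in> curvature_space (real_diag ?x) 0" by (simp add: C)
  next
    fix v :: "'f^4^4" assume "v \<in> curvature_space (real_diag ?x) 0"
    then have v: "v \<in> regular_tangent (real_diag ?x)" "\<And>i j. i \<noteq> j \<Longrightarrow> ?x i + ?x j = 0 \<or> v $ i $ j = 0"
      by (auto simp: C)
    have h: "adjoint_matrix v = v" using v(1) by (simp add: regular_tangent_def E4_def)
    obtain s where s: "v $ 1 $ 1 = of_real (s * b)" "v $ 2 $ 2 = of_real (- s * b)"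
      "v $ 3 $ 3 = of_real (- s * a)" "v $ 4 $ 4 = of_real (s * a)"
      using spectrum4_tangent_diagonal[OF ab(1,2) v(1)] by blast
    have z: "v $ 1 $ 3 = 0" "v $ 1 $ 4 = 0" "v $ 2 $ 3 = 0" "v $ 2 $ 4 = 0"
      using v(2)[of 1 3] v(2)[of 1 4] v(2)[of 2 3] v(2)[of 2 4] ab by auto
    have "v = F ((v $ 1 $ 2, v $ 3 $ 4), s)"
      unfolding vec_eq_iff forall_4
      using z s hermitian_entries(1)[OF h, of 2 1] hermitian_entries(1)[OF h, of 4 3]
        hermitian_entries(1)[OF h, of 3 1] hermitian_entries(1)[OF h, of 4 1]
        hermitian_entries(1)[OF h, of 3 2] hermitian_entries(1)[OF h, of 4 2]
      by (simp add: F_def herm_entry_def of_real_def)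
    then show "v \<in> range F" by blast
  qed
  then have "dim (curvature_space (real_diag ?x :: 'f^4^4) 0) = dim (UNIV :: (('f \<times> 'f) \<times> real) set)"
    using dim_image_eq[OF lin, of UNIV] inj by simp
  then show ?thesis by simp
qed

lemma dim_curvature_space_spectrum4:
  assumes ab: "b < a" "0 < b" "2 * a\<^sup>2 + 2 * b\<^sup>2 = 1"
  shows "dim (curvature_space (real_diag (spectrum4 a b) :: 'f::conjugation_algebra^4^4) \<kappa>)
    = (if \<kappa> = 0 then 2 * DIM('f) + 1 else if \<kappa> \<in> nonzero_curvatures (a\<^sup>2 - b\<^sup>2) then DIM('f) else 0)"
proof (cases "\<kappa> = 0")
  case True
  then show ?thesis using dim_curvature_space_spectrum4_zero[OF ab] by simp
next
  case k0: False
  let ?x = "spectrum4 a b" and ?g = "a\<^sup>2 - b\<^sup>2"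
  have g0: "0 < ?g" using ab by (simp add: power_strict_mono)
  show ?thesis
  proof (cases "\<kappa> \<in> nonzero_curvatures ?g")
    case True
    then consider "\<kappa> = (a + b) / ?g" | "\<kappa> = - ((a + b) / ?g)" | "\<kappa> = (a - b) / ?g" | "\<kappa> = - ((a - b) / ?g)"
      unfolding nonzero_curvatures_spectrum4[OF ab] by blast
    then obtain i j where ij: "i \<noteq> j" "?x i + ?x j \<noteq> 0" "\<kappa> = - (?x i + ?x j) / ?g"
      "\<And>k l. k \<noteq> l \<Longrightarrow> ?x k + ?x l = ?x i + ?x j \<Longrightarrow> (k = i \<and> l = j) \<or> (k = j \<and> l = i)"
    proof cases
      case 1
      have "(k = 2 \<and> l = 4) \<or> (k = 4 \<and> l = 2)" if "k \<noteq> l" "?x k + ?x l = ?x 2 + ?x 4" for k l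
        using that exhaust_4[of k] exhaust_4[of l] ab by auto
      then show ?thesis using that[of 2 4] 1 ab by (simp add: minus_divide_left)
    next
      case 2
      have "(k = 1 \<and> l = 3) \<or> (k = 3 \<and> l = 1)" if "k \<noteq> l" "?x k + ?x l = ?x 1 + ?x 3" for k l
        using that exhaust_4[of k] exhaust_4[of l] ab by auto
      then show ?thesis using that[of 1 3] 2 ab by (simp add: minus_divide_left)
    next
      case 3
      have "(k = 2 \<and> l = 3) \<or> (k = 3 \<and> l = 2)" if "k \<noteq> l" "?x k + ?x l = ?x 2 + ?x 3" for k l
        using that exhaust_4[of k] exhaust_4[of l] ab by auto
      then show ?thesis using that[of 2 3] 3 ab by (simp add: minus_divide_left)
    next
      case 4
      have "(k = 1 \<and> l = 4) \<or> (k = 4 \<and> l = 1)" if "k \<noteq> l" "?x k + ?x l = ?x 1 + ?x 4" for k l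
        using that exhaust_4[of k] exhaust_4[of l] ab by auto
      then show ?thesis using that[of 1 4] 4 ab by (simp add: minus_divide_left)
    qed
    show ?thesis
      using curvature_space_spectrum4_simple[OF ab ij(1,2) ij(4), where 'f = 'f] True k0
      unfolding ij(3)[symmetric] by simp
  next
    case False
    have x: "?x i + ?x j + \<kappa> * ?g \<noteq> 0" if "i \<noteq> j" for i j
    proof
      assume "?x i + ?x j + \<kappa> * ?g = 0"
      then have "\<kappa> = - (?x i + ?x j) / ?g" using g0 by (simp add: field_simps)
      moreover have "- (?x i + ?x j) / ?g \<in> insert 0 (nonzero_curvatures ?g)"
        unfolding nonzero_curvatures_spectrum4[OF ab]
        using that exhaust_4[of i] exhaust_4[of j] by (auto simp: add.commute minus_divide_left)
      ultimately show False using False k0 by simp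
    qed
    have "curvature_space (real_diag ?x :: 'f^4^4) \<kappa> \<subseteq> {0}"
    proof
      fix v :: "'f^4^4" assume "v \<in> curvature_space (real_diag ?x) \<kappa>"
      then have "\<And>i j. i \<noteq> j \<Longrightarrow> v $ i $ j = 0" "\<And>i. v $ i $ i = 0"
        unfolding curvature_space_spectrum4[OF ab] using x k0 by blast+
      then have "v $ i $ j = 0" for i j by (cases "i = j") auto
      then show "v \<in> {0}" by (simp add: vec_eq_iff)
    qed
    then show ?thesis using False k0 by (simp add: dim_eq_0)
  qed
qed

lemma gap_bounds:
  assumes "A \<in> cubic_zeros" shows "0 < gap A" "gap A < 1 / 2" "(gap A)\<^sup>2 = quartic A - 1 / 4"
proof -
  have q: "1 / 4 < quartic A" "quartic A < 1 / 2" using assms by (auto simp: cubic_zeros_def)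
  then show "0 < gap A" "(gap A)\<^sup>2 = quartic A - 1 / 4" by (auto simp: gap_def)
  have "gap A < sqrt (1 / 4)" unfolding gap_def using q by (intro real_sqrt_less_mono) simp
  then show "gap A < 1 / 2" by (simp add: real_sqrt_divide)
qed

text \<open>
  Unitary conjugation reduces this to diagonal matrices.
\<close>

theorem dim_curvature_space:
  fixes A :: "'f::conjugation_algebra^4^4"
  assumes "A \<in> cubic_zeros"
  shows "dim (curvature_space A \<kappa>)
    = (if \<kappa> = 0 then 2 * DIM('f) + 1 else if \<kappa> \<in> nonzero_curvatures (gap A) then DIM('f) else 0)"
proof -
  obtain P a b where ab: "b < a" "0 < b" "2 * a\<^sup>2 + 2 * b\<^sup>2 = 1" and P: "P \<in> unitary_group"
    and A: "A = unitary_conj P (real_diag (spectrum4 a b))"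
    using cubic_zeros_connected_to_diagonal[OF assms] by metis
  have "dim (curvature_space A \<kappa>) = dim (curvature_space (real_diag (spectrum4 a b) :: 'f^4^4) \<kappa>)"
    unfolding A curvature_space_unitary_conj[OF P]
    by (intro dim_image_eq linear_unitary_conj inj_on_subset[OF inj_unitary_conj[OF P]]) auto
  moreover have "gap A = a\<^sup>2 - b\<^sup>2"
    unfolding A using gap_spectrum4[OF ab, where 'f = 'f] P by (simp add: gap_def unitary_conj_invariants)
  ultimately show ?thesis by (simp add: dim_curvature_space_spectrum4[OF ab])
qed

text \<open>
  In a frame that diagonalizes \<open>A\<close>, the vector \<open>v\<close> has zero diagonal and
  \<open>A\<^sup>3\<close> is diagonal.
\<close>

lemma curvature_space_cube_orthogonal:
  fixes A :: "'f::conjugation_algebra^4^4"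
  assumes "A \<in> cubic_zeros" "v \<in> curvature_space A \<kappa>" "\<kappa> \<noteq> 0"
  shows "inner (A ** A ** A) v = 0"
proof -
  obtain P a b where ab: "b < a" "0 < b" "2 * a\<^sup>2 + 2 * b\<^sup>2 = 1" and P: "P \<in> unitary_group"
    and A: "A = unitary_conj P (real_diag (spectrum4 a b))"
    using cubic_zeros_connected_to_diagonal[OF assms(1)] by metis
  obtain w where w: "v = unitary_conj P w" "w \<in> curvature_space (real_diag (spectrum4 a b)) \<kappa>"
    using assms(2) unfolding A curvature_space_unitary_conj[OF P] by blast
  then have "w $ i $ i = 0" for i
    using assms(3) unfolding curvature_space_spectrum4[OF ab] by blast
  then show ?thesis
    by (simp add: A w(1) unitary_conj_mult[OF P] inner_unitary_conj[OF P] inner_real_diag)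
qed

section \<open>Tangent spaces\<close>

lemma tangent_space_subspace:
  assumes "subspace L" "p \<in> L" shows "tangent_space L p = L"
proof -
  have "slice_chart L UNIV (\<lambda>x. x) (\<lambda>x. x) L"
    using assms(1) by (auto simp: slice_chart_def intro: smooth_on_id)
  then have "tangent_space L p = frechet_derivative (\<lambda>x. x) (at p) ` L"
    by (rule tangent_space_slice_chart[OF _ UNIV_I assms(2)])
  also have "frechet_derivative (\<lambda>x. x) (at p) = (\<lambda>x. x)"
    by (rule frechet_derivative_at[OF has_derivative_ident, symmetric])
  finally show ?thesis by simp
qed

lemma embedded_submanifold_S4:
    "embedded_submanifold (6 * DIM('f) + 2) (S4 :: ('f::conjugation_algebra^4^4) set)"
  and tangent_space_S4: "p \<in> S4 \<Longrightarrow> tangent_space S4 p = {v \<in> E4. inner (p :: 'f^4^4) v = 0}"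
proof -
  let ?f = "\<lambda>x :: 'f^4^4. inner x x - 1"
  have "embedded_submanifold (Suc (6 * DIM('f) + 2)) (E4 :: ('f^4^4) set)"
  proof -
    have "Suc (6 * DIM('f) + 2) = dim (E4 :: ('f^4^4) set)" by (simp add: dim_E4)
    then show ?thesis using embedded_submanifold_subspace[OF subspace_E4] by metis
  qed
  note N = this
  have s: "smooth_on UNIV ?f"
    by (intro smooth_on_diff smooth_on_bilinear[OF bounded_bilinear_inner] smooth_on_id smooth_on_const open_UNIV)
  have d: "frechet_derivative ?f (at p) = (\<lambda>v. 2 * inner p v)" for p :: "'f^4^4"
  proof -
    have "(?f has_derivative (\<lambda>v. 2 * inner p v)) (at p)"
      by (auto intro!: derivative_eq_intros simp: inner_commute)
    then show ?thesis by (rule frechet_derivative_at[symmetric])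
  qed
  have reg: "\<exists>v\<in>tangent_space E4 p. frechet_derivative ?f (at p) v \<noteq> 0" if "p \<in> E4" "?f p = 0" for p :: "'f^4^4"
    by (rule bexI[of _ p]) (use that in \<open>simp_all add: d tangent_space_subspace[OF subspace_E4]\<close>)
  have S: "S4 = {x \<in> E4 \<inter> UNIV. ?f x = 0}" by (auto simp: S4_altdef)
  show "embedded_submanifold (6 * DIM('f) + 2) (S4 :: ('f^4^4) set)"
    unfolding S by (rule regular_level_set(1)[OF N open_UNIV s reg])
  assume "p \<in> S4"
  then show "tangent_space S4 p = {v \<in> E4. inner p v = 0}"
    unfolding S using regular_level_set(2)[OF N open_UNIV s reg]
    by (auto simp: d tangent_space_subspace[OF subspace_E4])
qed

text \<open>
  On the unit sphere this is the traceless part of \<open>A\<^sup>2\<close>. At the zeros of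
  \<open>cubic\<close> it is orthogonal to \<open>A\<close>, hence the part of
  \<open>A\<^sup>2\<close> tangent to the sphere.
\<close>

definition traceless_square :: "'f::conjugation_algebra^4^4 \<Rightarrow> 'f^4^4" where
  "traceless_square A = A ** A - (1 / 4) *\<^sub>R mat 1"

lemma inner_mat_1_mat_1 [simp]: "inner (mat 1 :: 'f::conjugation_algebra^4^4) (mat 1) = 4"
  by (simp add: mat_1_real_diag)

lemma traceless_square_inner:
  fixes A :: "'f::conjugation_algebra^4^4"
  assumes "A \<in> S4"
  shows "traceless_square A \<in> E4" "inner (traceless_square A) A = cubic A"
    "inner (traceless_square A) (traceless_square A) = quartic A - 1 / 4"
    "inner (A ** A) (traceless_square A) = quartic A - 1 / 4"
proof -
  have A: "adjoint_matrix A = A" "inner A (mat 1) = 0" "inner A A = 1"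
    using assms by (auto simp: S4_altdef E4_altdef)
  have AA: "inner (A ** A) (mat 1) = 1" using A by (simp add: inner_matrix_mult_right)
  show "traceless_square A \<in> E4"
    using A AA by (simp add: traceless_square_def E4_altdef adjoint_diff adjoint_mult adjoint_scaleR inner_diff_left)
  show "inner (traceless_square A) A = cubic A"
    using A(2) by (simp add: traceless_square_def inner_diff_left cubic_def inner_commute[of "mat 1"])
  show "inner (traceless_square A) (traceless_square A) = quartic A - 1 / 4" "inner (A ** A) (traceless_square A) = quartic A - 1 / 4"
    using AA by (simp_all add: traceless_square_def inner_diff_left inner_diff_right quartic_def inner_commute)
qed

lemma cubic_has_derivative:
  fixes A :: "'f::conjugation_algebra^4^4"
  assumes "adjoint_matrix A = A"
  shows "(cubic has_derivative (\<lambda>v. 3 * inner (A ** A) v)) (at A)"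
proof -
  have sq: "((\<lambda>A. A ** A) has_derivative (\<lambda>v. A ** v + v ** A)) (at A)"
    by (rule bounded_bilinear.FDERIV[OF bounded_bilinear_matrix_mult has_derivative_ident has_derivative_ident])
  have "(cubic has_derivative (\<lambda>v. inner (A ** A) v + inner (A ** v + v ** A) A)) (at A)"
    unfolding cubic_def by (rule has_derivative_inner[OF sq has_derivative_ident])
  then show ?thesis
    by (rule has_derivative_eq_rhs)
      (simp add: assms fun_eq_iff inner_add_left inner_matrix_mult_left[of A] inner_matrix_mult_right[of _ A]
        inner_commute[of _ "A ** A"])
qed

lemma quartic_has_derivative:
  fixes A :: "'f::conjugation_algebra^4^4"
  assumes "adjoint_matrix A = A"
  shows "(quartic has_derivative (\<lambda>v. 4 * inner (A ** A ** A) v)) (at A)"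
proof -
  have sq: "((\<lambda>A. A ** A) has_derivative (\<lambda>v. A ** v + v ** A)) (at A)"
    by (rule bounded_bilinear.FDERIV[OF bounded_bilinear_matrix_mult has_derivative_ident has_derivative_ident])
  have "(quartic has_derivative (\<lambda>v. inner (A ** A) (A ** v + v ** A) + inner (A ** v + v ** A) (A ** A))) (at A)"
    unfolding quartic_def by (rule has_derivative_inner[OF sq sq])
  moreover have "inner (A ** v) (A ** A) = inner (A ** A ** A) v" "inner (v ** A) (A ** A) = inner (A ** A ** A) v" for v
    using assms by (simp_all add: inner_matrix_mult_left[of A v] inner_matrix_mult_right[of v A] matrix_mul_assoc inner_commute[of v])
  ultimately show ?thesis
    by (elim has_derivative_eq_rhs) (simp add: fun_eq_iff inner_add_left inner_add_right inner_commute[of "A ** A"])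
qed

lemma smooth_on_square: "open U \<Longrightarrow> smooth_on U (\<lambda>A :: 'f::conjugation_algebra^4^4. A ** A)"
  by (intro smooth_on_bilinear[OF bounded_bilinear_matrix_mult] smooth_on_id)

lemma open_quartic_range: "open {A :: 'f::conjugation_algebra^4^4. 1 / 4 < quartic A \<and> quartic A < 1 / 2}"
  by (intro open_Collect_conj open_Collect_less continuous_on_quartic continuous_on_const)

text \<open>
  At a zero of \<open>cubic\<close> the derivative in the direction of
  \<open>A\<^sup>2 - I/4\<close>, which is tangent to the sphere, is three times the squared
  norm of this matrix, \<open>quartic A - 1/4\<close>.
\<close>

lemma embedded_submanifold_cubic_zeros:
    "embedded_submanifold (6 * DIM('f) + 1) (cubic_zeros :: ('f::conjugation_algebra^4^4) set)"
  and tangent_space_cubic_zeros: "p \<in> cubic_zeros \<Longrightarrow> tangent_space cubic_zeros p = regular_tangent (p :: 'f^4^4)"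
proof -
  let ?W = "{A :: 'f^4^4. 1 / 4 < quartic A \<and> quartic A < 1 / 2}"
  have N: "embedded_submanifold (Suc (6 * DIM('f) + 1)) (S4 :: ('f^4^4) set)"
    using embedded_submanifold_S4[where 'f = 'f] by simp
  have s: "smooth_on ?W cubic"
    unfolding cubic_def
    by (intro smooth_on_bilinear[OF bounded_bilinear_inner] smooth_on_square smooth_on_id open_quartic_range)
  have h: "adjoint_matrix p = p" if "p \<in> S4" for p :: "'f^4^4" using that by (simp add: S4_def E4_def)
  have d: "frechet_derivative cubic (at p) = (\<lambda>v. 3 * inner (p ** p) v)" if "p \<in> S4" for p :: "'f^4^4"
    by (rule frechet_derivative_at[OF cubic_has_derivative[OF h[OF that]], symmetric])
  have reg: "\<exists>v\<in>tangent_space S4 p. frechet_derivative cubic (at p) v \<noteq> 0"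
    if "p \<in> S4" "p \<in> ?W" "cubic p = 0" for p :: "'f^4^4"
    by (rule bexI[of _ "traceless_square p"])
      (use that traceless_square_inner[OF that(1)] in \<open>simp_all add: d tangent_space_S4 inner_commute[of p]\<close>)
  have B: "cubic_zeros = {x \<in> S4 \<inter> ?W. cubic x = 0}" by (auto simp: cubic_zeros_def)
  show "embedded_submanifold (6 * DIM('f) + 1) (cubic_zeros :: ('f^4^4) set)"
    unfolding B by (rule regular_level_set(1)[OF N open_quartic_range s reg])
  assume p: "p \<in> cubic_zeros"
  then have "p \<in> {x \<in> S4 \<inter> ?W. cubic x = 0}" by (simp add: B)
  from regular_level_set(2)[OF N open_quartic_range s reg this]
  have "tangent_space cubic_zeros p = {v \<in> tangent_space S4 p. frechet_derivative cubic (at p) v = 0}"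
    unfolding B .
  moreover have "p \<in> S4" using p by (simp add: cubic_zeros_def)
  ultimately show "tangent_space cubic_zeros p = regular_tangent p"
    by (auto simp: d tangent_space_S4 regular_tangent_def)
qed

section \<open>The unit normal\<close>

definition normal_field :: "'f::conjugation_algebra^4^4 \<Rightarrow> 'f^4^4" where
  "normal_field A = inverse (sqrt (inner (traceless_square A) (traceless_square A))) *\<^sub>R traceless_square A"

lemma normal_field_inner:
  fixes A :: "'f::conjugation_algebra^4^4"
  assumes "A \<in> cubic_zeros"
  shows "normal_field A = inverse (gap A) *\<^sub>R traceless_square A" "normal_field A \<in> E4"
    "inner (normal_field A) A = 0" "inner (normal_field A) (normal_field A) = 1"
    "v \<in> E4 \<Longrightarrow> inner (normal_field A) v = inverse (gap A) * inner (A ** A) v"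
proof -
  have A: "A \<in> S4" "cubic A = 0" using assms by (auto simp: cubic_zeros_def)
  show n: "normal_field A = inverse (gap A) *\<^sub>R traceless_square A"
    using traceless_square_inner[OF A(1)] by (simp add: normal_field_def gap_def)
  show "normal_field A \<in> E4" using traceless_square_inner[OF A(1)] unfolding n by (intro subspace_scale[OF subspace_E4])
  show "inner (normal_field A) A = 0" using traceless_square_inner[OF A(1)] A(2) by (simp add: n)
  show "inner (normal_field A) (normal_field A) = 1"
    using traceless_square_inner[OF A(1)] gap_bounds[OF assms] by (simp add: n power2_eq_square[symmetric] field_simps)
  show "inner (normal_field A) v = inverse (gap A) * inner (A ** A) v" if "v \<in> E4"
    using that by (simp add: n traceless_square_def inner_diff_left E4_altdef inner_commute[of "mat 1"])
qed

text \<open>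
  Subtracting the component along the unit normal leaves a vector tangent to the orbit; being also
  normal, it vanishes.
\<close>

lemma normal_space_cubic_zeros:
  fixes A :: "'f::conjugation_algebra^4^4"
  assumes A: "A \<in> cubic_zeros"
  shows "normal_space S4 cubic_zeros A = range (\<lambda>t. t *\<^sub>R normal_field A)"
proof -
  have AS: "A \<in> S4" using A by (simp add: cubic_zeros_def)
  note n = normal_field_inner[OF A]
  have g: "gap A \<noteq> 0" using gap_bounds(1)[OF A] by simp
  have nT: "inner (normal_field A) v = 0" if "v \<in> regular_tangent A" for v
    using that n(5)[of v] by (simp add: regular_tangent_def)
  show ?thesis
  proof (intro equalityI subsetI)
    fix \<xi> assume "\<xi> \<in> range (\<lambda>t. t *\<^sub>R normal_field A)"
    then show "\<xi> \<in> normal_space S4 cubic_zeros A"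
      using n(2,3) nT
      by (auto simp: normal_space_def tangent_space_S4[OF AS] tangent_space_cubic_zeros[OF A]
          inner_commute[of A] intro: subspace_scale[OF subspace_E4])
  next
    fix \<xi> assume "\<xi> \<in> normal_space S4 cubic_zeros A"
    then have xi: "\<xi> \<in> E4" "inner A \<xi> = 0" "\<And>v. v \<in> regular_tangent A \<Longrightarrow> inner \<xi> v = 0"
      by (auto simp: normal_space_def tangent_space_S4[OF AS] tangent_space_cubic_zeros[OF A])
    define \<zeta> where "\<zeta> = \<xi> - inner \<xi> (normal_field A) *\<^sub>R normal_field A"
    have z: "\<zeta> \<in> E4" unfolding \<zeta>_def
      by (intro subspace_diff[OF subspace_E4] subspace_scale[OF subspace_E4] xi n)
    have nz: "inner (normal_field A) \<zeta> = 0"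
      using n(4) by (simp add: \<zeta>_def inner_diff_right inner_commute)
    then have "inner (A ** A) \<zeta> = 0" using n(5)[OF z] g by simp
    moreover have "inner A \<zeta> = 0" using xi(2) n(3) by (simp add: \<zeta>_def inner_diff_right inner_commute)
    ultimately have "\<zeta> \<in> regular_tangent A" using z by (simp add: regular_tangent_def)
    then have "inner \<xi> \<zeta> = 0" by (rule xi(3))
    then have "inner \<zeta> \<zeta> = 0" using nz by (simp add: \<zeta>_def inner_diff_left)
    then have "\<xi> = inner \<xi> (normal_field A) *\<^sub>R normal_field A" by (simp add: \<zeta>_def)
    then show "\<xi> \<in> range (\<lambda>t. t *\<^sub>R normal_field A)" by blast
  qed
qed

lemma smooth_normal_field:
  obtains U where "open U" "cubic_zeros \<subseteq> U" "smooth_on U (normal_field :: 'f::conjugation_algebra^4^4 \<Rightarrow> _)"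
proof -
  let ?r = "\<lambda>A :: 'f^4^4. inner (traceless_square A) (traceless_square A)"
  have sr: "smooth_on UNIV (traceless_square :: 'f^4^4 \<Rightarrow> _)"
    unfolding traceless_square_def by (intro smooth_on_diff smooth_on_square smooth_on_const open_UNIV)
  have srr: "smooth_on UNIV ?r" by (intro smooth_on_bilinear[OF bounded_bilinear_inner] sr open_UNIV)
  define U where "U = {A. 0 < ?r A}"
  have U: "open U" unfolding U_def
    by (intro open_Collect_less continuous_on_const smooth_on_imp_continuous_on srr)
  have "smooth_on U (\<lambda>A. inverse (sqrt (?r A)))"
    by (rule smooth_on_compose[OF smooth_on_subset[OF srr] smooth_on_inverse_sqrt U]) (auto simp: U_def)
  then have "smooth_on U normal_field"
    unfolding normal_field_def
    by (intro smooth_on_bilinear[OF bounded_bilinear_scaleR] smooth_on_subset[OF sr] U) auto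
  moreover have "cubic_zeros \<subseteq> U"
  proof
    fix A :: "'f^4^4" assume "A \<in> cubic_zeros"
    then have "A \<in> S4" "1 / 4 < quartic A" by (simp_all add: cubic_zeros_def)
    then have "0 < inner (traceless_square A) (traceless_square A)" using traceless_square_inner(3)[of A] by linarith
    then show "A \<in> U" by (simp add: U_def)
  qed
  ultimately show thesis using that U by blast
qed

text \<open>
  Differentiating the normalizing factor contributes a multiple of the normal, which tangent
  vectors do not see.
\<close>

lemma inner_normal_field_derivative:
  fixes A :: "'f::conjugation_algebra^4^4"
  assumes A: "A \<in> cubic_zeros" and w: "w \<in> regular_tangent A"
  shows "inner (frechet_derivative normal_field (at A) v) w = inverse (gap A) * inner (A ** v + v ** A) w"
proof -
  have rw: "inner (traceless_square A) w = 0"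
    using w by (simp add: traceless_square_def inner_diff_left regular_tangent_def E4_altdef inner_commute[of "mat 1"])
  have AS: "A \<in> S4" using A by (simp add: cubic_zeros_def)
  have sq: "((\<lambda>A. A ** A) has_derivative (\<lambda>v. A ** v + v ** A)) (at A)"
    by (rule bounded_bilinear.FDERIV[OF bounded_bilinear_matrix_mult has_derivative_ident has_derivative_ident])
  have dr: "(traceless_square has_derivative (\<lambda>v. A ** v + v ** A)) (at A)"
    unfolding traceless_square_def
    by (rule has_derivative_eq_rhs[OF has_derivative_diff[OF sq has_derivative_const]]) simp
  have r0: "0 < inner (traceless_square A) (traceless_square A)" using traceless_square_inner(3)[OF AS] A by (simp add: cubic_zeros_def)
  have "(\<lambda>r. inverse (sqrt r)) differentiable (at (inner (traceless_square A) (traceless_square A)))"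
    using smooth_on_has_derivative[OF smooth_on_inverse_sqrt, of "inner (traceless_square A) (traceless_square A)"] r0
    unfolding differentiable_def greaterThan_iff by blast
  moreover have "(\<lambda>A. inner (traceless_square A) (traceless_square A)) differentiable (at A)"
    using has_derivative_inner[OF dr dr] by (auto simp: differentiable_def)
  ultimately have "(\<lambda>A. inverse (sqrt (inner (traceless_square A) (traceless_square A)))) differentiable (at A)"
    by (rule differentiable_compose)
  then obtain h' where h': "((\<lambda>A. inverse (sqrt (inner (traceless_square A) (traceless_square A)))) has_derivative h') (at A)"
    by (auto simp: differentiable_def)
  have "(normal_field has_derivative
      (\<lambda>v. inverse (sqrt (inner (traceless_square A) (traceless_square A))) *\<^sub>R (A ** v + v ** A) + h' v *\<^sub>R traceless_square A)) (at A)"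
    unfolding normal_field_def by (rule has_derivative_scaleR[OF h' dr])
  note frechet_derivative_at[OF this, symmetric]
  then show ?thesis using rw by (simp add: inner_add_left traceless_square_inner(3)[OF AS] gap_def)
qed

section \<open>Shape operator of a hypersurface\<close>

lemma orth_proj_eqI:
  assumes "subspace V" "y \<in> V" "\<And>z. z \<in> V \<Longrightarrow> inner (x - y) z = 0"
  shows "orth_proj V x = y"
  unfolding orth_proj_def
proof (rule the_equality)
  fix y' assume y': "y' \<in> V \<and> (\<forall>z\<in>V. inner (x - y') z = 0)"
  have "y - y' \<in> V" using assms y' by (intro subspace_diff) auto
  then have "inner (x - y') (y - y') = 0" "inner (x - y) (y - y') = 0" using y' assms(3) by blast+
  then have "inner (y - y') (y - y') = 0" by (simp add: inner_diff_left)
  then show "y' = y" by simp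
qed (use assms in blast)

lemma orth_proj_mem:
  fixes V :: "'a::euclidean_space set"
  assumes "subspace V"
  shows "orth_proj V x \<in> V" "z \<in> V \<Longrightarrow> inner (orth_proj V x) z = inner x z"
proof -
  obtain y u where yu: "x = y + u" "y \<in> span V" "\<And>w. w \<in> span V \<Longrightarrow> orthogonal u w"
    using orthogonal_subspace_decomp_exists[of V x] by metis
  have sV: "span V = V" using assms by (simp add: span_eq_iff)
  have "orth_proj V x = y"
    using yu sV by (intro orth_proj_eqI[OF assms]) (auto simp: orthogonal_def)
  then show "orth_proj V x \<in> V" "z \<in> V \<Longrightarrow> inner (orth_proj V x) z = inner x z"
    using yu sV by (auto simp: inner_add_left orthogonal_def)
qed

lemma orth_proj_eq_iff:
  fixes V :: "'a::euclidean_space set"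
  assumes "subspace V" "y \<in> V"
  shows "orth_proj V x = y \<longleftrightarrow> (\<forall>z\<in>V. inner x z = inner y z)"
proof
  assume "orth_proj V x = y"
  then show "\<forall>z\<in>V. inner x z = inner y z" using orth_proj_mem(2)[OF assms(1), of _ x] by simp
next
  assume "\<forall>z\<in>V. inner x z = inner y z"
  then show "orth_proj V x = y" by (intro orth_proj_eqI[OF assms]) (simp add: inner_diff_left)
qed

lemma orth_proj_orth_proj:
  fixes V W :: "'a::euclidean_space set"
  assumes "subspace V" "subspace W" "V \<subseteq> W"
  shows "orth_proj V (orth_proj W x) = orth_proj V x"
  unfolding orth_proj_eq_iff[OF assms(1) orth_proj_mem(1)[OF assms(1)]]
  using orth_proj_mem(2)[OF assms(2), of _ x] orth_proj_mem(2)[OF assms(1), of _ x] assms(3) by auto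

text \<open>
  Any local normal field \<open>X\<close> is a function times \<open>\<nu>\<close> on
  \<open>M\<close>. Differentiating this along a curve in \<open>M\<close> shows that the
  derivative of \<open>X\<close> is that of \<open>t \<nu>\<close> up to a multiple of the
  normal, so the value in the Weingarten formula does not depend on \<open>X\<close>.
\<close>

lemma shape_operator_hypersurface:
  fixes M N :: "'a::euclidean_space set"
  assumes TN: "subspace (tangent_space N p)" and TM: "subspace (tangent_space M p)"
    "tangent_space M p \<subseteq> tangent_space N p"
    and U0: "open U0" "M \<subseteq> U0" "smooth_on U0 \<nu>"
    and nrm: "\<And>q. q \<in> M \<Longrightarrow> normal_space N M q = range (\<lambda>t. t *\<^sub>R \<nu> q)" "\<And>q. q \<in> M \<Longrightarrow> inner (\<nu> q) (\<nu> q) = 1"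
    and p: "p \<in> M" and v: "v \<in> tangent_space M p"
  shows "shape_operator N M p (t *\<^sub>R \<nu> p) v
    = - orth_proj (tangent_space M p) (t *\<^sub>R frechet_derivative \<nu> (at p) v)"
proof -
  let ?T = "tangent_space M p"
  have pU0: "p \<in> U0" using U0 p by blast
  have d\<nu>: "(\<nu> has_derivative frechet_derivative \<nu> (at p)) (at p)"
    using smooth_on_has_derivative[OF U0(3) pU0] .
  have \<nu>T: "inner (\<nu> p) z = 0" if "z \<in> ?T" for z
  proof -
    have "\<nu> p \<in> normal_space N M p" using nrm(1)[OF p] by (metis rangeI scaleR_one)
    then show ?thesis using that by (simp add: normal_space_def)
  qed
  have unique: "orth_proj ?T (frechet_derivative X (at p) v) = orth_proj ?T (t *\<^sub>R frechet_derivative \<nu> (at p) v)"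
    if U: "open U" "p \<in> U" "smooth_on U X" and X: "\<forall>q\<in>U \<inter> M. X q \<in> normal_space N M q" "X p = t *\<^sub>R \<nu> p" for U X
  proof -
    obtain \<gamma> \<epsilon> where \<gamma>: "0 < \<epsilon>" "smooth_on {-\<epsilon><..<\<epsilon>} \<gamma>" "\<gamma> ` {-\<epsilon><..<\<epsilon>} \<subseteq> M" "\<gamma> 0 = p"
      "(\<gamma> has_vector_derivative v) (at (0::real))"
      using v unfolding tangent_space_altdef by blast
    have dX: "(X has_derivative frechet_derivative X (at p)) (at p)"
      using smooth_on_has_derivative[OF U(3,2)] .
    have vd: "((\<lambda>t. F (\<gamma> t)) has_vector_derivative F' v) (at 0)" if "(F has_derivative F') (at p)" for F F'
      using has_derivative_compose[OF \<gamma>(5)[unfolded has_vector_derivative_def], of F F'] that \<gamma>(4)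
        linear_scale[OF has_derivative_linear[OF that]]
      by (simp add: has_vector_derivative_def)
    let ?a = "frechet_derivative X (at p) v" and ?b = "frechet_derivative \<nu> (at p) v"
    have a: "((\<lambda>t. X (\<gamma> t)) has_vector_derivative ?a) (at 0)" by (rule vd[OF dX])
    have b: "((\<lambda>t. \<nu> (\<gamma> t)) has_vector_derivative ?b) (at 0)" by (rule vd[OF d\<nu>])
    have "((\<lambda>t. inner (X (\<gamma> t)) (\<nu> (\<gamma> t))) has_derivative
        (\<lambda>s. inner (X (\<gamma> 0)) (s *\<^sub>R ?b) + inner (s *\<^sub>R ?a) (\<nu> (\<gamma> 0)))) (at 0)"
      using has_derivative_inner[OF a[unfolded has_vector_derivative_def] b[unfolded has_vector_derivative_def]] .
    from has_derivative_scaleR[OF this b[unfolded has_vector_derivative_def]]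
    have "((\<lambda>t. inner (X (\<gamma> t)) (\<nu> (\<gamma> t)) *\<^sub>R \<nu> (\<gamma> t)) has_vector_derivative
        t *\<^sub>R ?b + (inner (t *\<^sub>R \<nu> p) ?b + inner ?a (\<nu> p)) *\<^sub>R \<nu> p) (at 0)"
      unfolding has_vector_derivative_def
      by (rule has_derivative_eq_rhs) (simp add: fun_eq_iff \<gamma>(4) X(2) nrm(2)[OF p] algebra_simps)
    moreover have "((\<lambda>t. inner (X (\<gamma> t)) (\<nu> (\<gamma> t)) *\<^sub>R \<nu> (\<gamma> t)) has_vector_derivative ?a) (at 0)"
      using a unfolding has_vector_derivative_def
    proof (rule has_derivative_transform_within_open)
      show "open ({-\<epsilon><..<\<epsilon>} \<inter> \<gamma> -` U)"
        using \<gamma>(2) U(1) by (intro continuous_open_preimage smooth_on_imp_continuous_on) auto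
      show "0 \<in> {-\<epsilon><..<\<epsilon>} \<inter> \<gamma> -` U" using \<gamma> U(2) by auto
      fix s assume "s \<in> {-\<epsilon><..<\<epsilon>} \<inter> \<gamma> -` U"
      then have "\<gamma> s \<in> U \<inter> M" using \<gamma>(3) by blast
      then have "\<gamma> s \<in> M" "X (\<gamma> s) \<in> range (\<lambda>t. t *\<^sub>R \<nu> (\<gamma> s))" using X(1) nrm(1) by auto
      then show "X (\<gamma> s) = inner (X (\<gamma> s)) (\<nu> (\<gamma> s)) *\<^sub>R \<nu> (\<gamma> s)" using nrm(2)[of "\<gamma> s"] by auto
    qed
    ultimately have "?a = t *\<^sub>R ?b + (inner (t *\<^sub>R \<nu> p) ?b + inner ?a (\<nu> p)) *\<^sub>R \<nu> p"
      using vector_derivative_unique_at by blast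
    then have "inner ?a z = inner (t *\<^sub>R ?b) z" if "z \<in> ?T" for z
      using \<nu>T[OF that] by (metis (no_types, lifting) add.right_neutral inner_add_left inner_scaleR_left mult_zero_right)
    then show ?thesis
      unfolding orth_proj_eq_iff[OF TM(1) orth_proj_mem(1)[OF TM(1)]]
      using orth_proj_mem(2)[OF TM(1), of _ "t *\<^sub>R frechet_derivative \<nu> (at p) v"] by simp
  qed
  have s: "smooth_on U0 (\<lambda>q. t *\<^sub>R \<nu> q)"
    by (intro smooth_on_bilinear[OF bounded_bilinear_scaleR] smooth_on_const U0)
  have ex: "\<forall>q\<in>U0 \<inter> M. t *\<^sub>R \<nu> q \<in> normal_space N M q" using nrm(1) by auto
  show ?thesis
    unfolding shape_operator_def covariant_derivative_def orth_proj_orth_proj[OF TM(1) TN TM(2)]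
  proof (rule the_equality)
    show "\<exists>U X. open U \<and> p \<in> U \<and> smooth_on U X \<and> (\<forall>q\<in>U \<inter> M. X q \<in> normal_space N M q) \<and>
        X p = t *\<^sub>R \<nu> p \<and> - orth_proj ?T (t *\<^sub>R frechet_derivative \<nu> (at p) v) = - orth_proj ?T (frechet_derivative X (at p) v)"
      using unique[OF U0(1) pU0 s ex refl] U0(1) pU0 s ex
      by (intro exI[of _ U0] exI[of _ "\<lambda>q. t *\<^sub>R \<nu> q"] conjI) simp_all
  next
    fix w assume "\<exists>U X. open U \<and> p \<in> U \<and> smooth_on U X \<and> (\<forall>q\<in>U \<inter> M. X q \<in> normal_space N M q) \<and>
        X p = t *\<^sub>R \<nu> p \<and> w = - orth_proj ?T (frechet_derivative X (at p) v)"
    then obtain U X where "open U" "p \<in> U" "smooth_on U X" "\<forall>q\<in>U \<inter> M. X q \<in> normal_space N M q"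
      "X p = t *\<^sub>R \<nu> p" "w = - orth_proj ?T (frechet_derivative X (at p) v)"
      by blast
    then show "w = - orth_proj ?T (t *\<^sub>R frechet_derivative \<nu> (at p) v)" using unique by simp
  qed
qed

lemma eigenspace_shape_operator_cubic_zeros:
  fixes p :: "'f::conjugation_algebra^4^4"
  assumes p: "p \<in> cubic_zeros"
  shows "eigenspace (tangent_space cubic_zeros p) (shape_operator S4 cubic_zeros p (t *\<^sub>R normal_field p)) \<kappa>
    = {v \<in> regular_tangent p. \<forall>w\<in>regular_tangent p. t * inner (p ** v + v ** p) w = - \<kappa> * gap p * inner v w}"
proof -
  have pS: "p \<in> S4" using p by (simp add: cubic_zeros_def)
  obtain U where U: "open U" "cubic_zeros \<subseteq> U" "smooth_on U (normal_field :: 'f^4^4 \<Rightarrow> _)"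
    by (rule smooth_normal_field)
  note T = tangent_space_cubic_zeros[OF p]
  have TN: "subspace (tangent_space S4 p)" using tangent_space_subspace_dim(1)[OF embedded_submanifold_S4 pS] .
  have TM: "subspace (tangent_space cubic_zeros p)" "tangent_space cubic_zeros p \<subseteq> tangent_space S4 p"
    unfolding T tangent_space_S4[OF pS] by (rule subspace_regular_tangent) (auto simp: regular_tangent_def)
  have g: "gap p \<noteq> 0" using gap_bounds(1)[OF p] by simp
  have "shape_operator S4 cubic_zeros p (t *\<^sub>R normal_field p) v = \<kappa> *\<^sub>R v \<longleftrightarrow>
      (\<forall>w\<in>regular_tangent p. t * inner (p ** v + v ** p) w = - \<kappa> * gap p * inner v w)"
    if v: "v \<in> regular_tangent p" for v
  proof -
    let ?D = "frechet_derivative normal_field (at p) v"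
    have "shape_operator S4 cubic_zeros p (t *\<^sub>R normal_field p) v = - orth_proj (regular_tangent p) (t *\<^sub>R ?D)"
      unfolding T[symmetric]
      by (rule shape_operator_hypersurface[OF TN TM U])
        (use normal_space_cubic_zeros normal_field_inner(4) p v T in auto)
    then have "shape_operator S4 cubic_zeros p (t *\<^sub>R normal_field p) v = \<kappa> *\<^sub>R v
        \<longleftrightarrow> orth_proj (regular_tangent p) (t *\<^sub>R ?D) = - \<kappa> *\<^sub>R v"
      unfolding scaleR_minus_left using minus_equation_iff[of "orth_proj (regular_tangent p) (t *\<^sub>R ?D)" "\<kappa> *\<^sub>R v"]
      by (simp add: eq_commute)
    also have "\<dots> \<longleftrightarrow> (\<forall>w\<in>regular_tangent p. inner (t *\<^sub>R ?D) w = inner (- \<kappa> *\<^sub>R v) w)"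
      using subspace_scale[OF subspace_regular_tangent v] by (intro orth_proj_eq_iff subspace_regular_tangent)
    also have "\<dots> \<longleftrightarrow> (\<forall>w\<in>regular_tangent p. t * inner (p ** v + v ** p) w = - \<kappa> * gap p * inner v w)"
      by (intro ball_cong refl) (use g in \<open>auto simp: inner_normal_field_derivative[OF p] field_simps\<close>)
    finally show ?thesis .
  qed
  then show ?thesis unfolding eigenspace_def T by blast
qed

section \<open>Austerity\<close>

text \<open>
  If negation permutes the arguments, symmetry gives \<open>f (- x) = f x\<close> and the odd
  degree gives \<open>f (- x) = - f x\<close>.
\<close>

lemma odd_symmetric_poly_vanishes:
  assumes f: "homogeneous_symmetric_poly (length \<mu>) d f" and d: "odd d"
    and sym: "image_mset uminus (mset \<mu>) = mset \<mu>"
  shows "f (\<lambda>i. \<mu> ! i) = 0"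
proof -
  let ?n = "length \<mu>" and ?x = "\<lambda>i. \<mu> ! i"
  obtain E c where E: "finite E" "\<forall>\<alpha>\<in>E. (\<Sum>i<?n. \<alpha> i) = d"
    "\<forall>x. f x = (\<Sum>\<alpha>\<in>E. c \<alpha> * (\<Prod>i<?n. x i ^ \<alpha> i))"
    and inv: "\<And>\<pi> x. \<pi> permutes {..<?n} \<Longrightarrow> f (x \<circ> \<pi>) = f x"
    using f unfolding homogeneous_symmetric_poly_def by blast
  have "mset (map uminus \<mu>) = mset \<mu>" using sym by simp
  then obtain \<pi> where \<pi>: "\<pi> permutes {..<?n}" "permute_list \<pi> \<mu> = map uminus \<mu>"
    by (rule mset_eq_permutation)
  have neg: "?x (\<pi> i) = - ?x i" if "i < ?n" for i
    using permute_list_nth[OF \<pi>(1) that] \<pi>(2) that by simp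
  have "f ?x = f (?x \<circ> \<pi>)" using inv[OF \<pi>(1)] by simp
  also have "\<dots> = (\<Sum>\<alpha>\<in>E. c \<alpha> * (\<Prod>i<?n. (- ?x i) ^ \<alpha> i))"
    unfolding E(3)[rule_format] by (intro sum.cong refl arg_cong2[where f = "(*)"] prod.cong) (simp_all add: neg)
  also have "\<dots> = (\<Sum>\<alpha>\<in>E. c \<alpha> * ((- 1) ^ d * (\<Prod>i<?n. ?x i ^ \<alpha> i)))"
  proof (intro sum.cong refl arg_cong2[where f = "(*)"])
    fix \<alpha> assume "\<alpha> \<in> E"
    then have "(- 1 :: real) ^ d = (\<Prod>i<?n. (- 1) ^ \<alpha> i)" using E(2) by (simp add: power_sum[symmetric])
    then show "(\<Prod>i<?n. (- ?x i) ^ \<alpha> i) = (- 1) ^ d * (\<Prod>i<?n. ?x i ^ \<alpha> i)"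
      by (simp add: prod.distrib[symmetric] power_minus[symmetric])
  qed
  also have "\<dots> = - f ?x" using d by (simp add: E(3)[rule_format] sum_negf)
  finally show ?thesis by simp
qed

lemma eigenvalues_iff_dim:
  fixes V :: "'a::euclidean_space set"
  shows "subspace (eigenspace V S \<kappa>) \<Longrightarrow> \<kappa> \<in> eigenvalues V S \<longleftrightarrow> dim (eigenspace V S \<kappa>) \<noteq> 0"
  unfolding eigenvalues_def mem_Collect_eq dim_eq_0 by blast

lemma eigenvalue_mset_uminus:
  fixes V :: "'a::euclidean_space set"
  assumes sub: "\<And>\<kappa>. subspace (eigenspace V S \<kappa>)"
    and sym: "\<And>\<kappa>. dim (eigenspace V S (- \<kappa>)) = dim (eigenspace V S \<kappa>)"
  shows "image_mset uminus (eigenvalue_mset V S) = eigenvalue_mset V S"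
proof -
  have "image_mset uminus (eigenvalue_mset V S)
      = (\<Sum>\<kappa>\<in>eigenvalues V S. image_mset uminus (replicate_mset (dim (eigenspace V S \<kappa>)) \<kappa>))"
    unfolding eigenvalue_mset_def
    by (subst sum_comp_morphism[of "image_mset uminus", symmetric]) (simp_all add: o_def)
  also have "\<dots> = eigenvalue_mset V S"
    unfolding eigenvalue_mset_def
    by (rule sum.reindex_bij_witness[of _ uminus uminus])
      (auto simp: eigenvalues_iff_dim[OF sub] sym)
  finally show ?thesis .
qed

lemma eigenspace_normal:
  fixes p :: "'f::conjugation_algebra^4^4"
  assumes p: "p \<in> cubic_zeros"
  defines "Eig \<equiv> \<lambda>t. eigenspace (tangent_space cubic_zeros p) (shape_operator S4 cubic_zeros p (t *\<^sub>R normal_field p))"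
  shows "t \<noteq> 0 \<Longrightarrow> Eig t \<kappa> = curvature_space p (\<kappa> / t)"
    and "Eig 0 \<kappa> = (if \<kappa> = 0 then regular_tangent p else {0})"
proof -
  have g: "gap p \<noteq> 0" using gap_bounds(1)[OF p] by simp
  show "Eig t \<kappa> = curvature_space p (\<kappa> / t)" if "t \<noteq> 0"
    unfolding Eig_def eigenspace_shape_operator_cubic_zeros[OF p] curvature_space_def
    using that by (intro Collect_cong conj_cong refl ball_cong) (auto simp: field_simps)
  have "v = 0" if "v \<in> regular_tangent p" "\<forall>w\<in>regular_tangent p. \<kappa> = 0 \<or> inner v w = 0" "\<kappa> \<noteq> 0" for v
    using that by auto
  then show "Eig 0 \<kappa> = (if \<kappa> = 0 then regular_tangent p else {0})"
    unfolding Eig_def eigenspace_shape_operator_cubic_zeros[OF p]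
    using g subspace_0[OF subspace_regular_tangent, of p] by auto
qed

lemma austere_cubic_zeros: "austere S4 (cubic_zeros :: ('f::conjugation_algebra^4^4) set)"
  unfolding austere_def
proof (intro ballI allI impI)
  fix p \<xi> :: "'f^4^4" and \<mu> d f
  assume p: "p \<in> cubic_zeros" and xi: "\<xi> \<in> normal_space S4 cubic_zeros p"
    and \<mu>: "mset \<mu> = eigenvalue_mset (tangent_space cubic_zeros p) (shape_operator S4 cubic_zeros p \<xi>)"
    and f: "odd d \<and> homogeneous_symmetric_poly (length \<mu>) d f"
  obtain t where t: "\<xi> = t *\<^sub>R normal_field p" using xi unfolding normal_space_cubic_zeros[OF p] by blast
  let ?E = "eigenspace (tangent_space cubic_zeros p) (shape_operator S4 cubic_zeros p \<xi>)"
  have "subspace (?E \<kappa>) \<and> dim (?E (- \<kappa>)) = dim (?E \<kappa>)" for \<kappa>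
  proof (cases "t = 0")
    case True
    then show ?thesis using eigenspace_normal(2)[OF p]
      by (simp add: t subspace_regular_tangent)
  next
    case False
    then show ?thesis
      unfolding t eigenspace_normal(1)[OF p False] dim_curvature_space[OF p]
      by (simp add: subspace_curvature_space nonzero_curvatures_uminus)
  qed
  then have "image_mset uminus (mset \<mu>) = mset \<mu>"
    unfolding \<mu> by (intro eigenvalue_mset_uminus) auto
  then show "f (\<lambda>i. \<mu> ! i) = 0" using odd_symmetric_poly_vanishes f by blast
qed

section \<open>Orientability of the orbit\<close>

lemma continuous_on_normal_field: "continuous_on cubic_zeros (normal_field :: 'f::conjugation_algebra^4^4 \<Rightarrow> _)"
proof -
  obtain U where "cubic_zeros \<subseteq> U" "smooth_on U (normal_field :: 'f^4^4 \<Rightarrow> _)"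
    by (rule smooth_normal_field)
  then show ?thesis using smooth_on_imp_continuous_on continuous_on_subset by blast
qed

text \<open>
  The position vector, the unit normal and a constant orthonormal basis of the complement of
  \<open>E4\<close> form the normal frame.
\<close>

lemma orientable_cubic_zeros:
  "orientable (6 * DIM('f) + 1) (cubic_zeros :: ('f::conjugation_algebra^4^4) set)"
proof -
  define O' :: "('f^4^4) set" where "O' = {y \<in> UNIV. \<forall>x\<in>E4. orthogonal x y}"
  have dO: "dim O' + (6 * DIM('f) + 3) = DIM('f^4^4)"
  proof -
    have "dim O' + dim (E4 :: ('f^4^4) set) = dim (UNIV :: ('f^4^4) set)"
      unfolding O'_def by (rule dim_subspace_orthogonal_to_vectors[OF subspace_E4 subspace_UNIV subset_UNIV])
    then show ?thesis by (simp add: dim_E4)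
  qed
  have sO: "subspace O'" by (auto simp: O'_def subspace_def orthogonal_def inner_add_right)
  obtain B where B: "B \<subseteq> O'" "pairwise orthogonal B" "\<And>x. x \<in> B \<Longrightarrow> norm x = 1"
    "independent B" "card B = dim O'" "span B = O'"
    using orthonormal_basis_subspace[OF sO] by metis
  obtain b where b: "bij_betw b {..<dim O'} B"
    using ex_bij_betw_nat_finite[of B] B(4,5) independent_imp_finite by (metis atLeast0LessThan)
  have bO: "b i \<in> O'" if "i < dim O'" for i using b B(1) that by (auto simp: bij_betw_def)
  have bo: "inner (b i) (b j) = (if i = j then 1 else 0)" if "i < dim O'" "j < dim O'" for i j
  proof (cases "i = j")
    case True
    then show ?thesis using b B(3)[of "b i"] that by (auto simp: bij_betw_def norm_eq_1)
  next
    case False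
    then have "b i \<noteq> b j" "b i \<in> B" "b j \<in> B" using b that by (auto simp: bij_betw_def inj_on_def)
    then show ?thesis using B(2) False by (auto simp: pairwise_def orthogonal_def)
  qed
  have E_b: "inner v (b i) = 0" "inner (b i) v = 0" if "v \<in> E4" "i < dim O'" for v i
    using bO[OF that(2)] that(1) by (auto simp: O'_def orthogonal_def inner_commute)
  have E_iff: "v \<in> E4 \<longleftrightarrow> (\<forall>i<dim O'. inner v (b i) = 0)" for v
  proof
    assume v: "\<forall>i<dim O'. inner v (b i) = 0"
    obtain y z where yz: "v = y + z" "y \<in> span E4" "\<And>w. w \<in> span E4 \<Longrightarrow> orthogonal z w"
      using orthogonal_subspace_decomp_exists[of E4 v] by metis
    have sE: "span (E4 :: ('f^4^4) set) = E4" using subspace_E4 by (simp only: span_eq_iff)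
    have yE: "y \<in> E4" using yz(2) unfolding sE .
    have zO: "z \<in> O'" using yz(3) by (auto simp: O'_def span_base orthogonal_commute)
    have "orthogonal v x" if "x \<in> B" for x
      using v b that by (auto simp: bij_betw_def orthogonal_def)
    then have "orthogonal v z"
      using zO B(6) orthogonal_to_span[of z B v] by (simp add: orthogonal_commute)
    moreover have "inner y z = 0" using yz(3)[of y] yz(2) by (simp add: orthogonal_def inner_commute)
    ultimately have "inner z z = 0" unfolding yz(1) by (simp add: orthogonal_def inner_add_left)
    then show "v \<in> E4" using yE yz(1) by simp
  qed (use E_b in auto)
  define g where "g = (\<lambda>i p :: 'f^4^4. if i = 0 then p else if i = 1 then normal_field p else b (i - 2))"
  show ?thesis
  proof (rule orientable_of_orthonormal_normal_frame[where g = g and r = "dim O' + 2"])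
    show "6 * DIM('f) + 1 + (dim O' + 2) = DIM('f^4^4)" using dO by simp
    show "continuous_on cubic_zeros (g i)" for i
      unfolding g_def
      by (cases "i = 0"; cases "i = 1") (simp_all add: continuous_on_normal_field)
    show "dim (tangent_space cubic_zeros p) = 6 * DIM('f) + 1" if "p \<in> cubic_zeros" for p :: "'f^4^4"
      using tangent_space_subspace_dim(2)[OF embedded_submanifold_cubic_zeros that] .
    fix p :: "'f^4^4" assume p: "p \<in> cubic_zeros"
    then have pE: "p \<in> E4" "inner p p = 1" by (auto simp: cubic_zeros_def S4_altdef)
    note n = normal_field_inner[OF p]
    show "inner (g i p) (g j p) = (if i = j then 1 else 0)" if "i < dim O' + 2" "j < dim O' + 2" for i j
    proof -
      have ij: "i = 0 \<or> i = 1 \<or> (\<exists>i'. i = i' + 2 \<and> i' < dim O')"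
        "j = 0 \<or> j = 1 \<or> (\<exists>j'. j = j' + 2 \<and> j' < dim O')"
        using that by presburger+
      have g: "g 0 p = p" "g 1 p = normal_field p" "g (Suc (Suc l)) p = b l" for l
        by (simp_all add: g_def)
      have "inner p (normal_field p) = 0" using n(3) by (simp add: inner_commute)
      then show ?thesis
        using ij by (elim disjE exE conjE) (simp_all add: g pE n(3,4) E_b[OF pE(1)] E_b[OF n(2)] bo del: One_nat_def)
    qed
    have all: "(\<forall>i<dim O' + 2. Q i) \<longleftrightarrow> Q 0 \<and> Q 1 \<and> (\<forall>i<dim O'. Q (i + 2))" for Q
      unfolding add_2_eq_Suc' All_less_Suc2 One_nat_def by simp
    have "v \<in> regular_tangent p \<longleftrightarrow> inner v p = 0 \<and> inner v (normal_field p) = 0 \<and> v \<in> E4" for v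
      using n(5)[of v] gap_bounds(1)[OF p]
      by (auto simp: regular_tangent_def inner_commute[of v p] inner_commute[of v "normal_field p"])
    then show "tangent_space cubic_zeros p = {v. \<forall>i<dim O' + 2. inner v (g i p) = 0}"
      unfolding tangent_space_cubic_zeros[OF p] all by (auto simp: g_def E_iff)
  qed simp
qed

section \<open>Principal curvatures and the Dupin condition\<close>

lemma unit_normal_field_normal_field:
  "unit_normal_field S4 cubic_zeros (normal_field :: 'f::conjugation_algebra^4^4 \<Rightarrow> _)"
  unfolding unit_normal_field_def
proof (intro ballI conjI)
  fix p :: "'f^4^4" assume p: "p \<in> cubic_zeros"
  show "normal_field p \<in> normal_space S4 cubic_zeros p"
    unfolding normal_space_cubic_zeros[OF p] by (metis rangeI scaleR_one)
  show "norm (normal_field p) = 1" using normal_field_inner(4)[OF p] by (simp add: norm_eq_1)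
  obtain U where "open U" "cubic_zeros \<subseteq> U" "smooth_on U (normal_field :: 'f^4^4 \<Rightarrow> _)"
    by (rule smooth_normal_field)
  then show "\<exists>U X. open U \<and> p \<in> U \<and> smooth_on U X \<and> (\<forall>q\<in>U \<inter> cubic_zeros. X q = normal_field q)"
    using p by (intro exI[of _ U] exI[of _ normal_field]) auto
qed

text \<open>
  The factor relating two unit normal fields is a continuous function with values in
  \<open>{1, -1}\<close> on a connected set.
\<close>

lemma unit_normal_field_sign:
  fixes \<nu> :: "'f::conjugation_algebra^4^4 \<Rightarrow> 'f^4^4"
  assumes \<nu>: "unit_normal_field S4 cubic_zeros \<nu>"
  obtains \<sigma> where "\<sigma> * \<sigma> = (1::real)" "\<And>p. p \<in> cubic_zeros \<Longrightarrow> \<nu> p = \<sigma> *\<^sub>R normal_field p"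
proof -
  define s where "s = (\<lambda>p. inner (\<nu> p) (normal_field p))"
  have s: "\<nu> p = s p *\<^sub>R normal_field p" "s p * s p = 1" if p: "p \<in> cubic_zeros" for p
  proof -
    have "\<nu> p \<in> range (\<lambda>t. t *\<^sub>R normal_field p)" "inner (\<nu> p) (\<nu> p) = 1"
      using \<nu> p unfolding unit_normal_field_def normal_space_cubic_zeros[OF p, symmetric]
      by (auto simp: norm_eq_1)
    then show "\<nu> p = s p *\<^sub>R normal_field p" "s p * s p = 1"
      using normal_field_inner(4)[OF p] by (auto simp: s_def)
  qed
  have "continuous_on cubic_zeros \<nu>"
    unfolding continuous_on_def
  proof
    fix p :: "'f^4^4" assume p: "p \<in> cubic_zeros"
    then obtain U X where U: "open U" "p \<in> U" "smooth_on U X" "\<forall>q\<in>U \<inter> cubic_zeros. X q = \<nu> q"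
      using \<nu> unfolding unit_normal_field_def by blast
    have "(X \<longlongrightarrow> X p) (at p)"
      using smooth_on_imp_continuous_on[OF U(3)] U(1,2) by (simp add: continuous_on_eq_continuous_at isCont_def)
    then have "(X \<longlongrightarrow> X p) (at p within cubic_zeros)"
      using tendsto_within_subset by blast
    then have "(\<nu> \<longlongrightarrow> X p) (at p within cubic_zeros)"
      by (rule Lim_transform_within_openin[OF _ openin_open_Int[OF U(1), of cubic_zeros]]) (use p U in auto)
    then show "(\<nu> \<longlongrightarrow> \<nu> p) (at p within cubic_zeros)" using U p by auto
  qed
  then have "continuous_on cubic_zeros s"
    unfolding s_def by (intro continuous_on_inner continuous_on_normal_field)
  moreover have "s ` cubic_zeros \<subseteq> {1, - 1}"
    using s(2) by (auto simp: square_eq_1_iff)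
  ultimately have "s constant_on cubic_zeros"
    using continuous_finite_range_constant[OF connected_cubic_zeros, of s] finite_subset[of "s ` cubic_zeros" "{1, - 1}"]
    by simp
  then obtain \<sigma> where \<sigma>: "\<And>p. p \<in> cubic_zeros \<Longrightarrow> s p = \<sigma>" by (auto simp: constant_on_def)
  have "(cubic_zeros :: ('f^4^4) set) \<noteq> {}" using not_compact_cubic_zeros by (metis compact_empty)
  then show thesis using that[of \<sigma>] s \<sigma> by (metis ex_in_conv)
qed

context
  fixes \<nu> :: "'f::conjugation_algebra^4^4 \<Rightarrow> 'f^4^4" and \<sigma> :: real
  assumes \<sigma>: "\<sigma> * \<sigma> = 1" and \<nu>: "\<And>p. p \<in> cubic_zeros \<Longrightarrow> \<nu> p = \<sigma> *\<^sub>R normal_field p"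
begin

lemma principal_space_eq:
  assumes p: "p \<in> cubic_zeros"
  shows "principal_space S4 cubic_zeros \<nu> p \<kappa> = curvature_space p (\<sigma> * \<kappa>)"
proof -
  have "\<sigma> \<noteq> 0" "\<kappa> / \<sigma> = \<sigma> * \<kappa>" using \<sigma> by (auto simp: square_eq_1_iff)
  then show ?thesis
    using eigenspace_normal(1)[OF p] by (simp add: principal_space_def \<nu>[OF p])
qed

lemma dim_principal_space:
  assumes p: "p \<in> cubic_zeros"
  shows "dim (principal_space S4 cubic_zeros \<nu> p \<kappa>)
    = (if \<kappa> = 0 then 2 * DIM('f) + 1 else if \<kappa> \<in> nonzero_curvatures (gap p) then DIM('f) else 0)"
proof -
  have "\<sigma> = 1 \<or> \<sigma> = - 1" using \<sigma> by (simp add: square_eq_1_iff)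
  then show ?thesis
    unfolding principal_space_eq[OF p] dim_curvature_space[OF p]
    by (auto simp: nonzero_curvatures_uminus)
qed

lemma principal_curvatures_eq:
  assumes p: "p \<in> cubic_zeros"
  shows "principal_curvatures S4 cubic_zeros \<nu> p = insert 0 (nonzero_curvatures (gap p))"
proof -
  have "\<kappa> \<in> principal_curvatures S4 cubic_zeros \<nu> p \<longleftrightarrow> dim (principal_space S4 cubic_zeros \<nu> p \<kappa>) \<noteq> 0" for \<kappa>
  proof -
    have "subspace (principal_space S4 cubic_zeros \<nu> p \<kappa>)"
      unfolding principal_space_eq[OF p] by (rule subspace_curvature_space)
    then show ?thesis
      unfolding principal_curvatures_def principal_space_def by (rule eigenvalues_iff_dim)
  qed
  then show ?thesis unfolding set_eq_iff dim_principal_space[OF p] by simp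
qed

lemma principal_curvatures_card:
  assumes p: "p \<in> cubic_zeros"
  shows "finite (principal_curvatures S4 cubic_zeros \<nu> p)" "card (principal_curvatures S4 cubic_zeros \<nu> p) = 5"
  using nonzero_curvatures_distinct[OF gap_bounds(1,2)[OF p]]
  by (simp_all add: principal_curvatures_eq[OF p] finite_nonzero_curvatures)

lemma principal_multiplicities_eq:
  assumes p: "p \<in> cubic_zeros"
  shows "principal_multiplicities S4 cubic_zeros \<nu> p
    = {#DIM('f), DIM('f), DIM('f), DIM('f), 2 * DIM('f) + 1#}"
proof -
  let ?K = "nonzero_curvatures (gap p)"
  note K = nonzero_curvatures_distinct[OF gap_bounds(1,2)[OF p]]
  have "{#dim (principal_space S4 cubic_zeros \<nu> p \<kappa>). \<kappa> \<in># mset_set ?K#} = {#DIM('f). \<kappa> \<in># mset_set ?K#}"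
    using K(2) by (intro image_mset_cong) (auto simp: dim_principal_space[OF p] finite_nonzero_curvatures)
  also have "\<dots> = replicate_mset 4 DIM('f)" using K(1) by (simp add: image_mset_const_eq)
  finally show ?thesis
    unfolding principal_multiplicities_def principal_curvatures_eq[OF p]
    using K(2) by (simp add: finite_nonzero_curvatures dim_principal_space[OF p] numeral_eq_Suc)
qed

text \<open>
  A curvature surface has constant dimension, so either its curvature is 0 throughout or nowhere.
  In the second case a nearby point is reached, in a slice chart, by a straight line. Its image
  \<open>\<gamma>\<close> has nonvanishing velocity \<open>D\<close> in the curvature spaces, so
  \<open>gap\<close> is constant along it, and the curvature is a continuous function of
  \<open>\<gamma>\<close> and \<open>D\<close> with values in the finite set that
  \<open>gap\<close> determines. Hence the curvature is locally constant, and the surface is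
  connected.
\<close>

lemma dupin_cubic_zeros: "dupin S4 cubic_zeros \<nu>"
  unfolding dupin_def
proof (intro allI impI)
  fix T assume "curvature_surface S4 cubic_zeros \<nu> T"
  then have sub: "topspace T \<subseteq> cubic_zeros" and conn: "connected_space T"
    and ex\<kappa>: "\<forall>p\<in>topspace T. \<exists>\<kappa>\<in>principal_curvatures S4 cubic_zeros \<nu> p.
        immersed_tangent_space T p = principal_space S4 cubic_zeros \<nu> p \<kappa>"
    and "\<exists>k. immersed_submanifold k T"
    by (auto simp: curvature_surface_def)
  then obtain k where k: "immersed_submanifold k T" by blast
  obtain \<kappa> where pc: "\<And>p. p \<in> topspace T \<Longrightarrow> \<kappa> p \<in> principal_curvatures S4 cubic_zeros \<nu> p"
    and tan: "\<And>p. p \<in> topspace T \<Longrightarrow> immersed_tangent_space T p = principal_space S4 cubic_zeros \<nu> p (\<kappa> p)"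
    using ex\<kappa> by metis
  have nbhd: "\<exists>W. openin T W \<and> p \<in> W \<and> embedded_submanifold k W \<and> subtopology T W = top_of_set W"
    if "p \<in> topspace T" for p
    using k that by (auto simp: immersed_submanifold_def)
  have dimk: "dim (principal_space S4 cubic_zeros \<nu> p (\<kappa> p)) = k" if p: "p \<in> topspace T" for p
  proof -
    obtain W where "openin T W" "p \<in> W" "embedded_submanifold k W" "subtopology T W = top_of_set W"
      using nbhd[OF p] by blast
    note W = this
    show ?thesis
      using tangent_space_subspace_dim(2)[OF W(3,2)]
      unfolding tan[OF p, symmetric] immersed_tangent_space_openin[OF W(1,2,4)] .
  qed
  show "\<exists>\<kappa>. \<forall>p\<in>topspace T. \<kappa> \<in> principal_curvatures S4 cubic_zeros \<nu> p \<and>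
        immersed_tangent_space T p = principal_space S4 cubic_zeros \<nu> p \<kappa>"
  proof (cases "\<exists>p\<in>topspace T. \<kappa> p = 0")
    case True
    then obtain p where "p \<in> topspace T" "\<kappa> p = 0" by blast
    then have "k = 2 * DIM('f) + 1" using dimk[of p] dim_principal_space[of p 0] sub by auto
    then have z: "\<kappa> p = 0" if "p \<in> topspace T" for p
      using dimk[OF that] unfolding dim_principal_space[OF subsetD[OF sub that]]
      by (simp split: if_split_asm)
    show ?thesis
    proof (intro exI[of _ 0] ballI)
      fix p assume p: "p \<in> topspace T"
      show "0 \<in> principal_curvatures S4 cubic_zeros \<nu> p \<and>
          immersed_tangent_space T p = principal_space S4 cubic_zeros \<nu> p 0"
        using pc[OF p] tan[OF p] unfolding z[OF p] by (rule conjI)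
    qed
  next
    case False
    have loc: "\<exists>V. openin T V \<and> p \<in> V \<and> (\<forall>q\<in>V. \<kappa> q = \<kappa> p)" if p: "p \<in> topspace T" for p
    proof -
      obtain W where W: "openin T W" "p \<in> W" "embedded_submanifold k W" "subtopology T W = top_of_set W"
        using nbhd[OF p] by blast
      obtain U \<phi> \<psi> L where c: "slice_chart W U \<phi> \<psi> L" and pU: "p \<in> U"
        using W(2,3) unfolding embedded_submanifold_slice_chart by blast
      have c': "open U" "open (\<phi> ` U)" "smooth_on U \<phi>" "smooth_on (\<phi> ` U) \<psi>" "\<And>x. x \<in> U \<Longrightarrow> \<psi> (\<phi> x) = x" "subspace L"
        using c by (auto simp: slice_chart_def)
      obtain e where e: "0 < e" "ball (\<phi> p) e \<subseteq> \<phi> ` U"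
        using c'(2) pU by (meson image_eqI open_contains_ball)
      define V where "V = W \<inter> (U \<inter> \<phi> -` ball (\<phi> p) e)"
      have "open (U \<inter> \<phi> -` ball (\<phi> p) e)"
        using c' by (intro continuous_open_preimage smooth_on_imp_continuous_on) auto
      then have "openin (subtopology T W) V" unfolding W(4) V_def by (rule openin_open_Int)
      then have V: "openin T V" "p \<in> V"
        using W(1,2) pU e(1) openin_trans_full by (auto simp: V_def)
      have "\<kappa> q = \<kappa> p" if q: "q \<in> V" for q
      proof (cases "q = p")
        case qp: False
        define l where "l = \<phi> q - \<phi> p"
        have qU: "q \<in> U" "q \<in> W" "dist (\<phi> p) (\<phi> q) < e" using q by (auto simp: V_def)
        have l0: "l \<noteq> 0" using qp c'(5)[OF pU] c'(5)[OF qU(1)] by (auto simp: l_def)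
        have L: "\<phi> p \<in> L" "l \<in> L"
          using slice_chart_mem[OF c pU] slice_chart_mem[OF c qU(1)] W(2) qU(2) c'(6)
          by (auto simp: l_def subspace_diff)
        define r where "r = e / norm l"
        have r1: "1 < r" using qU(3) l0 by (simp add: r_def l_def dist_norm norm_minus_commute)
        define J where "J = {-r<..<r}"
        have line: "\<phi> p + t *\<^sub>R l \<in> \<phi> ` U" if "t \<in> J" for t
        proof -
          have "\<bar>t\<bar> < e / norm l" using that by (auto simp: J_def r_def)
          then have "\<bar>t\<bar> * norm l < e" using l0 by (simp add: pos_less_divide_eq)
          then show ?thesis using e(2) by (auto simp: dist_norm)
        qed
        have J: "open J" "connected J" "0 \<in> J" "1 \<in> J" using r1 by (auto simp: J_def)
        define \<gamma> where "\<gamma> = (\<lambda>t. \<psi> (\<phi> p + t *\<^sub>R l))"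
        define D where "D = (\<lambda>t. frechet_derivative \<psi> (at (\<phi> p + t *\<^sub>R l)) l)"
        have sl: "smooth_on J \<gamma>" "t \<in> J \<Longrightarrow> \<gamma> t \<in> U \<inter> W"
          "t \<in> J \<Longrightarrow> (\<gamma> has_vector_derivative D t) (at t)" for t
          unfolding \<gamma>_def D_def using slice_chart_line[OF c L J(1)] line by blast+
        have \<gamma>T: "\<gamma> t \<in> topspace T" if "t \<in> J" for t
          using sl(2)[OF that] W(1) openin_subset by blast
        have \<gamma>B: "\<gamma> t \<in> cubic_zeros" if "t \<in> J" for t using \<gamma>T[OF that] sub by blast
        have \<phi>\<gamma>: "\<phi> (\<gamma> t) = \<phi> p + t *\<^sub>R l" if "t \<in> J" for t
          using line[OF that] c'(5) by (auto simp: \<gamma>_def)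
        have Dcs: "D t \<in> curvature_space (\<gamma> t) (\<sigma> * \<kappa> (\<gamma> t))" if t: "t \<in> J" for t
        proof -
          have g: "\<gamma> t \<in> U" "\<gamma> t \<in> W" using sl(2)[OF t] by auto
          have "D t \<in> tangent_space W (\<gamma> t)"
            unfolding tangent_space_slice_chart[OF c g] \<phi>\<gamma>[OF t] D_def using L(2) by blast
          then show ?thesis
            using immersed_tangent_space_openin[OF W(1) g(2) W(4)] tan[OF \<gamma>T[OF t]]
              principal_space_eq[OF \<gamma>B[OF t]] by simp
        qed
        have D0: "D t \<noteq> 0" if t: "t \<in> J" for t
        proof
          assume D: "D t = 0"
          have g: "\<gamma> t \<in> U" using sl(2)[OF t] by auto
          have "frechet_derivative \<phi> (at (\<gamma> t)) (D t) = l"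
            using slice_chart_inverse_derivatives(2)[OF c g, of l] by (simp add: \<phi>\<gamma>[OF t] D_def)
          moreover have "linear (frechet_derivative \<phi> (at (\<gamma> t)))"
            using smooth_on_has_derivative[OF c'(3) g] has_derivative_linear by blast
          ultimately show False using D l0 linear_0 by metis
        qed
        have \<kappa>0: "\<sigma> * \<kappa> (\<gamma> t) \<noteq> 0" if "t \<in> J" for t
          using False \<gamma>T[OF that] \<sigma> by auto
        have "((\<lambda>t. quartic (\<gamma> t)) has_real_derivative 0) (at t)" if t: "t \<in> J" for t
        proof -
          have h: "adjoint_matrix (\<gamma> t) = \<gamma> t" using \<gamma>B[OF t] by (simp add: cubic_zeros_def S4_def E4_def)
          have "((\<lambda>t. quartic (\<gamma> t)) has_derivative (\<lambda>s. 4 * inner (\<gamma> t ** \<gamma> t ** \<gamma> t) (s *\<^sub>R D t))) (at t)"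
            using has_derivative_compose[OF sl(3)[OF t, unfolded has_vector_derivative_def] quartic_has_derivative[OF h]] .
          then show ?thesis
            using curvature_space_cube_orthogonal[OF \<gamma>B[OF t] Dcs[OF t] \<kappa>0[OF t]]
            by (simp add: has_field_derivative_def lambda_zero)
        qed
        then have "quartic (\<gamma> t) = quartic (\<gamma> 0)" if "t \<in> J" for t
          using DERIV_isconst3[of "-r" r t 0 "\<lambda>t. quartic (\<gamma> t)"] that J(3) r1 by (simp add: J_def)
        then have gap: "gap (\<gamma> t) = gap (\<gamma> 0)" if "t \<in> J" for t using that by (simp add: gap_def)
        have g0: "0 < gap (\<gamma> 0)" using gap_bounds(1)[OF \<gamma>B[OF J(3)]] .
        (* Test the weak eigenvalue equation for D with D itself. *)
        have \<kappa>_eq: "\<kappa> (\<gamma> t) = - \<sigma> * inner (\<gamma> t ** D t + D t ** \<gamma> t) (D t) / (gap (\<gamma> 0) * inner (D t) (D t))"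
          if t: "t \<in> J" for t
        proof -
          have "inner (\<gamma> t ** D t + D t ** \<gamma> t) (D t) = - (\<sigma> * \<kappa> (\<gamma> t)) * gap (\<gamma> 0) * inner (D t) (D t)"
            using Dcs[OF t] gap[OF t] unfolding curvature_space_def by auto
          then have "- \<sigma> * inner (\<gamma> t ** D t + D t ** \<gamma> t) (D t) = (\<sigma> * \<sigma>) * \<kappa> (\<gamma> t) * (gap (\<gamma> 0) * inner (D t) (D t))"
            by (simp add: algebra_simps)
          then show ?thesis using \<sigma> g0 D0[OF t] by simp
        qed
        have cD: "continuous_on J D"
          unfolding D_def using c'(4) line
          by (intro continuous_on_compose2[OF smooth_on_imp_continuous_on[OF smooth_on_frechet_derivative[OF c'(4), of l]]]
              continuous_intros) auto
        have c\<gamma>: "continuous_on J \<gamma>" using smooth_on_imp_continuous_on[OF sl(1)] .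
        have "continuous_on J (\<lambda>t. - \<sigma> * inner (\<gamma> t ** D t + D t ** \<gamma> t) (D t) / (gap (\<gamma> 0) * inner (D t) (D t)))"
          using g0 D0 by (intro continuous_intros bounded_bilinear.continuous_on[OF bounded_bilinear_matrix_mult] cD c\<gamma>) auto
        then have c\<kappa>: "continuous_on J (\<lambda>t. \<kappa> (\<gamma> t))"
          by (rule continuous_on_eq) (simp add: \<kappa>_eq)
        have "(\<lambda>t. \<kappa> (\<gamma> t)) ` J \<subseteq> insert 0 (nonzero_curvatures (gap (\<gamma> 0)))"
          using pc[OF \<gamma>T] principal_curvatures_eq[OF \<gamma>B] gap by fastforce
        then have "finite ((\<lambda>t. \<kappa> (\<gamma> t)) ` J)"
          by (rule finite_subset) (simp add: finite_nonzero_curvatures)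
        from continuous_finite_range_constant[OF J(2) c\<kappa> this]
        have "\<kappa> (\<gamma> 1) = \<kappa> (\<gamma> 0)" using J(3,4) by (auto simp: constant_on_def)
        then show ?thesis using c'(5)[OF pU] c'(5)[OF qU(1)] by (simp add: \<gamma>_def l_def)
      qed simp
      then show ?thesis using V by blast
    qed
    have const: "\<kappa> q = \<kappa> p" if p: "p \<in> topspace T" and q: "q \<in> topspace T" for p q
    proof (rule ccontr)
      assume ne: "\<kappa> q \<noteq> \<kappa> p"
      have op: "openin T {x \<in> topspace T. Q (\<kappa> x)}" for Q
      proof (subst openin_subopen, intro ballI)
        fix x assume x: "x \<in> {x \<in> topspace T. Q (\<kappa> x)}"
        then obtain V where V: "openin T V" "x \<in> V" "\<forall>y\<in>V. \<kappa> y = \<kappa> x" using loc by blast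
        have "V \<subseteq> {x \<in> topspace T. Q (\<kappa> x)}"
        proof
          fix y assume y: "y \<in> V"
          then have "\<kappa> y = \<kappa> x" "y \<in> topspace T" using V openin_subset by blast+
          then show "y \<in> {x \<in> topspace T. Q (\<kappa> x)}" using x by simp
        qed
        with V show "\<exists>V. openin T V \<and> x \<in> V \<and> V \<subseteq> {x \<in> topspace T. Q (\<kappa> x)}" by blast
      qed
      have "\<not> connected_space T"
        unfolding connected_space_def not_not
        using op[of "\<lambda>y. y = \<kappa> p"] op[of "\<lambda>y. y \<noteq> \<kappa> p"] p q ne by blast
      with conn show False by simp
    qed
    show ?thesis
    proof (cases "topspace T = {}")
      case nonempty: False
      then obtain p where p: "p \<in> topspace T" by blast
      show ?thesis
      proof (intro exI[of _ "\<kappa> p"] ballI)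
        fix q assume q: "q \<in> topspace T"
        show "\<kappa> p \<in> principal_curvatures S4 cubic_zeros \<nu> q \<and>
            immersed_tangent_space T q = principal_space S4 cubic_zeros \<nu> q (\<kappa> p)"
          using pc[OF q] tan[OF q] unfolding const[OF p q] by (rule conjI)
      qed
    qed simp
  qed
qed

end

theorem cubic_zeros_hypersurface:
  defines "S \<equiv> (S4 :: ('f::conjugation_algebra^4^4) set)" and "B \<equiv> (cubic_zeros :: ('f^4^4) set)"
    and "m \<equiv> DIM('f)"
  shows "hypersurface (6 * m + 1) S B \<and> orientable (6 * m + 1) B \<and>
      connected B \<and> \<not> compact B \<and> austere S B \<and>
      (\<exists>\<nu>. unit_normal_field S B \<nu>) \<and>
      (\<forall>\<nu>. unit_normal_field S B \<nu> \<longrightarrow> proper_dupin S B \<nu> \<and>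
         (\<forall>p\<in>B. card (principal_curvatures S B \<nu> p) = 5 \<and>
            principal_multiplicities S B \<nu> p = {#m, m, m, m, 2 * m + 1#}))"
proof -
  have "hypersurface (6 * m + 1) S B"
    using embedded_submanifold_S4[where 'f = 'f] embedded_submanifold_cubic_zeros[where 'f = 'f]
    unfolding hypersurface_def S_def B_def m_def by (auto simp: cubic_zeros_def)
  moreover have "proper_dupin S B \<nu> \<and> (\<forall>p\<in>B. card (principal_curvatures S B \<nu> p) = 5 \<and>
      principal_multiplicities S B \<nu> p = {#m, m, m, m, 2 * m + 1#})" if u: "unit_normal_field S B \<nu>" for \<nu>
  proof -
    obtain \<sigma> where s: "\<sigma> * \<sigma> = (1::real)" "\<And>p. p \<in> B \<Longrightarrow> \<nu> p = \<sigma> *\<^sub>R normal_field p"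
      using unit_normal_field_sign[OF u[unfolded S_def B_def]] unfolding B_def by blast
    note r = dupin_cubic_zeros[OF s[unfolded B_def]] principal_curvatures_card[OF s[unfolded B_def]]
      principal_multiplicities_eq[OF s[unfolded B_def]]
    show ?thesis unfolding proper_dupin_def S_def B_def m_def using r by blast
  qed
  ultimately show ?thesis
    unfolding S_def B_def m_def
    using orientable_cubic_zeros connected_cubic_zeros not_compact_cubic_zeros austere_cubic_zeros
      unit_normal_field_normal_field by blast
qed

theorem theorem4p7:
  shows
  "(let m = DIM(real); S = (S4 :: (real^4^4) set); B = B4_tilde SO4 in
      hypersurface (6 * m + 1) S B \<and> orientable (6 * m + 1) B \<and>
      connected B \<and> \<not> compact B \<and> austere S B \<and>
      (\<exists>\<nu>. unit_normal_field S B \<nu>) \<and>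
      (\<forall>\<nu>. unit_normal_field S B \<nu> \<longrightarrow> proper_dupin S B \<nu> \<and>
         (\<forall>p\<in>B. card (principal_curvatures S B \<nu> p) = 5 \<and>
            principal_multiplicities S B \<nu> p = {#m, m, m, m, 2 * m + 1#}))) \<and>
   (let m = DIM(complex); S = (S4 :: (complex^4^4) set); B = B4_tilde U4 in
      hypersurface (6 * m + 1) S B \<and> orientable (6 * m + 1) B \<and>
      connected B \<and> \<not> compact B \<and> austere S B \<and>
      (\<exists>\<nu>. unit_normal_field S B \<nu>) \<and>
      (\<forall>\<nu>. unit_normal_field S B \<nu> \<longrightarrow> proper_dupin S B \<nu> \<and>
         (\<forall>p\<in>B. card (principal_curvatures S B \<nu> p) = 5 \<and>
            principal_multiplicities S B \<nu> p = {#m, m, m, m, 2 * m + 1#}))) \<and>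
   (let m = DIM(quat); S = (S4 :: (quat^4^4) set); B = B4_tilde Sp4 in
      hypersurface (6 * m + 1) S B \<and> orientable (6 * m + 1) B \<and>
      connected B \<and> \<not> compact B \<and> austere S B \<and>
      (\<exists>\<nu>. unit_normal_field S B \<nu>) \<and>
      (\<forall>\<nu>. unit_normal_field S B \<nu> \<longrightarrow> proper_dupin S B \<nu> \<and>
         (\<forall>p\<in>B. card (principal_curvatures S B \<nu> p) = 5 \<and>
            principal_multiplicities S B \<nu> p = {#m, m, m, m, 2 * m + 1#})))"
  unfolding Let_def U4_def Sp4_def B4_tilde_SO4 B4_tilde_unitary
  by (intro conjI[OF cubic_zeros_hypersurface[where 'f = real]]
      conjI[OF cubic_zeros_hypersurface[where 'f = complex] cubic_zeros_hypersurface[where 'f = quat]])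

end
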